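(* Let $p\ge 3$ be a prime, $0\le i\le p-1$, $r\ge (i+1)(p+1)$, and let $r_0$ be the constant term in the base $p$-expansion of $r$. If $r_0\ge i$, then $$\dim X_{r-i,\,r}=\begin{cases}(r_0+1)(\Sigma_p(r-r_0)+1), & \text{if } \Sigma_p(r-i)\le r_0,\\ (i+1)(\Sigma_p(r-i)+1), & \text{if } r_0\le \Sigma_p(r-i)\le p,\\ (i+1)(p+1), & \text{if } \Sigma_p(r-i)\ge p.\end{cases}$$ If $r_0<i$, then $$\dim X_{r-i,\,r}=\begin{cases}(p+r_0+1)\,\Sigma_p(r-r_0), & \text{if } \Sigma_p(r-i)<p,\\ (i-r_0)(p+1)+(\Sigma_p(r-r_0)+1)(r_0+1), & \text{if } \Sigma_p(r-i)\ge p,\ \Sigma_p(r-r_0)\le p,\\ (i+1)(p+1), & \text{if } \Sigma_p(r-i)\ge p,\ \Sigma_p(r-r_0)\ge p.\end{cases}$$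
   Context: Let $\Gamma=\mathrm{GL}_2(\mathbb{F}_p)$. $V_r$ is the $\mathbb{F}_p$-space of homogeneous polynomials $F(X,Y)$ of degree $r$ over $\mathbb{F}_p$, with action $\begin{pmatrix} a&b\\c&d\end{pmatrix}\cdot F(X,Y)=F(aX+cY,\,bX+dY)$ for $\begin{pmatrix} a&b\\c&d\end{pmatrix}\in\Gamma$. $X_{r-i,\,r}\subseteq V_r$ is the $\mathbb{F}_p[\Gamma]$-submodule generated by the monomial $X^{r-i}Y^{i}$; $\dim$ is dimension over $\mathbb{F}_p$. $\Sigma_p(n)$ is the sum of the digits of the base $p$-expansion of $n\ge0$. *)

theory Defs
  imports
    "HOL-Analysis.Analysis"
    "HOL-Computational_Algebra.Polynomial"
    "HOL-Computational_Algebra.Primes"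
begin

text \<open>
  The ring \<open>k[X,Y]\<close> is represented as \<open>k[X][Y]\<close>: the coefficient of \<open>X\<^sup>m Y\<^sup>n\<close> in \<open>F\<close> is
  \<open>coeff (coeff F n) m\<close>.
\<close>

type_synonym 'k bipoly = "'k poly poly"

definition bipoly_const :: "'k::comm_ring_1 \<Rightarrow> 'k bipoly"
  where "bipoly_const c = [:[:c:]:]"

definition bipoly_X :: "'k::comm_ring_1 bipoly"
  where "bipoly_X = [:[:0, 1:]:]"

definition bipoly_Y :: "'k::comm_ring_1 bipoly"
  where "bipoly_Y = [:0, 1:]"

definition bipoly_scale :: "'k::comm_ring_1 \<Rightarrow> 'k bipoly \<Rightarrow> 'k bipoly"
  where "bipoly_scale c F = bipoly_const c * F"

global_interpretation bipoly: vector_space "bipoly_scale :: 'k::field \<Rightarrow> 'k bipoly \<Rightarrow> 'k bipoly"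
  by unfold_locales (simp_all add: bipoly_scale_def bipoly_const_def smult_add_right
      smult_add_left[symmetric] one_pCons[symmetric])

text \<open>\<open>bipoly_subst P Q F\<close> is \<open>F(P, Q)\<close>.\<close>

definition bipoly_subst :: "'k::comm_ring_1 bipoly \<Rightarrow> 'k bipoly \<Rightarrow> 'k bipoly \<Rightarrow> 'k bipoly"
  where "bipoly_subst P Q F = poly (map_poly (\<lambda>f. poly (map_poly bipoly_const f) P) F) Q"

definition hom_polys :: "nat \<Rightarrow> 'k::comm_ring_1 bipoly set"
  where "hom_polys r = {F. \<forall>m n. coeff (coeff F n) m \<noteq> 0 \<longrightarrow> m + n = r}"

definition GL2 :: "('k::field ^ 2 ^ 2) set"
  where "GL2 = {g. invertible g}"

definition GL2_act :: "'k::field ^ 2 ^ 2 \<Rightarrow> 'k bipoly \<Rightarrow> 'k bipoly"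
  where "GL2_act g F =
    bipoly_subst
      (bipoly_scale (g $ 1 $ 1) bipoly_X + bipoly_scale (g $ 2 $ 1) bipoly_Y)
      (bipoly_scale (g $ 1 $ 2) bipoly_X + bipoly_scale (g $ 2 $ 2) bipoly_Y)
      F"

definition GL2_submodule :: "nat \<Rightarrow> 'k::field bipoly set \<Rightarrow> bool"
  where "GL2_submodule r W \<longleftrightarrow>
    W \<subseteq> hom_polys r \<and> bipoly.subspace W \<and> (\<forall>g\<in>GL2. \<forall>F\<in>W. GL2_act g F \<in> W)"

text \<open>\<open>monomial_submodule m n\<close> is \<open>X\<^bsub>m, m+n\<^esub>\<close>, generated by \<open>X\<^sup>m Y\<^sup>n\<close> inside \<open>V\<^bsub>m+n\<^esub>\<close>.\<close>

definition monomial_submodule :: "nat \<Rightarrow> nat \<Rightarrow> 'k::field bipoly set"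
  where "monomial_submodule m n = GL2_submodule (m + n) hull {bipoly_X ^ m * bipoly_Y ^ n}"

text \<open>
  The digit of \<open>n\<close> at \<open>p\<^sup>k\<close> is \<open>n div p ^ k mod p\<close>; for \<open>p \<ge> 2\<close> it vanishes when \<open>k > n\<close>,
  so the bound on \<open>k\<close> loses nothing.
\<close>

definition digit_sum :: "nat \<Rightarrow> nat \<Rightarrow> nat"
  where "digit_sum p n = (\<Sum>k\<le>n. n div p ^ k mod p)"

end

theory Submission
  imports Defs
begin

text \<open>
  Put \<open>s = r - i\<close>, and let \<open>V\<^sub>d\<close> be the space of forms of degree \<open>d\<close>.  The translates of
  \<open>X\<^sup>s Y\<^sup>i\<close> are the products \<open>L\<^sup>s M\<^sup>i\<close> of powers of independent linear forms, and because
  \<open>i < p\<close> the \<open>M\<^sup>i\<close> with \<open>M\<close> independent of a fixed \<open>L\<close> already span \<open>V\<^sub>i\<close>.  Hence the module is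
  the sum of the spaces \<open>L\<^sup>s V\<^sub>i\<close> over the \<open>p + 1\<close> points \<open>L\<close> of the projective line
  (\<open>monomial_submodule_eq_power_module\<close>), and its dimension is \<open>(i + 1) (p + 1)\<close> minus the
  dimension of the space of relations \<open>\<Sum> L\<^sup>s Q\<^sub>L = 0\<close> with \<open>Q\<^sub>L\<close> in \<open>V\<^sub>i\<close>.  In one variable, with \<open>X = 1\<close> and
  \<open>Y = z\<close>, the forms \<open>L\<close> become \<open>1 + t z\<close> and \<open>z\<close>.

  Digit sums enter because \<open>t\<^sup>k\<close>, for \<open>t\<close> in the prime field, depends only on the digit sum of
  \<open>k\<close>.  So \<open>(1 + t z)\<^sup>s = \<Sum>\<^sub>a t\<^sup>a H\<^sub>a(z)\<close>, where \<open>H\<^sub>a\<close> collects the terms of \<open>(1 + z)\<^sup>s\<close> whose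
  exponent has digit sum \<open>a\<close>, and \<open>a\<close> runs up to the digit sum \<open>\<sigma>\<close> of \<open>s\<close>.

  If \<open>\<sigma> \<le> p\<close>, a Vandermonde argument replaces the powers by the \<open>H\<^sub>a\<close>, so the module is spanned
  by the \<open>z\<^sup>j H\<^sub>a\<close> with \<open>j \<le> i\<close> and \<open>a \<le> \<sigma>\<close>.  Write \<open>s = s\<^sub>0 + p s'\<close> with \<open>s\<^sub>0 < p\<close>, and let
  \<open>N = \<sigma> - s\<^sub>0\<close> be the digit sum of \<open>s'\<close>.  If \<open>i \<le> N\<close> and \<open>s\<^sub>0 + i < p\<close>, these elements are
  independent (\<open>digit_parts_independent\<close>); if \<open>N \<le> i\<close> and \<open>\<sigma> < p\<close>, they span all products of a
  polynomial of degree at most \<open>s\<^sub>0 + i\<close> with the \<open>p\<close>-th power twist of the \<open>H\<close>-space of \<open>s'\<close>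
  (\<open>span_digit_parts_eq_span_twisted_parts\<close>), and these products form a space of dimension
  \<open>(s\<^sub>0 + i + 1) (N + 1)\<close> (\<open>twisted_parts_independent\<close>).  The independence and spanning statements are dual to each
  other and both follow from \<open>window_vanishing\<close>, which rests on the principle that a nonzero multiple of
  \<open>(1 + z)\<^sup>m\<close> of degree below \<open>p\<close> has more than \<open>m\<close> terms (\<open>few_terms\<close>).

  If \<open>\<sigma> \<ge> p\<close> and \<open>r \<ge> (i + 1) (p + 1)\<close>, every relation \<open>\<Sum> L\<^sup>s Q\<^sub>L = 0\<close> satisfies \<open>L dvd Q\<^sub>L\<close>.  By symmetry it suffices to treat
  one \<open>L\<close>, and then only exponents congruent to \<open>s\<close> modulo \<open>p - 1\<close> matter
  (\<open>vanishes_on_class_top\<close>).  Consequently passing from \<open>(s, i)\<close> to \<open>(s + 1, i - 1)\<close> lowers the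
  dimension by exactly \<open>p + 1\<close> (\<open>dim_power_module_step\<close>).  Iterating this, one either reaches the
  zero module, which gives \<open>(i + 1) (p + 1)\<close>, or, when \<open>r\<^sub>0 < i\<close> and the digit sum of \<open>r - r\<^sub>0\<close> is
  at most \<open>p\<close>, one stops at \<open>i = r\<^sub>0\<close>, where the previous paragraph applies.
\<close>

section \<open>Digit sums and binomial coefficients modulo p\<close>

lemma digit_sum_eq_sum_atMost:
  assumes "p \<ge> 2" "n \<le> K"
  shows "digit_sum p n = (\<Sum>k\<le>K. n div p ^ k mod p)"
  unfolding digit_sum_def
proof (rule sum.mono_neutral_left)
  show "\<forall>k\<in>{..K} - {..n}. n div p ^ k mod p = 0"
  proof
    fix k assume k: "k \<in> {..K} - {..n}"
    have "k < p ^ k"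
      using assms(1) by (intro power_gt_expt) auto
    then show "n div p ^ k mod p = 0" using k by (auto simp: not_le)
  qed
qed (use assms in auto)

lemma digit_sum_0 [simp]: "digit_sum p 0 = 0"
  by (simp add: digit_sum_def)

lemma digit_sum_mod_div:
  assumes "p \<ge> 2"
  shows "digit_sum p n = n mod p + digit_sum p (n div p)"
proof (cases n)
  case (Suc m)
  have le: "n div p \<le> m"
  proof -
    have "n div p < n" using assms Suc by (intro div_less_dividend) auto
    then show ?thesis using Suc by simp
  qed
  have "digit_sum p n = (\<Sum>k\<le>Suc m. n div p ^ k mod p)"
    using Suc by (simp add: digit_sum_def)
  also have "\<dots> = n mod p + (\<Sum>k\<le>m. n div p div p ^ k mod p)"
    by (subst sum.atMost_Suc_shift) (simp add: div_mult2_eq)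
  also have "(\<Sum>k\<le>m. n div p div p ^ k mod p) = digit_sum p (n div p)"
    using digit_sum_eq_sum_atMost[OF assms le] by simp
  finally show ?thesis .
qed simp

lemma digit_sum_add_mult:
  assumes "p \<ge> 2" "l < p"
  shows "digit_sum p (l + p * k) = l + digit_sum p k"
  using assms by (subst digit_sum_mod_div) auto

lemma digit_sum_eq_0_iff [simp]:
  assumes "p \<ge> 2"
  shows "digit_sum p n = 0 \<longleftrightarrow> n = 0"
proof (induction n rule: less_induct)
  case (less n)
  show ?case
  proof (cases "n = 0")
    case False
    then have "n div p < n" using assms by (intro div_less_dividend) auto
    then have "digit_sum p (n div p) = 0 \<longleftrightarrow> n div p = 0" by (rule less)
    moreover have "n mod p \<noteq> 0 \<or> n div p \<noteq> 0"
      using False by (metis add.right_neutral mod_mult_div_eq mult_0_right)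
    ultimately show ?thesis using False
      by (auto simp: digit_sum_mod_div[OF assms, of n])
  qed simp
qed

text \<open>
  The base satisfies \<open>p = 1\<close> modulo \<open>p - 1\<close>, so all powers of
  \<open>p\<close> have residue one.
\<close>

lemma digit_sum_cong_mod:
  assumes "p \<ge> 2"
  shows "digit_sum p n mod (p - 1) = n mod (p - 1)"
proof (induction n rule: less_induct)
  case (less n)
  show ?case
  proof (cases "n = 0")
    case False
    then have "n div p < n" using assms by (intro div_less_dividend) auto
    then have IH: "digit_sum p (n div p) mod (p - 1) = n div p mod (p - 1)" by (rule less)
    have "n = n mod p + p * (n div p)" by simp
    also have "\<dots> = (n mod p + n div p) + (p - 1) * (n div p)"
      using assms by (cases p) auto
    finally have "n mod (p - 1) = (n mod p + n div p) mod (p - 1)"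
      by (metis mod_mult_self2)
    also have "\<dots> = digit_sum p n mod (p - 1)"
      unfolding digit_sum_mod_div[OF assms, of n]
      by (metis IH mod_add_right_eq)
    finally show ?thesis by simp
  qed simp
qed

lemma coeff_linear_power: "coeff ([:1, 1:] ^ s :: 'a::comm_ring_1 poly) k = of_nat (s choose k)"
proof -
  have "[:1, 1:] ^ s = (monom 1 1 + 1 :: 'a poly) ^ s"
    by (simp add: monom_altdef one_pCons)
  also have "\<dots> = (\<Sum>j\<le>s. monom (of_nat (s choose j)) j)"
    by (subst binomial_ring) (simp add: monom_power of_nat_monom mult_monom)
  finally show ?thesis
    by (simp add: coeff_sum binomial_eq_0)
qed

lemma pcompose_power: "pcompose (f ^ n) g = pcompose f g ^ n"
  for f g :: "'a::comm_ring_1 poly"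
  by (induction n) (simp_all add: pcompose_mult pcompose_1)

text \<open>
  When \<open>deg f < 2 p\<close>, each coefficient of \<open>f(z) q(z\<^sup>p)\<close>
  receives at most two contributions: one from a low exponent of \<open>f\<close> and one
  carried over from an exponent between \<open>p\<close> and \<open>2 p\<close>.
\<close>

lemma coeff_mult_pcompose_monom:
  fixes f q :: "'a::comm_ring_1 poly"
  assumes f: "\<And>m. m \<ge> 2 * p \<Longrightarrow> coeff f m = 0" and l: "l < p"
  shows "coeff (f * pcompose q (monom 1 p)) (l + p * k) =
    coeff f l * coeff q k + (if k = 0 then 0 else coeff f (l + p) * coeff q (k - 1))"
proof (induction q arbitrary: k)
  case (pCons a q)
  have "f * pcompose (pCons a q) (monom 1 p) = smult a f + monom 1 p * (f * pcompose q (monom 1 p))"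
    by (simp add: pcompose_pCons algebra_simps)
  then have *: "coeff (f * pcompose (pCons a q) (monom 1 p)) (l + p * k)
     = a * coeff f (l + p * k) + coeff (monom 1 p * (f * pcompose q (monom 1 p))) (l + p * k)"
    by simp
  show ?case
  proof (cases k)
    case 0
    then show ?thesis using l unfolding * by (simp add: coeff_monom_mult)
  next
    case (Suc k')
    have "coeff (monom 1 p * (f * pcompose q (monom 1 p))) (l + p * k)
        = coeff (f * pcompose q (monom 1 p)) (l + p * k')"
      using Suc by (simp add: coeff_monom_mult)
    moreover have "coeff f (l + p * k) = 0" if "k' > 0"
    proof (rule f)
      have "p * 2 \<le> p * k" using that Suc by (intro mult_le_mono2) auto
      then show "l + p * k \<ge> 2 * p" by linarith
    qed
    ultimately show ?thesis unfolding * pCons.IH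
      using Suc by (cases k') (auto simp: add.commute)
  qed
qed simp

text \<open>
  The type argument \<open>K\<close> only serves to bind \<open>'k\<close> as the prime field
  with \<open>p\<close> elements.
\<close>

locale prime_field =
  fixes p :: nat and K :: "'k::{field, finite} itself"
  assumes prime_p: "prime p" and card_k: "CARD('k) = p"
begin

lemma p_ge_2: "p \<ge> 2"
  using prime_p by (rule prime_ge_2_nat)

lemma p_pos: "p > 0"
  using p_ge_2 by simp

lemmas digit_sum_split = digit_sum_add_mult[OF p_ge_2]

lemma digit_sum_lt_p: "l < p \<Longrightarrow> digit_sum p l = l"
  using digit_sum_split[of l 0] by simp

lemma char_k: "CHAR('k) = p"
proof -
  have "(\<Sum>x\<in>UNIV. x) = (\<Sum>x\<in>UNIV. x + 1 :: 'k)"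
    by (rule sum.reindex_bij_witness[of _ "\<lambda>x. x + 1" "\<lambda>x. x - 1"]) auto
  then have "of_nat CARD('k) = (0::'k)"
    by (simp add: sum.distrib)
  then have "CHAR('k) dvd p"
    by (simp add: of_nat_eq_0_iff_char_dvd card_k)
  moreover have "CHAR('k) \<noteq> 1"
    by (metis of_nat_1 of_nat_CHAR one_neq_zero)
  ultimately show ?thesis
    using prime_p by (auto simp: prime_nat_iff)
qed

lemma of_nat_eq_0_iff: "of_nat n = (0::'k) \<longleftrightarrow> p dvd n"
  by (simp add: of_nat_eq_0_iff_char_dvd char_k)

lemma of_nat_lt_p: "0 < n \<Longrightarrow> n < p \<Longrightarrow> of_nat n \<noteq> (0::'k)"
  using of_nat_eq_0_iff nat_dvd_not_less by auto

lemma of_nat_choose_neq_0: "k \<le> n \<Longrightarrow> n < p \<Longrightarrow> of_nat (n choose k) \<noteq> (0::'k)"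
proof -
  assume kn: "k \<le> n" "n < p"
  have "\<not> p dvd (n choose k)"
  proof
    assume "p dvd (n choose k)"
    then have "p dvd fact n"
      using binomial_fact_lemma[OF kn(1)] by (metis dvd_mult)
    then show False using prime_dvd_fact_iff[OF prime_p] kn by simp
  qed
  then show ?thesis by (simp add: of_nat_eq_0_iff)
qed

text \<open>
  Every element of the field is the image of a natural number, and the fixed points of the
  Frobenius map contain 1 and are closed under addition.
\<close>

lemma power_p: "(x::'k) ^ p = x"
proof -
  have pr: "prime CHAR('k)" by (simp add: char_k prime_p)
  have fixed: "of_nat n ^ p = (of_nat n :: 'k)" for n
  proof (induction n)
    case (Suc n)
    then show ?case
      using freshmans_dream[OF pr char_k[symmetric], of "of_nat n" 1] by (simp add: add.commute)
  qed (simp add: p_pos)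
  have "inj_on (of_nat :: nat \<Rightarrow> 'k) {..<p}"
  proof (rule inj_onI)
    fix m n assume "m \<in> {..<p}" "n \<in> {..<p}" "of_nat m = (of_nat n :: 'k)"
    then show "m = n"
    proof (induction m n rule: linorder_wlog)
      case (le m n)
      then have "of_nat (n - m) = (0::'k)" by (simp add: of_nat_diff)
      moreover have "n - m < p" using le by auto
      ultimately show ?case using of_nat_lt_p[of "n - m"] le by (cases "m = n") auto
    qed auto
  qed
  then have "card (of_nat ` {..<p} :: 'k set) = CARD('k)"
    by (simp add: card_image card_k)
  then have "(of_nat ` {..<p} :: 'k set) = UNIV"
    by (intro card_subset_eq) auto
  then obtain n where "x = of_nat n" by blast
  then show ?thesis using fixed by simp
qed

text \<open>
  Since \<open>t\<^sup>p = t\<close>, the digits of the exponent may be added up; this is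
  where digit sums come from.
\<close>

lemma power_digit_sum: "(t::'k) ^ digit_sum p n = t ^ n"
proof (induction n rule: less_induct)
  case (less n)
  show ?case
  proof (cases "n = 0")
    case False
    then have "n div p < n" using p_ge_2 by (intro div_less_dividend) auto
    then have IH: "t ^ digit_sum p (n div p) = t ^ (n div p)" by (rule less)
    have "t ^ n = t ^ (n mod p + p * (n div p))" by simp
    also have "\<dots> = t ^ (n mod p) * t ^ (n div p)"
      unfolding power_add power_mult power_p ..
    also have "\<dots> = t ^ digit_sum p n"
      by (simp add: digit_sum_mod_div[OF p_ge_2, of n] power_add IH)
    finally show ?thesis by simp
  qed simp
qed

lemma power_p_minus_1: "t \<noteq> 0 \<Longrightarrow> (t::'k) ^ (p - 1) = 1"
  using power_p[of t] p_pos by (cases p) auto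

lemma power_cong_mod:
  assumes "m mod (p - 1) = n mod (p - 1)" "m > 0" "n > 0"
  shows "(t::'k) ^ m = t ^ n"
proof (cases "t = 0")
  case False
  have "t ^ k = t ^ (k mod (p - 1))" for k
  proof -
    have "t ^ k = t ^ ((p - 1) * (k div (p - 1)) + k mod (p - 1))" by simp
    also have "\<dots> = t ^ (k mod (p - 1))"
      unfolding power_add power_mult by (simp add: power_p_minus_1[unfolded One_nat_def] False)
    finally show ?thesis .
  qed
  then show ?thesis using assms by metis
qed (use assms in \<open>simp add: power_0_left\<close>)

text \<open>
  If some unit \<open>u\<close> has \<open>u\<^sup>e \<noteq> 1\<close>, then rescaling the
  summation variable by \<open>u\<close> shows that the sum vanishes; such a \<open>u\<close>
  exists unless \<open>p - 1\<close> divides \<open>e\<close>, because \<open>z\<^sup>d -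
  1\<close> with \<open>d = e mod (p - 1)\<close> has at most \<open>d\<close> roots.
\<close>

lemma sum_powers:
  "(\<Sum>t\<in>UNIV. (t::'k) ^ e) = (if e > 0 \<and> (p - 1) dvd e then - 1 else 0)"
proof (cases "e = 0")
  case True
  then show ?thesis by (simp add: card_k of_nat_eq_0_iff)
next
  case e: False
  show ?thesis
  proof (cases "(p - 1) dvd e")
    case True
    then obtain c where c: "e = (p - 1) * c" by blast
    have te: "t ^ e = (if t = 0 then 0 else 1)" for t :: 'k
      unfolding c power_mult using e c by (auto simp: power_p_minus_1[unfolded One_nat_def])
    have "(\<Sum>t\<in>UNIV. (t::'k) ^ e) = (\<Sum>t\<in>UNIV. 1 - (if t = (0::'k) then 1 else 0))"
      by (intro sum.cong refl) (simp add: te)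
    also have "\<dots> = - 1"
      by (simp add: sum_subtractf card_k of_nat_eq_0_iff)
    finally show ?thesis using True e by simp
  next
    case False
    define d where "d = e mod (p - 1)"
    have d: "0 < d" "d < p - 1"
      using False p_ge_2 prime_p unfolding d_def
      by (auto simp: dvd_eq_mod_eq_0 intro!: mod_less_divisor gr0I)
    have "\<exists>u::'k. u \<noteq> 0 \<and> u ^ e \<noteq> 1"
    proof (rule ccontr)
      assume "\<not> ?thesis"
      then have all: "u ^ e = 1" if "u \<noteq> 0" for u :: 'k using that by blast
      have "poly (monom 1 d - 1 :: 'k poly) u = 0" if "u \<noteq> 0" for u :: 'k
      proof -
        have "u ^ d = u ^ e" using d e unfolding d_def by (intro power_cong_mod) auto
        then show ?thesis using all[OF that] by (simp add: poly_monom)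
      qed
      then have sub: "UNIV - {0} \<subseteq> {u. poly (monom 1 d - 1 :: 'k poly) u = 0}" by blast
      have "coeff (monom 1 d - 1 :: 'k poly) d = 1" using d by simp
      then have ne: "monom 1 d - 1 \<noteq> (0 :: 'k poly)" by (metis coeff_0 zero_neq_one)
      have "card (UNIV - {0} :: 'k set) \<le> card {u. poly (monom 1 d - 1 :: 'k poly) u = 0}"
        using sub poly_roots_finite[OF ne] by (intro card_mono)
      also have "\<dots> \<le> degree (monom 1 d - 1 :: 'k poly)"
        using ne by (rule card_poly_roots_bound)
      also have "\<dots> \<le> d"
        by (intro degree_diff_le) (auto simp: degree_monom_le)
      finally show False using d by (simp add: card_Diff_singleton card_k)
    qed
    then obtain u :: 'k where u: "u \<noteq> 0" "u ^ e \<noteq> 1" by blast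
    have "(\<Sum>t\<in>UNIV. (t::'k) ^ e) = (\<Sum>t\<in>UNIV. (u * t) ^ e)"
      by (rule sum.reindex_bij_witness[of _ "\<lambda>t. u * t" "\<lambda>t. t / u"]) (use u in auto)
    also have "\<dots> = u ^ e * (\<Sum>t\<in>UNIV. (t::'k) ^ e)"
      by (simp add: power_mult_distrib sum_distrib_left)
    finally have "(1 - u ^ e) * (\<Sum>t\<in>UNIV. (t::'k) ^ e) = 0"
      by (simp add: algebra_simps)
    then show ?thesis using u False by auto
  qed
qed

lemma linear_power_p: "([:1, 1:] ^ p :: 'k poly) = pcompose [:1, 1:] (monom 1 p)"
proof -
  have "([:1, 1:] :: 'k poly) ^ p = (1 + monom 1 1) ^ p"
    by (simp add: monom_altdef one_pCons)
  also have "\<dots> = 1 ^ p + monom 1 1 ^ p"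
    by (rule freshmans_dream) (simp_all add: char_k prime_p)
  also have "\<dots> = pcompose [:1, 1:] (monom 1 p)"
    by (simp add: pcompose_pCons monom_power pcompose_1 flip: one_pCons)
  finally show ?thesis .
qed

lemma linear_power_split:
  "([:1, 1:] ^ (a + p * b) :: 'k poly) = [:1, 1:] ^ a * pcompose ([:1, 1:] ^ b) (monom 1 p)"
  by (simp add: power_add power_mult linear_power_p pcompose_power)

text \<open>
  Compare coefficients in \<open>(1 + z)\<^bsup>a + p b\<^esup> = (1 + z)\<^sup>a (1 +
  z\<^sup>p)\<^sup>b\<close>.
\<close>

lemma lucas:
  assumes "a < p" "l < p"
  shows "of_nat ((a + p * b) choose (l + p * k)) = (of_nat (a choose l) * of_nat (b choose k) :: 'k)"
proof -
  have "coeff ([:1, 1:] ^ (a + p * b) :: 'k poly) (l + p * k)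
      = coeff ([:1, 1:] ^ a * pcompose ([:1, 1:] ^ b) (monom 1 p)) (l + p * k)"
    by (simp only: linear_power_split)
  also have "\<dots> = of_nat (a choose l) * of_nat (b choose k)"
    using assms by (subst coeff_mult_pcompose_monom) (auto simp: coeff_linear_power binomial_eq_0)
  finally show ?thesis by (simp add: coeff_linear_power)
qed

lemma choose_neq_0_digit_sum:
  assumes "of_nat (s choose k) \<noteq> (0::'k)"
  shows "digit_sum p k \<le> digit_sum p s \<and> (digit_sum p k = digit_sum p s \<longrightarrow> k = s)"
  using assms
proof (induction s arbitrary: k rule: less_induct)
  case (less s)
  show ?case
  proof (cases "s = 0")
    case True
    then show ?thesis using less.prems by (cases k) auto
  next
    case False
    then have lt: "s div p < s" using p_ge_2 by (intro div_less_dividend) auto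
    have "of_nat ((s mod p + p * (s div p)) choose (k mod p + p * (k div p))) \<noteq> (0::'k)"
      using less.prems by simp
    then have nz: "of_nat (s mod p choose (k mod p)) \<noteq> (0::'k)"
        "of_nat (s div p choose (k div p)) \<noteq> (0::'k)"
      by (subst (asm) lucas; simp add: p_pos)+
    then have "k mod p \<le> s mod p"
      by (metis binomial_eq_0 not_le of_nat_0)
    moreover note less.IH[OF lt nz(2)]
    ultimately show ?thesis
      unfolding digit_sum_mod_div[OF p_ge_2, of k] digit_sum_mod_div[OF p_ge_2, of s]
      by (metis (no_types, opaque_lifting) add_le_cancel_right add_le_mono add_left_cancel le_antisym
          mod_mult_div_eq nat_add_left_cancel_le order_refl)
  qed
qed

text \<open>
  Every digit sum up to that of \<open>s\<close> is attained by an exponent that really occurs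
  in \<open>(1 + z)\<^sup>s\<close>: choose the digits greedily below those of
  \<open>s\<close>.
\<close>

lemma exists_choose_digit_sum:
  assumes "a \<le> digit_sum p s"
  obtains k where "k \<le> s" "digit_sum p k = a" "of_nat (s choose k) \<noteq> (0::'k)"
proof -
  have "\<exists>k\<le>s. digit_sum p k = a \<and> of_nat (s choose k) \<noteq> (0::'k)"
    using assms
  proof (induction s arbitrary: a rule: less_induct)
    case (less s)
    show ?case
    proof (cases "s = 0")
      case False
      then have lt: "s div p < s" using p_ge_2 by (intro div_less_dividend) auto
      define l where "l = min (s mod p) a"
      have "a - l \<le> digit_sum p (s div p)"
        using less.prems unfolding l_def digit_sum_mod_div[OF p_ge_2, of s] by auto
      from less.IH[OF lt this] obtain k where k: "k \<le> s div p" "digit_sum p k = a - l"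
        "of_nat (s div p choose k) \<noteq> (0::'k)" by blast
      have l: "l \<le> s mod p" "l < p" "l \<le> a"
        using mod_less_divisor[OF p_pos, of s] unfolding l_def by linarith+
      have "l + p * k \<le> s mod p + p * (s div p)"
        using l k by (intro add_mono mult_le_mono) auto
      moreover have "digit_sum p (l + p * k) = a"
        using l k by (simp add: digit_sum_split)
      moreover have "of_nat (s choose (l + p * k)) \<noteq> (0::'k)"
        using lucas[of "s mod p" l "s div p" k] l k of_nat_choose_neq_0[of l "s mod p"]
        by (simp add: p_pos)
      ultimately show ?thesis by (intro exI[of _ "l + p * k"]) auto
    qed (use less in auto)
  qed
  then show ?thesis using that by blast
qed

section \<open>Multiples of a power of 1 + z have many terms\<close>

text \<open>
  The operator \<open>f \<mapsto> z f' - d f\<close> kills the term of exponent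
  \<open>d\<close> and, as all exponents are distinct modulo \<open>p\<close>, no other term,
  while it lowers the order of vanishing at \<open>-1\<close> by at most one.  Hence each
  factor \<open>1 + z\<close> costs a term.
\<close>

lemma few_terms:
  fixes f :: "'k poly"
  assumes "f \<noteq> 0" "degree f < p" "[:1, 1:] ^ m dvd f"
  shows "m < card {k. coeff f k \<noteq> 0}"
  using assms
proof (induction m arbitrary: f)
  case 0
  have "finite {k. coeff f k \<noteq> 0}"
    by (rule finite_subset[of _ "{..degree f}"]) (auto intro: le_degree)
  then show ?case using 0 by (auto simp: card_gt_0_iff intro!: exI[of _ "degree f"])
next
  case (Suc m)
  have fin: "finite {k. coeff f k \<noteq> 0}"
    by (rule finite_subset[of _ "{..degree f}"]) (auto intro: le_degree)
  define d where "d = degree f"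
  \<comment> \<open>the term to be killed is the leading one\<close>
  define g where "g = [:0, 1:] * pderiv f - smult (of_nat d) f"
  have coeff_g: "coeff g k = (of_nat k - of_nat d) * coeff f k" for k
    by (cases k) (simp_all add: g_def coeff_pderiv algebra_simps)
  have supp: "{k. coeff g k \<noteq> 0} \<subseteq> {k. coeff f k \<noteq> 0} - {d}"
    by (auto simp: coeff_g)
  have "g \<noteq> 0"
  proof
    assume g: "g = 0"
    have "coeff f k = 0" if "k \<noteq> d" for k
    proof (cases "k < d")
      case True
      then have "of_nat (d - k) \<noteq> (0::'k)"
        using Suc.prems(2) by (intro of_nat_lt_p) (auto simp: d_def)
      then show ?thesis
        using coeff_g[of k] g True by (simp add: of_nat_diff)
    qed (use that in \<open>auto simp: d_def intro: coeff_eq_0\<close>)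
    then have "f = monom (coeff f d) d" by (intro poly_eqI) auto
    then have "poly f (- 1) = coeff f d * (- 1) ^ d" by (metis poly_monom)
    moreover have "[:1, 1:] dvd f" using Suc.prems(3) by (auto intro: dvd_mult_left)
    then have "poly f (- 1) = 0" by (auto elim!: dvdE)
    ultimately show False using Suc.prems(1) by (simp add: d_def)
  qed
  moreover have "degree g < p"
  proof -
    have "degree g \<le> d"
      by (rule degree_le) (auto simp: coeff_g d_def coeff_eq_0)
    then show ?thesis using Suc.prems(2) by (simp add: d_def)
  qed
  moreover have "[:1, 1:] ^ m dvd g"
  proof -
    obtain h where h: "f = [:1, 1:] ^ Suc m * h" using Suc.prems(3) by (elim dvdE)
    have "[:1, 1:] ^ m dvd pderiv f"
      unfolding h pderiv_mult pderiv_power_Suc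
      by (rule dvd_add, rule dvd_mult2, rule le_imp_power_dvd, simp,
          rule dvd_mult, rule dvd_mult2, rule dvd_smult, rule dvd_refl)
    moreover have "[:1, 1:] ^ m dvd f" unfolding h by (rule dvd_mult2, rule le_imp_power_dvd, simp)
    ultimately show ?thesis unfolding g_def by (intro dvd_diff dvd_mult dvd_smult)
  qed
  ultimately have "m < card {k. coeff g k \<noteq> 0}" by (rule Suc.IH)
  also have "\<dots> \<le> card ({k. coeff f k \<noteq> 0} - {d})"
    using supp fin by (intro card_mono) auto
  also have "Suc \<dots> = card {k. coeff f k \<noteq> 0}"
    using fin Suc.prems(1) by (intro card.remove[symmetric]) (auto simp: d_def)
  finally show ?case by simp
qed

text \<open>
  The exponents of \<open>g\<close> are confined to an interval, and those of \<open>(1 +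
  z)\<^sup>m g\<close> to one that is longer by \<open>m\<close>.  The window \<open>{d -
  i..d}\<close> removes from the longer interval at least as many exponents as the shorter one
  has, also when it sticks out at either end.  At most \<open>m\<close> terms survive, so
  \<open>few_terms\<close> applies.  Exchanging the roles of \<open>n\<close> and
  \<open>i\<close> turns the independence statement below into the spanning statement.
\<close>

lemma window_vanishing:
  fixes g :: "'k poly"
  assumes "n \<le> i" "m + n < p"
    and supp: "\<And>b. coeff g b \<noteq> 0 \<Longrightarrow> b \<le> n \<and> b \<le> d \<and> d \<le> b + m + i"
    and zero: "\<And>a. a \<le> d \<Longrightarrow> d \<le> a + i \<Longrightarrow> coeff ([:1, 1:] ^ m * g) a = 0"
  shows "g = 0"
proof (rule ccontr)
  assume g: "g \<noteq> 0"
  define f where "f = [:1, 1:] ^ m * g"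
  define lo where "lo = d - (m + i)"
  define hi where "hi = min n d + m"
  define S where "S = {lo..hi} - {d - i..d}"
  have "f \<noteq> 0" using g by (simp add: f_def)
  have supp_f: "{a. coeff f a \<noteq> 0} \<subseteq> S"
  proof
    fix a assume a: "a \<in> {a. coeff f a \<noteq> 0}"
    have "coeff f a = (\<Sum>j\<le>a. of_nat (m choose j) * coeff g (a - j))"
      by (simp add: f_def coeff_mult coeff_linear_power)
    then obtain j where j: "j \<le> a" "of_nat (m choose j) * coeff g (a - j) \<noteq> 0"
      using a by (metis (mono_tags, lifting) atMost_iff mem_Collect_eq sum.neutral)
    then have "j \<le> m" by (metis binomial_eq_0 mult_zero_left not_le of_nat_0)
    moreover have "a \<notin> {d - i..d}" using a zero[of a] by (auto simp: f_def le_diff_conv)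
    moreover have "a - j \<le> n \<and> a - j \<le> d \<and> d \<le> a - j + m + i" using j by (intro supp) auto
    ultimately show "a \<in> S" using j(1) by (auto simp: S_def lo_def hi_def)
  qed
  have "degree f < p"
  proof -
    have "coeff f (degree f) \<noteq> 0" using \<open>f \<noteq> 0\<close> by simp
    then have "degree f \<in> S" using supp_f by blast
    then show ?thesis using assms(2) by (auto simp: S_def hi_def)
  qed
  then have "m < card {a. coeff f a \<noteq> 0}"
    using \<open>f \<noteq> 0\<close> by (intro few_terms) (auto simp: f_def)
  also have "\<dots> \<le> card S"
    using supp_f by (intro card_mono) (auto simp: S_def)
  also have "card S = card {lo..hi} - card ({lo..hi} \<inter> {d - i..d})"
    unfolding S_def by (rule card_Diff_subset_Int) simp
  also have "{lo..hi} \<inter> {d - i..d} = {max lo (d - i)..min hi d}" by auto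
  finally have "m < Suc hi - lo - (Suc (min hi d) - max lo (d - i))" by simp
  moreover have "lo \<le> min n d"
  proof -
    have "coeff g (degree g) \<noteq> 0" using g by simp
    then show ?thesis using supp[of "degree g"] by (auto simp: lo_def)
  qed
  \<comment> \<open>the interval \<open>{lo..hi}\<close> has \<open>min n d - lo + m + 1\<close> elements, and the window removes at least \<open>min n d - lo + 1\<close>\<close>
  ultimately show False using assms(1)
    unfolding lo_def hi_def by (auto simp: min_def max_def split: if_splits)
qed

section \<open>Relations visible in one residue class of exponents\<close>

lemma coeff_linear_power_mult:
  fixes g :: "'k poly"
  assumes "\<And>m. m \<ge> 2 * p \<Longrightarrow> coeff ([:1, 1:] ^ (s mod p) * g) m = 0" "l < p"
  shows "coeff ([:1, 1:] ^ s * g) (l + p * k) =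
    coeff ([:1, 1:] ^ (s mod p) * g) l * of_nat (s div p choose k) +
    (if k = 0 then 0 else coeff ([:1, 1:] ^ (s mod p) * g) (l + p) * of_nat (s div p choose (k - 1)))"
proof -
  have "[:1, 1:] ^ s * g = ([:1, 1:] ^ (s mod p) * g) * pcompose ([:1, 1:] ^ (s div p)) (monom 1 p)"
  proof -
    have "([:1, 1:] ^ s :: 'k poly) = [:1, 1:] ^ (s mod p) * pcompose ([:1, 1:] ^ (s div p)) (monom 1 p)"
      using linear_power_split[of "s mod p" "s div p"] unfolding mod_mult_div_eq .
    then have "[:1, 1:] ^ s * g = [:1, 1:] ^ (s mod p) * pcompose ([:1, 1:] ^ (s div p)) (monom 1 p) * g"
      by (rule arg_cong)
    then show ?thesis by (simp only: ac_simps)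
  qed
  then have "coeff ([:1, 1:] ^ s * g) (l + p * k) = coeff (([:1, 1:] ^ (s mod p) * g)
      * pcompose ([:1, 1:] ^ (s div p)) (monom 1 p)) (l + p * k)"
    by (rule arg_cong)
  also note coeff_mult_pcompose_monom[OF assms]
  finally show ?thesis unfolding coeff_linear_power .
qed

lemma degree_linear_power: "degree ([:1, 1:] ^ n :: 'k poly) = n"
  by (simp add: degree_power_eq)

text \<open>
  The row \<open>(\<sigma> choose \<kappa>, \<sigma> choose (\<kappa> - 1))\<close> is
  proportional to \<open>(\<sigma> + 1 - \<kappa>, \<kappa>)\<close>, so rows with different
  \<open>\<kappa>\<close> are independent.
\<close>

lemma choose_Suc_shift:
  assumes "\<kappa> \<le> Suc \<sigma>" "Suc \<sigma> < p"
    and "x * of_nat (\<sigma> choose \<kappa>) + y * (if \<kappa> = 0 then 0 else of_nat (\<sigma> choose (\<kappa> - 1))) = (0::'k)"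
  shows "of_nat (Suc \<sigma> - \<kappa>) * x + of_nat \<kappa> * y = 0"
proof -
  let ?c = "of_nat (Suc \<sigma> choose \<kappa>) :: 'k"
  have 1: "of_nat (Suc \<sigma>) * of_nat (\<sigma> choose \<kappa>) = of_nat (Suc \<sigma> - \<kappa>) * ?c"
    using binomial_absorb_comp[of "Suc \<sigma>" \<kappa>] by (metis diff_Suc_1 of_nat_mult)
  have 2: "of_nat (Suc \<sigma>) * (if \<kappa> = 0 then 0 else of_nat (\<sigma> choose (\<kappa> - 1))) = of_nat \<kappa> * ?c"
  proof (cases \<kappa>)
    case (Suc \<kappa>')
    then show ?thesis
      using binomial_absorption[of \<kappa>' "Suc \<sigma>"] by (simp only: diff_Suc_1 nat.distinct if_False simp_thms flip: of_nat_mult)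
  qed simp
  have "?c * (of_nat (Suc \<sigma> - \<kappa>) * x + of_nat \<kappa> * y)
      = x * (of_nat (Suc \<sigma> - \<kappa>) * ?c) + y * (of_nat \<kappa> * ?c)"
    by (simp add: algebra_simps)
  also have "\<dots> = of_nat (Suc \<sigma>) * (x * of_nat (\<sigma> choose \<kappa>)
      + y * (if \<kappa> = 0 then 0 else of_nat (\<sigma> choose (\<kappa> - 1))))"
    unfolding 1[symmetric] 2[symmetric] by (simp add: algebra_simps del: of_nat_Suc)
  also have "\<dots> = 0" using assms(3) by simp
  finally show ?thesis using of_nat_choose_neq_0[OF assms(1,2)] by simp
qed

text \<open>
  Reducing \<open>f\<close> modulo \<open>(1 + z)\<^sup>p = 1 + z\<^sup>p\<close> gives the
  polynomial with coefficients \<open>f\<^sub>l - f\<^bsub>l + p\<^esub>\<close>, which is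
  still divisible by \<open>(1 + z)\<^sup>m\<close>; with at most \<open>m\<close> terms it
  must be zero.
\<close>

lemma reduction_mod_linear_power_p:
  fixes f :: "'k poly"
  assumes f: "\<And>m. m \<ge> 2 * p \<Longrightarrow> coeff f m = 0" and dvd: "[:1, 1:] ^ m dvd f" "m \<le> p"
    and S: "\<And>l. l < p \<Longrightarrow> l \<notin> S \<Longrightarrow> coeff f l = coeff f (l + p)" "finite S" "card S \<le> m"
    and l: "l < p"
  shows "coeff f l = coeff f (l + p)"
proof -
  define e where "e = (\<Sum>l<p. monom (coeff f l - coeff f (l + p)) l)"
  define h where "h = (\<Sum>l<p. monom (coeff f (l + p)) l)"
  have coeff_e: "coeff e k = (if k < p then coeff f k - coeff f (k + p) else 0)" for k
    by (simp add: e_def coeff_sum)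
  have coeff_h: "coeff h k = (if k < p then coeff f (k + p) else 0)" for k
    by (simp add: h_def coeff_sum)
  have "f = e + h * pcompose [:1, 1:] (monom 1 p)"
  proof (rule poly_eqI)
    fix n
    have "coeff (h * pcompose [:1, 1:] (monom 1 p)) (n mod p + p * (n div p))
      = coeff h (n mod p) * coeff [:1, 1:] (n div p) + (if n div p = 0 then 0 else coeff h (n mod p + p) * coeff [:1, 1:] (n div p - 1))"
      by (rule coeff_mult_pcompose_monom) (auto simp: coeff_h p_pos)
    then have c: "coeff (h * pcompose [:1, 1:] (monom 1 p)) n = coeff f (n mod p + p) * coeff [:1, 1:] (n div p)"
      by (simp add: coeff_h p_pos)
    consider "n div p = 0" | "n div p = 1" | "n div p \<ge> 2" by linarith
    then show "coeff f n = coeff (e + h * pcompose [:1, 1:] (monom 1 p)) n"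
    proof cases
      case 1
      then have "n < p" using p_pos by (simp add: div_eq_0_iff)
      then show ?thesis using c by (simp add: coeff_e)
    next
      case 2
      then have "n = n mod p + p" "\<not> n < p" using mod_mult_div_eq[of n p] by auto
      then show ?thesis using c 2 by (simp add: coeff_e)
    next
      case 3
      then have "p * 2 \<le> p * (n div p)" by (intro mult_le_mono2)
      then have "n \<ge> 2 * p" using mod_mult_div_eq[of n p] by linarith
      moreover have "coeff [:1, 1:] (n div p) = (0::'k)" using 3 by (intro coeff_eq_0) simp
      ultimately show ?thesis using c f p_pos by (simp add: coeff_e)
    qed
  qed
  then have "e = f - h * [:1, 1:] ^ p" by (simp add: linear_power_p)
  moreover have "[:1, 1:] ^ m dvd ([:1, 1:] ^ p :: 'k poly)" using dvd(2) by (rule le_imp_power_dvd)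
  ultimately have "[:1, 1:] ^ m dvd e" using dvd(1) by (simp add: dvd_diff)
  moreover have "degree e < p"
    using p_pos by (intro degree_lessI) (auto simp: coeff_e)
  moreover have "card {k. coeff e k \<noteq> 0} \<le> card S"
    using S by (intro card_mono) (auto simp: coeff_e split: if_splits)
  ultimately have "e = 0" using few_terms[of e m] S(3) by fastforce
  then show ?thesis using coeff_e[of l] l by simp
qed

lemma add_mult_mod_pred: "(l + p * k) mod (p - 1) = (l + k) mod (p - 1)"
proof -
  have "l + p * k = (l + k) + (p - 1) * k"
    using p_pos by (cases p) (auto simp: algebra_simps)
  then show ?thesis by (metis mod_mult_self2)
qed

text \<open>
  This encodes a relation \<open>\<Sum> L\<^sup>s Q\<^sub>L = 0\<close> seen from the point
  \<open>L = Y\<close>.  For \<open>t \<noteq> 0\<close> and exponents congruent to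
  \<open>s\<close>, the contributions of all the \<open>(1 + t z)\<^sup>s Q(z)\<close> add up
  to those of a single product \<open>(1 + z)\<^sup>s g\<close>.  Exponents up to
  \<open>i\<close> are left free because \<open>L = X\<close> contributes there, and those
  from \<open>s\<close> on because \<open>L = Y\<close> does.
\<close>

definition vanishes_on_class :: "nat \<Rightarrow> nat \<Rightarrow> 'k poly \<Rightarrow> bool" where
  "vanishes_on_class s i g \<longleftrightarrow> degree g \<le> i \<and> i < p \<and>
    (\<forall>k. i < k \<and> k < s \<and> k mod (p - 1) = s mod (p - 1) \<longrightarrow> coeff ([:1, 1:] ^ s * g) k = 0)"

lemma vanishes_on_class_low_degree:
  assumes "vanishes_on_class s i g"
  shows "degree ([:1, 1:] ^ (s mod p) * g) \<le> s mod p + i"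
  using degree_mult_le[of "[:1, 1:] ^ (s mod p)" g] assms
  by (simp add: degree_linear_power vanishes_on_class_def)

lemma vanishes_on_class_coeff:
  assumes "vanishes_on_class s i g" "l < p"
  shows "coeff ([:1, 1:] ^ s * g) (l + p * k) =
    coeff ([:1, 1:] ^ (s mod p) * g) l * of_nat (s div p choose k) +
    (if k = 0 then 0 else coeff ([:1, 1:] ^ (s mod p) * g) (l + p) * of_nat (s div p choose (k - 1)))"
proof (rule coeff_linear_power_mult[OF _ assms(2)])
  fix m assume "m \<ge> 2 * p"
  moreover have "s mod p < p" "i < p" using p_pos assms(1) by (auto simp: vanishes_on_class_def)
  ultimately show "coeff ([:1, 1:] ^ (s mod p) * g) m = 0"
    using vanishes_on_class_low_degree[OF assms(1)] by (intro coeff_eq_0) linarith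
qed

text \<open>
  Split \<open>s = s\<^sub>0 + p s'\<close> and let \<open>f = (1 +
  z)\<^bsup>s\<^sub>0\<^esup> g\<close>.  The coefficient at \<open>l + p k\<close> couples
  only \<open>f\<^sub>l\<close> and \<open>f\<^bsub>l + p\<^esub>\<close>, and \<open>k \<ge>
  1\<close> already puts the exponent above \<open>i\<close>.
\<close>

lemma vanishes_on_class_eq:
  assumes van: "vanishes_on_class s i g" and l: "l < p" and k: "1 \<le> k" "l + p * k < s"
    and cls: "(l + digit_sum p k) mod (p - 1) = digit_sum p s mod (p - 1)"
  shows "coeff ([:1, 1:] ^ (s mod p) * g) l * of_nat (s div p choose k)
    + coeff ([:1, 1:] ^ (s mod p) * g) (l + p) * of_nat (s div p choose (k - 1)) = 0"
proof -
  have "i < l + p * k"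
  proof -
    have "p * 1 \<le> p * k" using k(1) by (rule mult_le_mono2)
    moreover have "i < p" using van by (simp add: vanishes_on_class_def)
    ultimately show ?thesis by linarith
  qed
  moreover have "(l + p * k) mod (p - 1) = s mod (p - 1)"
    using cls digit_sum_cong_mod[OF p_ge_2] unfolding add_mult_mod_pred by (metis mod_add_right_eq)
  ultimately have "coeff ([:1, 1:] ^ s * g) (l + p * k) = 0"
    using van k by (simp add: vanishes_on_class_def)
  then show ?thesis
    using vanishes_on_class_coeff[OF van l, of k] k by simp
qed

text \<open>
  For a given \<open>l\<close> it suffices that the residue class prescribes a digit sum
  \<open>a\<close> attained by some \<open>k \<ge> 1\<close> in \<open>(1 +
  z)\<^bsup>s'\<^esup>\<close>.  The extreme value of \<open>a\<close> forces \<open>k =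
  s'\<close>, and then \<open>l + p k < s\<close> needs \<open>l < s\<^sub>0\<close>.
\<close>

lemma vanishes_on_class_zero:
  assumes van: "vanishes_on_class s i g" and l: "l < p"
    and high: "coeff ([:1, 1:] ^ (s mod p) * g) (l + p) = 0"
    and a: "1 \<le> a" "a \<le> digit_sum p (s div p)" "a = digit_sum p (s div p) \<Longrightarrow> l < s mod p"
    and cls: "(l + a) mod (p - 1) = digit_sum p s mod (p - 1)"
  shows "coeff ([:1, 1:] ^ (s mod p) * g) l = 0"
proof -
  obtain k where k: "k \<le> s div p" "digit_sum p k = a" "of_nat (s div p choose k) \<noteq> (0::'k)"
    using a(2) by (rule exists_choose_digit_sum)
  have "k \<ge> 1" using k a by (cases k) auto
  moreover have "l + p * k < s"
  proof (cases "k = s div p")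
    case True
    then have "l < s mod p" using k a by simp
    then have "l + p * k < s mod p + p * k" by simp
    then show ?thesis unfolding True mod_mult_div_eq .
  next
    case False
    then have "p * (k + 1) \<le> p * (s div p)" using k by (intro mult_le_mono2) simp
    then have "l + p * k < p * (s div p)" using l by simp
    also have "\<dots> \<le> s" by simp
    finally show ?thesis .
  qed
  ultimately show ?thesis
    using vanishes_on_class_eq[OF van l, of k] cls k high by simp
qed

text \<open>
  If \<open>s\<^sub>0 + i < p\<close> no carry occurs.  All coefficients of \<open>f = (1 +
  z)\<^bsup>s\<^sub>0\<^esup> g\<close> above \<open>s\<^sub>0\<close> vanish, so
  \<open>g\<close> is a constant; it equals \<open>f\<^sub>0\<close>, which vanishes because
  the class prescribes an attainable digit sum at \<open>l = 0\<close> as well.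
\<close>

lemma vanishes_on_class_no_carry:
  assumes van: "vanishes_on_class s i g" and i: "s mod p + i < p" and p_le: "p \<le> digit_sum p s"
  shows "coeff ([:1, 1:] ^ s * g) s = 0"
proof -
  define s0 s' N where "s0 = s mod p" "s' = s div p" "N = digit_sum p s'"
  define f where "f = [:1, 1:] ^ s0 * g"
  note defs = s0_s'_N_def
  have N: "digit_sum p s = s0 + N" by (simp add: defs flip: digit_sum_mod_div[OF p_ge_2])
  have deg_f: "degree f \<le> s0 + i"
    using vanishes_on_class_low_degree[OF van] by (simp add: f_def defs)
  have f_zero: "coeff f l = 0"
    if "l < p" "1 \<le> a" "a \<le> N" "a = N \<Longrightarrow> l < s0" "(l + a) mod (p - 1) = (s0 + N) mod (p - 1)" for l a
  proof -
    have "coeff f (l + p) = 0"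
      using deg_f i by (intro coeff_eq_0) (auto simp: defs)
    then show ?thesis
      using vanishes_on_class_zero[OF van that(1), of a] that N by (simp add: f_def defs)
  qed
  have "degree f \<le> s0"
  proof (rule degree_le, intro allI impI)
    fix l assume l: "s0 < l"
    show "coeff f l = 0"
    proof (cases "l \<le> s0 + i")
      case True
      then have "1 \<le> N - (l - s0)" "N - (l - s0) < N" "l + (N - (l - s0)) = s0 + N" "l < p"
        using l i p_le N by (auto simp: defs)
      then show ?thesis by (intro f_zero[of _ "N - (l - s0)"]) (simp_all add: add.commute)
    qed (use deg_f in \<open>auto intro: coeff_eq_0\<close>)
  qed
  moreover have "degree f = s0 + degree g" if "g \<noteq> 0"
    using that by (simp add: f_def degree_mult_eq degree_linear_power)
  ultimately have "degree g = 0" by (cases "g = 0") auto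
  then obtain c where c: "g = [:c:]" by (metis degree_eq_zeroE)
  have "coeff f 0 = c" by (simp add: f_def c coeff_linear_power)
  moreover have "coeff f 0 = 0"
  \<comment> \<open>\<open>s0 + N\<close> exceeds \<open>N\<close> in general, but is congruent to a digit sum between 1 and \<open>N\<close>\<close>
  proof (rule f_zero[of 0 "s0 + N - (p - 1)"])
    have "s0 < p" using p_pos by (simp add: defs)
    then show "s0 + N - (p - 1) \<le> N" by simp
    show "0 < s0" if "s0 + N - (p - 1) = N" using that p_ge_2 p_le N by (intro gr0I) auto
    have "s0 + N = (0 + (s0 + N - (p - 1))) + (p - 1)" using p_le N by simp
    then show "(0 + (s0 + N - (p - 1))) mod (p - 1) = (s0 + N) mod (p - 1)"
      by (metis mod_add_self2)
  qed (use p_pos p_le N p_ge_2 in auto)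
  ultimately show ?thesis using c by simp
qed

text \<open>
  In the next two lemmas \<open>x\<close> and \<open>y\<close> stand for the coefficients at 0
  and \<open>p\<close> of the polynomial \<open>f\<close> in
  \<open>vanishes_on_class_carry\<close>.  If \<open>p\<close> divides \<open>s' + 1\<close>,
  the last digit of \<open>s'\<close> is \<open>p - 1\<close>.  Any \<open>k\<close> with
  nonzero last digit then gives \<open>(s' choose (k - 1)) = - (s' choose k)\<close>, since
  \<open>p choose l\<close> vanishes modulo \<open>p\<close>.
\<close>

lemma low_eq_high_if_dvd_Suc:
  assumes A: "1 \<le> A" "A \<le> digit_sum p s'" and s': "p dvd Suc s'"
    and eq: "\<And>k. 1 \<le> k \<Longrightarrow> k \<le> s' \<Longrightarrow> digit_sum p k = A \<Longrightarrow>
      x * of_nat (s' choose k) + y * of_nat (s' choose (k - 1)) = (0::'k)"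
  shows "x = y"
proof -
  define s'' where "s'' = s' div p"
  have mod: "s' mod p = p - 1"
  proof -
    have "Suc (s' mod p) = p"
      using s' p_pos by (metis dvd_imp_mod_0 mod_Suc nat.distinct(1))
    then show ?thesis by simp
  qed
  have s'_eq: "s' = (p - 1) + p * s''"
    using mod_mult_div_eq[of s' p] mod by (simp add: s''_def)
  have N: "digit_sum p s' = (p - 1) + digit_sum p s''"
    using p_pos digit_sum_split[of "p - 1" s''] unfolding s'_eq[symmetric] by linarith
  define l where "l = min A (p - 1)"
  have l: "1 \<le> l" "l \<le> p - 1" "l < p" "l \<le> A" "A - l \<le> digit_sum p s''"
    using A p_ge_2 N by (auto simp: l_def)
  obtain k where k: "k \<le> s''" "digit_sum p k = A - l" "of_nat (s'' choose k) \<noteq> (0::'k)"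
    using l(5) by (rule exists_choose_digit_sum)
  have "l + p * k \<le> s'"
    unfolding s'_eq using l k by (intro add_mono mult_le_mono) auto
  then have "x * of_nat (s' choose (l + p * k)) + y * of_nat (s' choose (l + p * k - 1)) = 0"
    using l k by (intro eq) (auto simp: digit_sum_split)
  moreover have "of_nat (s' choose (l + p * k)) = (of_nat (p - 1 choose l) * of_nat (s'' choose k) :: 'k)"
    using lucas[of "p - 1" l s'' k] l p_pos unfolding s'_eq[symmetric] by simp
  moreover have "of_nat (s' choose (l - 1 + p * k)) = (of_nat (p - 1 choose (l - 1)) * of_nat (s'' choose k) :: 'k)"
    using lucas[of "p - 1" "l - 1" s'' k] l p_pos unfolding s'_eq[symmetric] by simp
  moreover have "l + p * k - 1 = l - 1 + p * k" using l by simp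
  moreover have "of_nat (p - 1 choose (l - 1)) + of_nat (p - 1 choose l) = (of_nat (p choose l) :: 'k)"
    using choose_reduce_nat[of p l] l p_pos by simp
  moreover have "of_nat (p choose l) = (0::'k)"
    using dvd_choose_prime[of l p] prime_p l by (simp add: of_nat_eq_0_iff)
  ultimately have "x * (u * w) + y * (v * w) = 0" "v = - u"
    if "u = of_nat (p - 1 choose l)" "v = of_nat (p - 1 choose (l - 1))" "w = of_nat (s'' choose k)" for u v w
    using that by (simp_all only: eq_neg_iff_add_eq_0)
  note * = this(1)[OF refl refl refl] this(2)[OF refl refl refl]
  have "of_nat (p - 1 choose l) * of_nat (s'' choose k) * (x - y) = x * (of_nat (p - 1 choose l)
      * of_nat (s'' choose k)) + y * (- of_nat (p - 1 choose l) * of_nat (s'' choose k))"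
    by (simp add: algebra_simps)
  also have "\<dots> = 0" using *(1) unfolding *(2) .
  finally have "of_nat (p - 1 choose l) * of_nat (s'' choose k) * (x - y) = 0" .
  moreover have "of_nat (p - 1 choose l) \<noteq> (0::'k)"
    using l p_pos by (intro of_nat_choose_neq_0) auto
  ultimately show ?thesis using k by simp
qed

text \<open>
  Since \<open>s'\<close> has at least two digits, the digit sum \<open>A\<close> can be
  distributed with two consecutive last digits \<open>\<kappa>\<close> and \<open>\<kappa> +
  1\<close>.  The two resulting equations differ exactly by \<open>x - y\<close>.
\<close>

lemma low_eq_high_if_not_dvd_Suc:
  assumes A: "1 \<le> A" "A \<le> digit_sum p s'" and s': "\<not> p dvd Suc s'" "p \<le> s'"
    and eq: "\<And>k. 1 \<le> k \<Longrightarrow> k \<le> s' \<Longrightarrow> digit_sum p k = A \<Longrightarrow>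
      x * of_nat (s' choose k) + y * of_nat (s' choose (k - 1)) = (0::'k)"
  shows "x = y"
proof -
  define \<sigma> s'' where "\<sigma> = s' mod p" "s'' = s' div p"
  have s'_eq: "s' = \<sigma> + p * s''" by (simp add: \<sigma>_s''_def)
  have \<sigma>: "Suc \<sigma> < p"
  proof -
    have "Suc \<sigma> \<noteq> p"
    proof
      assume "Suc \<sigma> = p"
      then have "Suc s' = p * Suc s''" using s'_eq by simp
      then show False using s'(1) by (metis dvd_triv_left)
    qed
    moreover have "\<sigma> < p" using p_pos by (simp add: \<sigma>_s''_def)
    ultimately show ?thesis by simp
  qed
  have "s'' \<noteq> 0" using s'(2) p_pos by (simp add: \<sigma>_s''_def div_eq_0_iff)
  then have n2: "digit_sum p s'' \<ge> 1" using digit_sum_eq_0_iff[OF p_ge_2, of s''] by linarith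
  have N: "digit_sum p s' = \<sigma> + digit_sum p s''"
    using digit_sum_mod_div[OF p_ge_2, of s'] by (simp add: \<sigma>_s''_def)
  have row: "of_nat (Suc \<sigma> - \<kappa>) * x + of_nat \<kappa> * y = 0"
    if \<kappa>: "\<kappa> \<le> Suc \<sigma>" "\<kappa> \<le> A" "A - \<kappa> \<le> digit_sum p s''" for \<kappa>
  proof -
    obtain k where k: "k \<le> s''" "digit_sum p k = A - \<kappa>" "of_nat (s'' choose k) \<noteq> (0::'k)"
      using \<kappa>(3) by (rule exists_choose_digit_sum)
    have ds: "digit_sum p (\<kappa> + p * k) = A" using \<kappa> \<sigma> k by (simp add: digit_sum_split)
    then have ge: "1 \<le> \<kappa> + p * k" using A by (metis One_nat_def Suc_leI digit_sum_0 gr0I not_one_le_zero)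
    have "\<kappa> + p * k \<le> s'"
    proof (cases "k = s''")
      case True
      then have "\<kappa> \<le> \<sigma>" using k A N \<kappa> by simp
      then show ?thesis using True s'_eq by simp
    next
      case False
      then have "p * (k + 1) \<le> p * s''" using k by (intro mult_le_mono2) simp
      then show ?thesis using \<kappa> \<sigma> unfolding s'_eq by simp
    qed
    then have "x * of_nat (s' choose (\<kappa> + p * k)) + y * of_nat (s' choose (\<kappa> + p * k - 1)) = 0"
      using ge ds by (intro eq)
    moreover have "of_nat (s' choose (\<kappa> + p * k)) = (of_nat (\<sigma> choose \<kappa>) * of_nat (s'' choose k) :: 'k)"
      using lucas[of \<sigma> \<kappa> s'' k] \<sigma> \<kappa> by (simp flip: s'_eq)
    moreover have "of_nat (s' choose (\<kappa> + p * k - 1))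
        = ((if \<kappa> = 0 then 0 else of_nat (\<sigma> choose (\<kappa> - 1))) * of_nat (s'' choose k) :: 'k)"
    proof (cases "\<kappa> = 0")
      case True
      then have "k \<ge> 1" using ge by (cases k) auto
      then have "p * k = p + p * (k - 1)" by (cases k) auto
      then have "\<kappa> + p * k - 1 = (p - 1) + p * (k - 1)" using True p_pos by simp
      then show ?thesis
        using lucas[of \<sigma> "p - 1" s'' "k - 1"] \<sigma> True by (simp add: binomial_eq_0 flip: s'_eq)
    next
      case False
      then have "\<kappa> + p * k - 1 = (\<kappa> - 1) + p * k" by simp
      then show ?thesis using lucas[of \<sigma> "\<kappa> - 1" s'' k] \<sigma> \<kappa> False by (simp flip: s'_eq)
    qed
    ultimately have "(x * of_nat (\<sigma> choose \<kappa>) + y * (if \<kappa> = 0 then 0 else of_nat (\<sigma> choose (\<kappa> - 1))))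
        * of_nat (s'' choose k) = 0"
      by (simp only: distrib_right mult.assoc)
    then show ?thesis using k \<kappa> \<sigma> by (intro choose_Suc_shift) auto
  qed
  \<comment> \<open>the smallest admissible last digit; its successor is admissible because \<open>1 \<le> A \<le> \<sigma> + digit_sum p s''\<close> and \<open>digit_sum p s''\<close> is positive\<close>
  define \<kappa> where "\<kappa> = A - digit_sum p s''"
  have \<kappa>: "\<kappa> \<le> \<sigma>" "Suc \<kappa> \<le> A" "A - \<kappa> \<le> digit_sum p s''"
    using A N n2 by (auto simp: \<kappa>_def)
  define u where "u = of_nat (\<sigma> - \<kappa>) * x + of_nat \<kappa> * y"
  have "of_nat (Suc \<sigma> - \<kappa>) * x + of_nat \<kappa> * y = 0"
    using \<kappa> by (intro row) auto
  moreover have "Suc \<sigma> - \<kappa> = Suc (\<sigma> - \<kappa>)" using \<kappa> by simp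
  ultimately have "u + x = 0" by (simp add: u_def algebra_simps)
  moreover have "of_nat (Suc \<sigma> - Suc \<kappa>) * x + of_nat (Suc \<kappa>) * y = 0"
    using \<kappa> by (intro row) auto
  then have "u + y = 0" by (simp add: u_def algebra_simps)
  ultimately show ?thesis by (metis add_left_cancel)
qed

text \<open>
  Here \<open>s\<^sub>0 + i = p + r\<^sub>0\<close> with \<open>r\<^sub>0 < s\<^sub>0\<close>,
  so low and high coefficients of \<open>f = (1 + z)\<^bsup>s\<^sub>0\<^esup> g\<close>
  interact.  The aim is to show that \<open>(1 + z)\<^sup>p\<close> divides \<open>f\<close>,
  that is \<open>f\<^sub>l = f\<^bsub>l + p\<^esub>\<close> for all \<open>l < p\<close>.
  Modulo \<open>(1 + z)\<^sup>p\<close> the terms of \<open>f\<close> above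
  \<open>s\<^sub>0\<close> vanish, so a single further vanishing term at some \<open>l0 \<le>
  s\<^sub>0\<close> leaves only \<open>s\<^sub>0\<close> of them, too few for a nonzero
  multiple of \<open>(1 + z)\<^bsup>s\<^sub>0\<^esup>\<close>.
\<close>

lemma vanishes_on_class_carry:
  assumes van: "vanishes_on_class s i g" and i: "p \<le> s mod p + i" and p_le: "p \<le> digit_sum p s"
    and s_ge: "s + i \<ge> (i + 1) * (p + 1)"
  shows "coeff ([:1, 1:] ^ s * g) s = 0"
proof -
  define s0 s' N r0 where "s0 = s mod p" "s' = s div p" "N = digit_sum p s'" "r0 = s0 + i - p"
  define f where "f = [:1, 1:] ^ s0 * g"
  note defs = s0_s'_N_r0_def
  have ip: "i < p" using van by (simp add: vanishes_on_class_def)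
  have s: "s = s0 + p * s'" by (simp add: defs)
  have N: "digit_sum p s = s0 + N" by (simp add: defs flip: digit_sum_mod_div[OF p_ge_2])
  have s0: "s0 < p" using p_pos by (simp add: defs)
  have r0: "r0 < s0" "r0 < i" "s0 + i = p + r0"
    using i[folded defs(1)] ip s0 unfolding defs(4) by linarith+
  have deg_f: "degree f \<le> p + r0"
    using vanishes_on_class_low_degree[OF van] r0 by (simp add: f_def defs)
  have high: "coeff f m = 0" if "m > p + r0" for m
    using that deg_f by (intro coeff_eq_0) auto
  have eq: "coeff f l * of_nat (s' choose k) + coeff f (l + p) * of_nat (s' choose (k - 1)) = 0"
    if "l < p" "1 \<le> k" "l + p * k < s" "(l + digit_sum p k) mod (p - 1) = (s0 + N) mod (p - 1)" for l k
    using vanishes_on_class_eq[OF van that(1-3)] that(4) N by (simp add: f_def defs)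
  have f_zero: "coeff f l = 0"
    if "l < p" "r0 < l" "1 \<le> a" "a \<le> N" "a = N \<Longrightarrow> l < s0" "(l + a) mod (p - 1) = (s0 + N) mod (p - 1)" for l a
  proof -
    have "coeff f (l + p) = 0" using that by (intro high) auto
    then show ?thesis
      using vanishes_on_class_zero[OF van that(1), of a] that N by (simp add: f_def defs)
  qed
  have top: "coeff f l = 0" if "s0 < l" "l < p" for l
    using that r0 p_le N by (intro f_zero[of l "N - (l - s0)"]) (auto simp: add.commute)
  \<comment> \<open>\<open>A\<close> is the digit sum that the class prescribes at \<open>l = 0\<close>; it is positive because \<open>p \<le> s0 + N\<close>\<close>
  define A where "A = N - (p - 1 - s0)"
  have A: "1 \<le> A" "A \<le> N" "s0 + N = A + (p - 1)" using p_le N s0 by (auto simp: A_def)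
  have A_mod: "A mod (p - 1) = (s0 + N) mod (p - 1)" unfolding A(3) by simp
  have eqA: "coeff f 0 * of_nat (s' choose k) + coeff f (0 + p) * of_nat (s' choose (k - 1)) = 0"
    if "1 \<le> k" "k \<le> s'" "digit_sum p k = A" for k
  proof (rule eq)
    have "p * k \<le> p * s'" using that(2) by (rule mult_le_mono2)
    then show "0 + p * k < s" using s r0 by linarith
    show "(0 + digit_sum p k) mod (p - 1) = (s0 + N) mod (p - 1)"
      using that(3) A_mod by simp
  qed (use that p_pos in auto)
  obtain l0 where l0: "l0 \<le> s0" "coeff f l0 = coeff f (l0 + p)"
  proof -
    consider "p dvd Suc s'" | "\<not> p dvd Suc s'" "p \<le> s'" | "\<not> p dvd Suc s'" "s' < p" by linarith
    then show ?thesis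
    proof cases
      case 1
      have "coeff f 0 = coeff f (0 + p)"
        using A(1) A(2)[unfolded defs(3)] 1 eqA by (rule low_eq_high_if_dvd_Suc)
      then show ?thesis by (intro that[of 0]) auto
    next
      case 2
      have "coeff f 0 = coeff f (0 + p)"
        using A(1) A(2)[unfolded defs(3)] 2 eqA by (rule low_eq_high_if_not_dvd_Suc)
      then show ?thesis by (intro that[of 0]) auto
    next
      case 3
      then have "Suc s' < p" by (metis Suc_lessI dvd_refl)
      then have Ns: "N = s'" by (simp add: defs(3) digit_sum_lt_p)
      \<comment> \<open>a one-digit \<open>s'\<close> gives only one equation at \<open>l = 0\<close>, but then \<open>l = r0 + 1\<close> works: the bound on \<open>r\<close> makes its digit sum \<open>N - i\<close> positive\<close>
      have "p * (i + 1) < p * (s' + 1)"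
      proof -
        have "s + i = r0 + p * (s' + 1)" using s r0 by simp
        moreover have "(i + 1) * (p + 1) = p * (i + 1) + i + 1" by simp
        ultimately show ?thesis using s_ge r0 by linarith
      qed
      then have "i < s'" by simp
      then have "coeff f (r0 + 1) = 0"
      proof (intro f_zero[of "r0 + 1" "N - i"])
        have "s0 + N = (r0 + 1 + (N - i)) + (p - 1)" using \<open>i < s'\<close> Ns r0 by simp
        then show "(r0 + 1 + (N - i)) mod (p - 1) = (s0 + N) mod (p - 1)"
          by (metis mod_add_self2)
      qed (use r0 Ns s0 in auto)
      moreover have "coeff f (r0 + 1 + p) = 0" by (intro high) auto
      ultimately show ?thesis using r0 by (intro that[of "r0 + 1"]) auto
    qed
  qed
  have fold: "coeff f l = coeff f (l + p)" if "l < p" for l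
  proof (rule reduction_mod_linear_power_p[of f s0 "{..s0} - {l0}"])
    show "coeff f m = 0" if "2 * p \<le> m" for m using that r0 s0 by (intro high) auto
    show "coeff f l = coeff f (l + p)" if "l < p" "l \<notin> {..s0} - {l0}" for l
    proof (cases "l = l0")
      case False
      then have "s0 < l" using that by auto
      then show ?thesis using top[of l] high[of "l + p"] that r0 by simp
    qed (use l0 in simp)
  qed (use s0 l0 that in \<open>auto simp: f_def\<close>)
  have "coeff ([:1, 1:] ^ s * g) s = coeff f s0 * of_nat (s' choose s')
      + (if s' = 0 then 0 else coeff f (s0 + p) * of_nat (s' choose (s' - 1)))"
    using vanishes_on_class_coeff[OF van s0, of s'] by (simp add: f_def defs)
  moreover have "coeff f (s0 + p) = 0" using r0 by (intro high) auto
  ultimately show ?thesis using fold[OF s0] by simp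
qed

lemma vanishes_on_class_top:
  assumes "vanishes_on_class s i g" "p \<le> digit_sum p s" "s + i \<ge> (i + 1) * (p + 1)"
  shows "coeff ([:1, 1:] ^ s * g) s = 0"
  using vanishes_on_class_no_carry vanishes_on_class_carry assms by (meson not_le)

end

section \<open>Linear algebra\<close>

lemma (in vector_space) dim_span_family:
  assumes fin: "finite I"
    and indep: "\<And>c x. (\<Sum>x\<in>I. scale (c x) (v x)) = 0 \<Longrightarrow> x \<in> I \<Longrightarrow> c x = 0"
  shows "dim (span (v ` I)) = card I"
proof -
  have inj: "inj_on v I"
  proof (rule inj_onI, rule ccontr)
    fix x y assume xy: "x \<in> I" "y \<in> I" "v x = v y" "x \<noteq> y"
    define c :: "'c \<Rightarrow> 'a" where "c z = (if z = x then 1 else 0) - (if z = y then 1 else 0)" for z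
    have "(\<Sum>z\<in>I. scale (c z) (v z)) = (\<Sum>z\<in>I. (if z = x then v z else 0) - (if z = y then v z else 0))"
      by (intro sum.cong) (auto simp: c_def scale_left_diff_distrib)
    also have "\<dots> = 0" using fin xy by (simp add: sum_subtractf)
    finally have "c x = 0" using xy(1) by (rule indep)
    then show False using xy by (simp add: c_def)
  qed
  have "independent (v ` I)"
  proof (rule independent_if_scalars_zero)
    fix f y assume "(\<Sum>x\<in>v ` I. scale (f x) x) = 0" "y \<in> v ` I"
    then show "f y = 0"
      using indep[of "\<lambda>x. f (v x)"] by (auto simp: sum.reindex[OF inj])
  qed (use fin in simp)
  then show ?thesis by (simp add: dim_eq_card_independent card_image[OF inj])
qed

lemma (in vector_space) dim_insert_finitely_spanned:
  assumes "S \<subseteq> span T" "finite T" "a \<notin> span S"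
  shows "dim (insert a S) = Suc (dim S)"
proof -
  obtain B where B: "B \<subseteq> S" "independent B" "S \<subseteq> span B" "card B = dim S"
    using basis_exists .
  have "span B = span S"
    using B by (meson span_eq span_superset subset_trans)
  then have a: "a \<notin> span B" using assms by simp
  have "finite B"
    using independent_span_bound[OF assms(2) B(2)] B(1) assms(1) by auto
  have "dim (insert a S) = card (insert a B)"
  proof (rule dim_unique)
    show "insert a B \<subseteq> insert a S" using B by auto
    show "insert a S \<subseteq> span (insert a B)"
      using B(3) span_mono[of B "insert a B"] by (auto intro: span_base)
    show "independent (insert a B)" using a B(2) by (rule independent_insertI)
  qed simp
  also have "\<dots> = Suc (dim S)"
    using a \<open>finite B\<close> B(4) by (metis card_insert_disjoint span_base)
  finally show ?thesis .
qed

lemma (in vector_space) dim_union_independent_family: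
  assumes "finite P" "finite T" "S \<subseteq> span T"
    and "\<And>x. x \<in> P \<Longrightarrow> e x \<notin> span (S \<union> e ` (P - {x}))"
  shows "dim (S \<union> e ` P) = dim S + card P"
  using assms(1,4)
proof (induction P rule: finite_induct)
  case (insert x P)
  have "dim (insert (e x) (S \<union> e ` P)) = Suc (dim (S \<union> e ` P))"
  proof (rule dim_insert_finitely_spanned)
    show "S \<union> e ` P \<subseteq> span (T \<union> e ` P)"
      using assms(3) span_mono[of T "T \<union> e ` P"] by (auto intro: span_base)
    show "finite (T \<union> e ` P)" using assms(2) insert.hyps by simp
    show "e x \<notin> span (S \<union> e ` P)"
      using insert.prems[of x] insert.hyps by simp
  qed
  moreover have "dim (S \<union> e ` P) = dim S + card P"
  proof (rule insert.IH)
    fix y assume y: "y \<in> P"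
    have "span (S \<union> e ` (P - {y})) \<subseteq> span (S \<union> e ` (insert x P - {y}))"
      by (intro span_mono) auto
    then show "e y \<notin> span (S \<union> e ` (P - {y}))" using insert.prems[of y] y by auto
  qed
  ultimately show ?case using insert.hyps by simp
qed simp

text \<open>
  Extend a basis of the span of \<open>U\<close> by \<open>w\<close> and take the coordinate
  at \<open>w\<close>.
\<close>

lemma (in vector_space) separating_functional:
  assumes "w \<notin> span U"
  shows "\<exists>\<phi>. (\<forall>x y. \<phi> (x + y) = \<phi> x + \<phi> y) \<and> (\<forall>c x. \<phi> (scale c x) = c * \<phi> x)
    \<and> (\<forall>x\<in>U. \<phi> x = 0) \<and> \<phi> w = 1"
proof -
  obtain B where B: "B \<subseteq> U" "independent B" "U \<subseteq> span B"
    using maximal_independent_subset .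
  then have w: "w \<notin> span B" using assms span_mono[of B U] by auto
  have ind: "independent (insert w B)" using w B(2) by (rule independent_insertI)
  define C where "C = extend_basis (insert w B)"
  have C: "insert w B \<subseteq> C" "independent C" "span C = UNIV"
    unfolding C_def
    by (rule extend_basis_superset[OF ind] independent_extend_basis[OF ind] span_extend_basis[OF ind])+
  show ?thesis
  proof (intro exI[of _ "\<lambda>x. representation C x w"] conjI allI ballI)
    fix x y show "representation C (x + y) w = representation C x w + representation C y w"
      using C by (simp add: representation_add)
  next
    fix c x show "representation C (scale c x) w = c * representation C x w"
      using C by (simp add: representation_scale)
  next
    fix x assume "x \<in> U"
    then have "representation C x w = representation B x w"
      using B C by (subst representation_extend[of C x B]) auto
    also have "\<dots> = 0" using w representation_ne_zero[of B x w] by (auto intro: span_base)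
    finally show "representation C x w = 0" .
  next
    show "representation C w w = 1" using C by (simp add: representation_basis)
  qed
qed

global_interpretation poly_vs: vector_space "smult :: 'a::field \<Rightarrow> 'a poly \<Rightarrow> 'a poly"
  by unfold_locales (simp_all add: smult_add_right smult_add_left)

context prime_field begin

text \<open>
  Multiplying by \<open>t\<^bsup>p - 1 - a\<^esup>\<close> and summing over all
  \<open>t\<close> isolates \<open>- v a\<close>, by the power sums.  For \<open>a = 0\<close>
  this would also pick up the exponent \<open>p - 1\<close>; the value at \<open>t = 0\<close>
  is used instead.
\<close>

lemma vandermonde_subspace:
  fixes scale :: "'k \<Rightarrow> 'b::ab_group_add \<Rightarrow> 'b" and v :: "nat \<Rightarrow> 'b"
  assumes vs: "vector_space scale" and W: "module.subspace scale W"
    and d: "d < p" and in_W: "\<And>t. (\<Sum>a\<le>d. scale (t ^ a) (v a)) \<in> W" and a: "a \<le> d"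
  shows "v a \<in> W"
proof -
  interpret vector_space scale by fact
  show ?thesis
  proof (cases "a = 0")
    case True
    have "(\<Sum>b\<le>d. scale (0 ^ b) (v b)) = (\<Sum>b\<le>d. if b = 0 then v b else 0)"
      by (intro sum.cong) auto
    then show ?thesis using in_W[of 0] True by simp
  next
    case False
    have "(\<Sum>t\<in>UNIV. scale (t ^ (p - 1 - a)) (\<Sum>b\<le>d. scale (t ^ b) (v b)))
        = (\<Sum>b\<le>d. scale (\<Sum>t\<in>UNIV. t ^ (p - 1 - a + b)) (v b))"
      unfolding scale_sum_right scale_sum_left scale_scale
      by (subst sum.swap) (simp add: power_add)
    also have "\<dots> = (\<Sum>b\<le>d. if b = a then - v b else 0)"
    proof (intro sum.cong refl)
      fix b assume b: "b \<in> {..d}"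
      have "p - 1 - a + b > 0 \<and> (p - 1) dvd (p - 1 - a + b) \<longleftrightarrow> b = a"
      proof
        assume *: "p - 1 - a + b > 0 \<and> (p - 1) dvd (p - 1 - a + b)"
        then obtain q where q: "p - 1 - a + b = (p - 1) * q" by blast
        have "p - 1 - a + b < (p - 1) * 2" using a b d False by auto
        then have "(p - 1) * q < (p - 1) * 2" unfolding q .
        then have "q < 2" by simp
        moreover have "q \<noteq> 0" using *[unfolded q] by (intro notI) simp
        ultimately have "q = 1" by simp
        then show "b = a" using q a b d by simp
      qed (use a d p_ge_2 in auto)
      then show "scale (\<Sum>t\<in>UNIV. t ^ (p - 1 - a + b)) (v b) = (if b = a then - v b else 0)"
        unfolding sum_powers by simp
    qed
    also have "\<dots> = - v a" using a by simp
    finally have "- v a \<in> W"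
      using W in_W by (metis (no_types, lifting) subspace_scale subspace_sum)
    then show ?thesis using W subspace_neg by fastforce
  qed
qed

text \<open>
  For \<open>d = p\<close> the exponents 1 and \<open>p\<close> give the same function of
  \<open>t\<close>, so only \<open>v 1 + v p\<close> is found from the values at finite
  \<open>t\<close>; the value at infinity, which is \<open>v p\<close>, separates the two.
\<close>

lemma vandermonde_subspace_infinity:
  fixes scale :: "'k \<Rightarrow> 'b::ab_group_add \<Rightarrow> 'b" and v :: "nat \<Rightarrow> 'b"
  assumes vs: "vector_space scale" and W: "module.subspace scale W"
    and d: "d \<le> p" and in_W: "\<And>t. (\<Sum>a\<le>d. scale (t ^ a) (v a)) \<in> W" and top: "v d \<in> W"
    and a: "a \<le> d"
  shows "v a \<in> W"
proof (cases "d < p")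
  case True
  then show ?thesis using vandermonde_subspace[OF vs W _ in_W a] by simp
next
  case False
  interpret vector_space scale by fact
  have d: "d = p" using False d by simp
  \<comment> \<open>\<open>t\<^sup>p = t\<close> merges the coefficients at 1 and \<open>p\<close>\<close>
  define v' where "v' b = (if b = 1 then v 1 + v p else v b)" for b
  have v': "v' b \<in> W" if "b \<le> p - 1" for b
  proof (rule vandermonde_subspace[OF vs W _ _ that])
    fix t :: 'k
    have "(\<Sum>a\<le>p. scale (t ^ a) (v a)) = (\<Sum>a\<le>p - 1. scale (t ^ a) (v a)) + scale t (v p)"
    proof -
      have "{..p} = insert p {..p - 1}" using p_pos by auto
      then show ?thesis using p_pos by (simp add: power_p add.commute)
    qed
    also have "scale t (v p) = (\<Sum>a\<le>p - 1. if a = 1 then scale (t ^ a) (v p) else 0)"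
    proof -
      have "1 \<le> p - 1" using p_ge_2 by linarith
      then show ?thesis by simp
    qed
    also have "(\<Sum>a\<le>p - 1. scale (t ^ a) (v a)) + \<dots> = (\<Sum>a\<le>p - 1. scale (t ^ a) (v' a))"
      unfolding sum.distrib[symmetric] by (intro sum.cong) (auto simp: v'_def scale_right_distrib)
    finally show "(\<Sum>a\<le>p - 1. scale (t ^ a) (v' a)) \<in> W" using in_W[of t] d by simp
  qed (use p_pos in simp)
  consider "a = p" | "a = 1" | "a \<le> p - 1" "a \<noteq> 1" using a d by linarith
  then show ?thesis
  proof cases
    case 2
    have "v 1 + v p \<in> W" using v'[of 1] p_ge_2 by (simp add: v'_def)
    then have "(v 1 + v p) - v p \<in> W" using W top d by (intro subspace_diff) auto
    then show ?thesis using 2 by simp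
  qed (use v'[of a] top d in \<open>auto simp: v'_def\<close>)
qed

section \<open>Powers of linear forms split by digit sum\<close>

text \<open>
  The polynomial written \<open>H\<^sub>a\<close> in the introduction.
\<close>

definition digit_part :: "nat \<Rightarrow> nat \<Rightarrow> 'k poly" where
  "digit_part s a = (\<Sum>k | k \<le> s \<and> digit_sum p k = a. monom (of_nat (s choose k)) k)"

lemma coeff_digit_part:
  "coeff (digit_part s a) k = (if digit_sum p k = a then of_nat (s choose k) else 0)"
  by (auto simp: digit_part_def coeff_sum binomial_eq_0)

lemma digit_part_eq_0: "digit_sum p s < a \<Longrightarrow> digit_part s a = 0"
  using choose_neq_0_digit_sum by (intro poly_eqI) (fastforce simp: coeff_digit_part)

lemma digit_part_top: "digit_part s (digit_sum p s) = monom 1 s"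
  using choose_neq_0_digit_sum by (intro poly_eqI) (auto simp: coeff_digit_part)

lemma coeff_linear_power': "coeff ([:1, t:] ^ s) k = of_nat (s choose k) * (t::'k) ^ k"
proof -
  have "[:1, t:] ^ s = pcompose ([:1, 1:] ^ s) [:0, t:]"
    by (simp add: pcompose_power pcompose_pCons)
  then show ?thesis
    by (simp add: coeff_pcompose_linear coeff_linear_power mult.commute)
qed

lemma linear_power_eq_sum_digit_parts:
  "[:1, t:] ^ s = (\<Sum>a\<le>digit_sum p s. smult (t ^ a) (digit_part s a))"
proof (rule poly_eqI)
  fix k
  have "coeff (\<Sum>a\<le>digit_sum p s. smult (t ^ a) (digit_part s a)) k
      = (\<Sum>a\<le>digit_sum p s. if a = digit_sum p k then t ^ k * of_nat (s choose k) else 0)"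
    unfolding coeff_sum by (intro sum.cong) (auto simp: coeff_digit_part power_digit_sum)
  also have "\<dots> = t ^ k * of_nat (s choose k)"
    using choose_neq_0_digit_sum[of s k] by (auto simp: not_le)
  finally show "coeff ([:1, t:] ^ s) k = coeff (\<Sum>a\<le>digit_sum p s. smult (t ^ a) (digit_part s a)) k"
    by (simp add: coeff_linear_power' mult.commute)
qed

lemma span_linear_powers_eq_span_digit_parts:
  assumes "digit_sum p s \<le> p"
  shows "poly_vs.span {q * [:a, c:] ^ s | q a c. (a, c) \<noteq> (0, 0::'k) \<and> degree q \<le> i}
    = poly_vs.span ((\<lambda>(j, a). monom 1 j * digit_part s a) ` ({..i} \<times> {..digit_sum p s}))"
    (is "poly_vs.span ?L = poly_vs.span ?R")
proof (rule poly_vs.span_eq[THEN iffD2], intro conjI subsetI)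
  fix x assume "x \<in> ?L"
  then obtain q a c where x: "x = q * [:a, c:] ^ s" "(a, c) \<noteq> (0, 0)" "degree q \<le> i" by blast
  have "\<exists>\<beta>. [:a, c:] ^ s = (\<Sum>b\<le>digit_sum p s. smult (\<beta> b) (digit_part s b))"
  proof (cases "a = 0")
    case True
    have "[:a, c:] = monom c 1" using True by (simp add: monom_altdef)
    then have "[:a, c:] ^ s = smult (c ^ s) (digit_part s (digit_sum p s))"
      by (simp add: digit_part_top monom_power smult_monom)
    also have "\<dots> = (\<Sum>b\<le>digit_sum p s. if b = digit_sum p s then smult (c ^ s) (digit_part s b) else 0)"
      by simp
    also have "\<dots> = (\<Sum>b\<le>digit_sum p s. smult (if b = digit_sum p s then c ^ s else 0) (digit_part s b))"
      by (intro sum.cong) auto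
    finally show ?thesis by (rule exI[of _ "\<lambda>b. if b = digit_sum p s then c ^ s else 0"])
  next
    case False
    then have "[:a, c:] ^ s = smult (a ^ s) ([:1, c / a:] ^ s)"
      by (simp flip: smult_power)
    also have "\<dots> = (\<Sum>b\<le>digit_sum p s. smult (a ^ s * (c / a) ^ b) (digit_part s b))"
      by (simp add: linear_power_eq_sum_digit_parts poly_vs.scale_sum_right)
    finally show ?thesis by (rule exI[of _ "\<lambda>b. a ^ s * (c / a) ^ b"])
  qed
  then obtain \<beta> where \<beta>: "[:a, c:] ^ s = (\<Sum>b\<le>digit_sum p s. smult (\<beta> b) (digit_part s b))" ..
  have "x = (\<Sum>j\<le>i. monom (coeff q j) j) * (\<Sum>b\<le>digit_sum p s. smult (\<beta> b) (digit_part s b))"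
    unfolding x(1) \<beta> using poly_as_sum_of_monoms'[OF x(3)] by simp
  also have "\<dots> = (\<Sum>j\<le>i. \<Sum>b\<le>digit_sum p s. smult (coeff q j * \<beta> b) (monom 1 j * digit_part s b))"
    unfolding sum_product
  proof (intro sum.cong refl)
    fix j b
    have "monom (coeff q j) j = smult (coeff q j) (monom 1 j)" by (simp add: smult_monom)
    then show "monom (coeff q j) j * smult (\<beta> b) (digit_part s b)
      = smult (coeff q j * \<beta> b) (monom 1 j * digit_part s b)"
      by (simp add: mult.commute)
  qed
  also have "\<dots> \<in> poly_vs.span ?R"
    by (intro poly_vs.span_sum poly_vs.span_scale poly_vs.span_base) auto
  finally show "x \<in> poly_vs.span ?R" .
next
  fix x assume "x \<in> ?R"
  then obtain j a where x: "x = monom 1 j * digit_part s a" "j \<le> i" "a \<le> digit_sum p s" by auto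
  show "x \<in> poly_vs.span ?L" unfolding x(1)
  proof (rule vandermonde_subspace_infinity[OF poly_vs.vector_space_axioms poly_vs.subspace_span assms _ _ x(3)])
    fix t :: 'k
    have "(\<Sum>a\<le>digit_sum p s. smult (t ^ a) (monom 1 j * digit_part s a)) = monom 1 j * [:1, t:] ^ s"
      by (simp add: linear_power_eq_sum_digit_parts sum_distrib_left)
    also have "\<dots> \<in> ?L" using x(2) by (intro CollectI exI[of _ "monom 1 j"] exI[of _ 1] exI[of _ t]) (auto simp: degree_monom_eq)
    finally show "(\<Sum>a\<le>digit_sum p s. smult (t ^ a) (monom 1 j * digit_part s a)) \<in> poly_vs.span ?L"
      by (rule poly_vs.span_base)
  next
    have "monom 1 j * digit_part s (digit_sum p s) = monom 1 j * [:0, 1:] ^ s"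
      by (simp add: digit_part_top monom_altdef)
    also have "\<dots> \<in> ?L" using x(2) by (intro CollectI exI[of _ "monom 1 j"] exI[of _ 0] exI[of _ 1]) (auto simp: degree_monom_eq)
    finally show "monom 1 j * digit_part s (digit_sum p s) \<in> poly_vs.span ?L"
      by (rule poly_vs.span_base)
  qed
qed

text \<open>
  Since \<open>s\<^sub>0 + i < p\<close>, multiplication by \<open>z\<^sup>j\<close> causes no
  carry, and the coefficient at \<open>l + p k\<close> is that of a convolution with \<open>(1
  + z)\<^bsup>s\<^sub>0\<^esup>\<close> times a factor depending on \<open>k\<close> alone.
\<close>

lemma coeff_sum_mult_digit_part:
  fixes c :: "nat \<times> nat \<Rightarrow> 'k"
  assumes i: "s mod p + i < p" and l: "l \<le> s mod p + i"
  shows "coeff (\<Sum>x\<in>{..i} \<times> {..N}. smult (c x) (case x of (j, a) \<Rightarrow> monom 1 j * digit_part s a)) (l + p * k)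
    = of_nat (s div p choose k) * (\<Sum>j | j \<le> i \<and> j \<le> l \<and> l - j + digit_sum p k \<le> N.
        c (j, l - j + digit_sum p k) * of_nat (s mod p choose (l - j)))"
proof -
  have "coeff (\<Sum>x\<in>{..i} \<times> {..N}. smult (c x) (case x of (j, a) \<Rightarrow> monom 1 j * digit_part s a)) (l + p * k)
     = (\<Sum>j\<le>i. \<Sum>a\<le>N. c (j, a) * coeff (monom 1 j * digit_part s a) (l + p * k))"
    unfolding sum.cartesian_product coeff_sum
  proof (rule sum.cong[OF refl])
    fix x :: "nat \<times> nat"
    show "coeff (smult (c x) (case x of (j, a) \<Rightarrow> monom 1 j * digit_part s a)) (l + p * k)
      = (case x of (j, a) \<Rightarrow> c (j, a) * coeff (monom 1 j * digit_part s a) (l + p * k))"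
      by (cases x) (simp only: prod.case coeff_smult)
  qed
  also have "\<dots> = (\<Sum>j\<le>i. if j \<le> l \<and> l - j + digit_sum p k \<le> N
      then c (j, l - j + digit_sum p k) * (of_nat (s mod p choose (l - j)) * of_nat (s div p choose k)) else 0)"
  proof (intro sum.cong refl)
    fix j assume j: "j \<in> {..i}"
    show "(\<Sum>a\<le>N. c (j, a) * coeff (monom 1 j * digit_part s a) (l + p * k)) =
      (if j \<le> l \<and> l - j + digit_sum p k \<le> N
       then c (j, l - j + digit_sum p k) * (of_nat (s mod p choose (l - j)) * of_nat (s div p choose k)) else 0)"
    proof (cases "j \<le> l")
      case True
      have lt: "l - j < p" "s mod p < p" using l i p_pos by auto
      have "(\<Sum>a\<le>N. c (j, a) * coeff (monom 1 j * digit_part s a) (l + p * k)) = (\<Sum>a\<le>N.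
        if a = l - j + digit_sum p k then c (j, a) * (of_nat (s mod p choose (l - j)) * of_nat (s div p choose k)) else 0)"
      proof (rule sum.cong[OF refl])
        fix a
        have "coeff (monom 1 j * digit_part s a) (l + p * k) = coeff (digit_part s a) ((l - j) + p * k)"
          using True by (simp add: coeff_monom_mult)
        also have "\<dots> = (if a = l - j + digit_sum p k
            then of_nat (s mod p choose (l - j)) * of_nat (s div p choose k) else 0)"
          using lucas[OF lt(2,1), of "s div p" k]
          unfolding coeff_digit_part digit_sum_split[OF lt(1)] mod_mult_div_eq by auto
        finally show "c (j, a) * coeff (monom 1 j * digit_part s a) (l + p * k) = (if a = l - j + digit_sum p k
            then c (j, a) * (of_nat (s mod p choose (l - j)) * of_nat (s div p choose k)) else 0)"
          by simp
      qed
      then show ?thesis using True by simp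
    next
      case False
      have "coeff (monom 1 j * digit_part s a) (l + p * k) = 0" for a
      proof (cases "j \<le> l + p * k")
        case True
        then have "k \<noteq> 0" using False by (intro notI) simp
        then have "l + p * k - j = (p + l - j) + p * (k - 1)"
          using False j i by (cases k) auto
        moreover have "of_nat (s choose ((p + l - j) + p * (k - 1))) = (0::'k)"
          using lucas[of "s mod p" "p + l - j" "s div p" "k - 1"] False j i p_pos
          by (simp add: binomial_eq_0)
        ultimately show ?thesis using True by (simp add: coeff_monom_mult coeff_digit_part)
      qed (simp add: coeff_monom_mult)
      then show ?thesis using False by simp
    qed
  qed
  also have "\<dots> = (\<Sum>j | j \<le> i \<and> j \<le> l \<and> l - j + digit_sum p k \<le> N.
        c (j, l - j + digit_sum p k) * (of_nat (s mod p choose (l - j)) * of_nat (s div p choose k)))"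
    unfolding sum.inter_filter[OF finite_atMost, symmetric] by (intro sum.cong) auto
  finally show ?thesis by (simp add: sum_distrib_left mult_ac)
qed

text \<open>
  The coefficients \<open>c (j, a)\<close> with \<open>j + a = d\<close> form a polynomial
  \<open>g\<close> in \<open>j\<close>.  Every digit sum up to \<open>N\<close> occurs among
  the exponents of \<open>(1 + z)\<^bsup>s'\<^esup>\<close>, so the vanishing of the
  combination says that \<open>(1 + z)\<^bsup>s\<^sub>0\<^esup> g\<close> vanishes on the
  window \<open>{d - N..d}\<close>.
\<close>

lemma digit_parts_independent:
  assumes i: "s mod p + i < p" "i \<le> digit_sum p (s div p)"
    and zero: "(\<Sum>x\<in>{..i} \<times> {..digit_sum p s}. smult (c x) (case x of (j, a) \<Rightarrow> monom 1 j * digit_part s a)) = 0"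
    and x: "x \<in> {..i} \<times> {..digit_sum p s}"
  shows "c x = 0"
proof -
  define s0 s' where "s0 = s mod p" "s' = s div p"
  obtain j0 a0 where x_eq: "x = (j0, a0)" by (cases x)
  define d where "d = j0 + a0"
  have ds: "digit_sum p s = s0 + digit_sum p s'" by (simp add: s0_s'_def flip: digit_sum_mod_div[OF p_ge_2])
  \<comment> \<open>the indices \<open>j\<close> for which \<open>(j, d - j)\<close> lies in the index set of the sum\<close>
  define J where "J = {j. j \<le> i \<and> j \<le> d \<and> d - j \<le> digit_sum p s}"
  have fin: "finite J" by (simp add: J_def)
  define g where "g = (\<Sum>j\<in>J. monom (c (j, d - j)) j)"
  have coeff_g: "coeff g j = (if j \<in> J then c (j, d - j) else 0)" for j
    using fin by (simp add: g_def coeff_sum)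
  have "g = 0"
  proof (rule window_vanishing[of i "digit_sum p s'" s0 g d])
    fix b assume "coeff g b \<noteq> 0"
    then show "b \<le> i \<and> b \<le> d \<and> d \<le> b + s0 + digit_sum p s'"
      using ds by (auto simp: coeff_g J_def split: if_splits)
  next
    fix l assume l: "l \<le> d" "d \<le> l + digit_sum p s'"
    show "coeff ([:1, 1:] ^ s0 * g) l = 0"
    proof (cases "l \<le> s0 + i")
      case True
      obtain k where k: "digit_sum p k = d - l" "of_nat (s' choose k) \<noteq> (0::'k)"
        using exists_choose_digit_sum[of "d - l" s'] l by (metis le_diff_conv add.commute)
      have set_eq: "{j. j \<le> i \<and> j \<le> l \<and> l - j + digit_sum p k \<le> digit_sum p s} = {..l} \<inter> J"
        using l k by (auto simp: J_def)
      have "coeff ([:1, 1:] ^ s0 * g) l = (\<Sum>j\<le>l. coeff g j * of_nat (s0 choose (l - j)))"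
        by (subst mult.commute) (simp add: coeff_mult coeff_linear_power)
      also have "\<dots> = (\<Sum>j\<in>{..l} \<inter> J. c (j, l - j + digit_sum p k) * of_nat (s0 choose (l - j)))"
        using l k by (intro sum.mono_neutral_cong_right) (auto simp: coeff_g)
      finally have "of_nat (s' choose k) * coeff ([:1, 1:] ^ s0 * g) l = 0"
        using coeff_sum_mult_digit_part[where s = s and i = i and l = l and N = "digit_sum p s" and c = c and k = k] True i
        unfolding zero by (simp add: s0_s'_def[symmetric] set_eq)
      then show ?thesis using k by simp
    next
      case False
      have "degree g \<le> i" by (rule degree_le) (auto simp: coeff_g J_def)
      then have "degree ([:1, 1:] ^ s0 * g) < l"
        using degree_mult_le[of "[:1, 1:] ^ s0" g] False by (simp add: degree_linear_power)
      then show ?thesis by (rule coeff_eq_0)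
    qed
  qed (use i in \<open>auto simp: s0_s'_def\<close>)
  moreover have "j0 \<in> J" using x by (auto simp: J_def d_def x_eq)
  ultimately show ?thesis using coeff_g[of j0] by (simp add: x_eq d_def)
qed

section \<open>Removing the lowest digit\<close>

text \<open>
  The polynomial \<open>z\<^sup>l H\<^sub>b(z\<^sup>p)\<close>, with \<open>H\<^sub>b\<close>
  taken from \<open>(1 + z)\<^bsup>s'\<^esup>\<close>.  For \<open>l < p\<close> these model
  the tensor product of polynomials in \<open>z\<close> with the Frobenius twist of the span
  of the \<open>H\<^sub>b\<close>.
\<close>

definition twisted_part :: "nat \<Rightarrow> nat \<Rightarrow> nat \<Rightarrow> 'k poly" where
  "twisted_part s' l b = monom 1 l * pcompose (digit_part s' b) (monom 1 p)"

lemma twisted_part_eq_0: "digit_sum p s' < b \<Longrightarrow> twisted_part s' l b = 0"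
  by (simp add: twisted_part_def digit_part_eq_0)

lemma coeff_twisted_part:
  assumes "m < 2 * p" "l < p"
  shows "coeff (twisted_part s' m b) (l + p * k) =
    (if l = m then coeff (digit_part s' b) k else 0)
    + (if k \<noteq> 0 \<and> l + p = m then coeff (digit_part s' b) (k - 1) else 0)"
  unfolding twisted_part_def using assms by (subst coeff_mult_pcompose_monom) auto

text \<open>
  The factorization \<open>(1 + z)\<^sup>s = (1 + z)\<^bsup>s\<^sub>0\<^esup> (1 +
  z\<^sup>p)\<^bsup>s'\<^esup>\<close>, sorted by digit sum.
\<close>

lemma digit_part_split:
  "digit_part s a = (\<Sum>l\<le>a. smult (of_nat (s mod p choose l)) (twisted_part (s div p) l (a - l)))"
proof (rule poly_eqI)
  fix n
  define l0 k where "l0 = n mod p" "k = n div p"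
  have l0: "l0 < p" using p_pos by (simp add: l0_k_def)
  have n: "n = l0 + p * k" by (simp add: l0_k_def)
  have s: "s mod p < p" using p_pos by simp
  have "coeff (\<Sum>l\<le>a. smult (of_nat (s mod p choose l)) (twisted_part (s div p) l (a - l))) n
      = (\<Sum>l\<le>a. if l = l0 then of_nat (s mod p choose l0) * coeff (digit_part (s div p) (a - l0)) k else 0)"
    unfolding coeff_sum
  proof (rule sum.cong[OF refl])
    fix l assume "l \<in> {..a}"
    show "coeff (smult (of_nat (s mod p choose l)) (twisted_part (s div p) l (a - l))) n
      = (if l = l0 then of_nat (s mod p choose l0) * coeff (digit_part (s div p) (a - l0)) k else 0)"
    proof (cases "l < p")
      case True
      then show ?thesis
        unfolding n coeff_smult using coeff_twisted_part[of l l0 "s div p" "a - l" k] l0 by auto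
    next
      case False
      then have "(s mod p choose l) = 0" using s by (intro binomial_eq_0) simp
      then show ?thesis using False l0 by (metis mult_zero_left of_nat_0 smult_0_left coeff_0)
    qed
  qed
  also have "\<dots> = (if l0 \<le> a then of_nat (s mod p choose l0) * coeff (digit_part (s div p) (a - l0)) k else 0)"
    by simp
  also have "\<dots> = (if digit_sum p n = a then of_nat (s mod p choose l0) * of_nat (s div p choose k) else 0)"
    unfolding n digit_sum_split[OF l0] coeff_digit_part by auto
  also have "\<dots> = coeff (digit_part s a) n"
    using lucas[OF s l0, of "s div p" k] unfolding coeff_digit_part n mod_mult_div_eq by simp
  finally show "coeff (digit_part s a) n =
    coeff (\<Sum>l\<le>a. smult (of_nat (s mod p choose l)) (twisted_part (s div p) l (a - l))) n" by simp
qed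

lemma monom_mult_digit_part:
  "monom 1 j * digit_part s a
    = (\<Sum>l\<le>a. smult (of_nat (s mod p choose l)) (twisted_part (s div p) (j + l) (a - l)))"
proof -
  have "monom 1 j * twisted_part s' l b = twisted_part s' (j + l) b" for s' l b
    by (simp add: twisted_part_def mult_monom flip: mult.assoc)
  then show ?thesis by (subst digit_part_split) (simp add: sum_distrib_left)
qed

text \<open>
  Dual to \<open>digit_parts_independent\<close>.  Otherwise some functional kills all
  \<open>z\<^sup>j H\<^sub>a\<close> but not the twisted part of some indices with \<open>l +
  b = d\<close>.  Its values on the twisted parts with \<open>l + b = d\<close> are the
  coefficients of a nonzero polynomial \<open>g\<close> of degree at most \<open>N\<close>,
  and \<open>(1 + z)\<^bsup>s\<^sub>0\<^esup> g\<close> vanishes on the window \<open>{d -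
  i..d}\<close>.
\<close>

lemma span_digit_parts_eq_span_twisted_parts:
  assumes i: "digit_sum p (s div p) \<le> i" "digit_sum p s < p"
  shows "poly_vs.span ((\<lambda>(j, a). monom 1 j * digit_part s a) ` ({..i} \<times> {..digit_sum p s}))
    = poly_vs.span ((\<lambda>(l, b). twisted_part (s div p) l b) ` ({..s mod p + i} \<times> {..digit_sum p (s div p)}))"
    (is "poly_vs.span ?U = poly_vs.span ?W")
proof (rule poly_vs.span_eq[THEN iffD2], intro conjI subsetI)
  fix x assume "x \<in> ?U"
  then obtain j a where x: "x = monom 1 j * digit_part s a" "j \<le> i" by auto
  show "x \<in> poly_vs.span ?W"
    unfolding x(1) monom_mult_digit_part
  proof (rule poly_vs.span_sum)
    fix l assume "l \<in> {..a}"
    consider "s mod p < l" | "digit_sum p (s div p) < a - l" | "l \<le> s mod p" "a - l \<le> digit_sum p (s div p)"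
      by linarith
    then show "smult (of_nat (s mod p choose l)) (twisted_part (s div p) (j + l) (a - l)) \<in> poly_vs.span ?W"
    proof cases
      case 3
      then show ?thesis using x(2) by (intro poly_vs.span_scale poly_vs.span_base) auto
    qed (simp_all add: binomial_eq_0 twisted_part_eq_0 poly_vs.span_zero)
  qed
next
  fix x assume "x \<in> ?W"
  define s0 s' N where "s0 = s mod p" "s' = s div p" "N = digit_sum p s'"
  note defs = s0_s'_N_def
  have \<sigma>: "digit_sum p s = s0 + N" by (simp add: defs flip: digit_sum_mod_div[OF p_ge_2])
  obtain l0 b0 where x: "x = twisted_part s' l0 b0" "l0 \<le> s0 + i" "b0 \<le> N"
    using \<open>x \<in> ?W\<close> by (auto simp: defs)
  show "x \<in> poly_vs.span ?U"
  proof (rule ccontr)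
    assume "x \<notin> poly_vs.span ?U"
    from poly_vs.separating_functional[OF this] obtain \<phi> :: "'k poly \<Rightarrow> 'k" where add: "\<And>u v. \<phi> (u + v) = \<phi> u + \<phi> v"
      and smult: "\<And>c u. \<phi> (smult c u) = c * \<phi> u"
      and U: "\<And>u. u \<in> ?U \<Longrightarrow> \<phi> u = 0" and x1: "\<phi> x = 1"
      by blast
    have zero: "\<phi> 0 = 0" using smult[of 0 0] by simp
    have sum: "\<phi> (sum h A) = (\<Sum>a\<in>A. \<phi> (h a))" for h :: "nat \<Rightarrow> 'k poly" and A
      by (induction A rule: infinite_finite_induct) (simp_all add: zero add)
    have U': "\<phi> (monom 1 j * digit_part s a) = 0" if "j \<le> i" for j a
    proof (cases "a \<le> digit_sum p s")
      case True
      then show ?thesis using that by (intro U) auto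
    qed (simp add: digit_part_eq_0 zero)
    define d where "d = l0 + b0"
    define J where "J = {b. b \<le> N \<and> b \<le> d \<and> d - b \<le> s0 + i}"
    have fin: "finite J" by (simp add: J_def)
    define g where "g = (\<Sum>b\<in>J. monom (\<phi> (twisted_part s' (d - b) b)) b)"
    have coeff_g: "coeff g b = (if b \<in> J then \<phi> (twisted_part s' (d - b) b) else 0)" for b
      using fin by (simp add: g_def coeff_sum)
    have "g = 0"
    proof (rule window_vanishing[of N i s0 g d])
      fix b assume "coeff g b \<noteq> 0"
      then show "b \<le> N \<and> b \<le> d \<and> d \<le> b + s0 + i"
        by (auto simp: coeff_g J_def split: if_splits)
    next
      fix a assume a: "a \<le> d" "d \<le> a + i"
      have "coeff ([:1, 1:] ^ s0 * g) a = (\<Sum>l\<le>a. of_nat (s0 choose l) * coeff g (a - l))"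
        by (simp add: coeff_mult coeff_linear_power)
      also have "\<dots> = (\<Sum>l\<le>a. of_nat (s0 choose l) * \<phi> (twisted_part s' ((d - a) + l) (a - l)))"
      proof (rule sum.cong[OF refl])
        fix l assume l: "l \<in> {..a}"
        have eq: "d - (a - l) = (d - a) + l" using l a by simp
        consider "s0 < l" | "l \<le> s0" "N < a - l" | "l \<le> s0" "a - l \<le> N" by linarith
        then show "of_nat (s0 choose l) * coeff g (a - l)
            = of_nat (s0 choose l) * \<phi> (twisted_part s' ((d - a) + l) (a - l))"
        proof cases
          case 2
          then show ?thesis by (simp add: coeff_g J_def twisted_part_eq_0 zero defs)
        next
          case 3
          then have "a - l \<in> J" using a l by (auto simp: J_def)
          then show ?thesis by (simp only: coeff_g eq if_True)
        qed (simp add: binomial_eq_0)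
      qed
      also have "\<dots> = \<phi> (monom 1 (d - a) * digit_part s a)"
        by (simp add: monom_mult_digit_part sum smult defs)
      also have "\<dots> = 0" using a by (intro U') simp
      finally show "coeff ([:1, 1:] ^ s0 * g) a = 0" .
    qed (use i \<sigma> in \<open>auto simp: defs\<close>)
    moreover have "b0 \<in> J" using x by (auto simp: J_def d_def)
    ultimately show False using coeff_g[of b0] x1 x(1) by (simp add: d_def)
  qed
qed

text \<open>
  Sorting exponents modulo \<open>p\<close> separates different \<open>l < p\<close>.  If
  \<open>l\<close> may exceed \<open>p\<close>, the parts for \<open>l\<close> and \<open>l +
  p\<close> share a residue; a relation between them is one between the
  \<open>H\<^sub>b\<close> and the \<open>z H\<^sub>b\<close> of \<open>s'\<close>, which
  \<open>digit_parts_independent\<close> excludes for \<open>s'\<close> and \<open>i =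
  1\<close>.
\<close>

lemma twisted_parts_independent:
  fixes c :: "nat \<times> nat \<Rightarrow> 'k"
  assumes R: "R < p \<or> R < 2 * p \<and> s' mod p + 1 < p \<and> 1 \<le> digit_sum p (s' div p)"
    and zero: "(\<Sum>x\<in>{..R} \<times> {..digit_sum p s'}. smult (c x) (case x of (l, b) \<Rightarrow> twisted_part s' l b)) = 0"
    and x: "x \<in> {..R} \<times> {..digit_sum p s'}"
  shows "c x = 0"
proof -
  define N where "N = digit_sum p s'"
  \<comment> \<open>extension by zero, so that \<open>l + p\<close> may run past \<open>R\<close>\<close>
  define c' where "c' l b = (if l \<le> R then c (l, b) else 0)" for l b
  have R2: "R < 2 * p" using R by auto
  have eq: "(\<Sum>b\<le>N. c' l b * coeff (digit_part s' b) k)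
      + (if k = 0 then 0 else (\<Sum>b\<le>N. c' (l + p) b * coeff (digit_part s' b) (k - 1))) = 0"
    if l: "l < p" for l k
  proof -
    have "0 = (\<Sum>m\<le>R. \<Sum>b\<le>N. c (m, b) * coeff (twisted_part s' m b) (l + p * k))"
    proof -
      have "coeff (\<Sum>x\<in>{..R} \<times> {..N}. smult (c x) (case x of (l, b) \<Rightarrow> twisted_part s' l b)) (l + p * k)
          = (\<Sum>m\<le>R. \<Sum>b\<le>N. c (m, b) * coeff (twisted_part s' m b) (l + p * k))"
        unfolding sum.cartesian_product coeff_sum
        by (rule sum.cong[OF refl]) auto
      then show ?thesis using zero by (simp add: N_def)
    qed
    also have "\<dots> = (\<Sum>m\<le>R. (if m = l then (\<Sum>b\<le>N. c' l b * coeff (digit_part s' b) k) else 0)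
      + (if m = l + p then (if k = 0 then 0 else (\<Sum>b\<le>N. c' (l + p) b * coeff (digit_part s' b) (k - 1))) else 0))"
    proof (rule sum.cong[OF refl])
      fix m assume m: "m \<in> {..R}"
      then have "m < 2 * p" using R2 by simp
      then show "(\<Sum>b\<le>N. c (m, b) * coeff (twisted_part s' m b) (l + p * k))
        = (if m = l then (\<Sum>b\<le>N. c' l b * coeff (digit_part s' b) k) else 0)
        + (if m = l + p then (if k = 0 then 0 else (\<Sum>b\<le>N. c' (l + p) b * coeff (digit_part s' b) (k - 1))) else 0)"
        using l m p_pos by (simp add: coeff_twisted_part c'_def)
    qed
    also have "\<dots> = (\<Sum>b\<le>N. c' l b * coeff (digit_part s' b) k)
      + (if k = 0 then 0 else (\<Sum>b\<le>N. c' (l + p) b * coeff (digit_part s' b) (k - 1)))"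
      unfolding sum.distrib by (simp add: c'_def)
    finally show ?thesis by simp
  qed
  have main: "c' l b = 0 \<and> c' (l + p) b = 0" if l: "l < p" and b: "b \<le> N" for l b
    using R
  proof
    assume R: "R < p"
    then have high: "c' (l + p) b' = 0" for b' by (simp add: c'_def)
    obtain k where k: "digit_sum p k = b" "of_nat (s' choose k) \<noteq> (0::'k)"
      using exists_choose_digit_sum[of b s'] b unfolding N_def by metis
    have "(\<Sum>b'\<le>N. c' l b' * coeff (digit_part s' b') k) = (\<Sum>b'\<le>N. if b' = b then c' l b * of_nat (s' choose k) else 0)"
      using k by (intro sum.cong) (auto simp: coeff_digit_part)
    moreover have "(\<Sum>b\<le>N. c' (l + p) b * coeff (digit_part s' b) (k - 1)) = 0"
      by (simp add: high)
    ultimately have "c' l b * of_nat (s' choose k) = 0"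
      using eq[OF l, of k] b by (simp split: if_splits)
    then show ?thesis using k high by simp
  next
    assume R: "R < 2 * p \<and> s' mod p + 1 < p \<and> 1 \<le> digit_sum p (s' div p)"
    define e where "e = (\<lambda>(j, b). if j = (0::nat) then c' l b else c' (l + p) b)"
    have "(\<Sum>x\<in>{..1} \<times> {..N}. smult (e x) (case x of (j, a) \<Rightarrow> monom 1 j * digit_part s' a)) = 0"
      (is "?S = 0")
    proof (rule poly_eqI)
      fix k
      have "?S = (\<Sum>j\<le>1. \<Sum>b\<le>N. smult (e (j, b)) (monom 1 j * digit_part s' b))"
        unfolding sum.cartesian_product by (rule sum.cong[OF refl]) auto
      also have "\<dots> = (\<Sum>b\<le>N. smult (c' l b) (digit_part s' b)) + (\<Sum>b\<le>N. smult (c' (l + p) b) (monom 1 1 * digit_part s' b))"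
        by (simp add: e_def)
      finally have "coeff ?S k = (\<Sum>b\<le>N. c' l b * coeff (digit_part s' b) k)
        + (\<Sum>b\<le>N. c' (l + p) b * (if k = 0 then 0 else coeff (digit_part s' b) (k - 1)))"
        by (simp add: coeff_sum coeff_monom_mult Suc_le_eq cong: if_cong)
      also have "\<dots> = 0" using eq[OF l, of k] by (cases "k = 0") auto
      finally show "coeff ?S k = coeff 0 k" by simp
    qed
    then have "e x = 0" if "x \<in> {..1} \<times> {..N}" for x
      using digit_parts_independent[of s' 1 e x] R that by (simp add: N_def)
    from this[of "(0, b)"] this[of "(1, b)"] b show ?thesis by (simp add: e_def)
  qed
  obtain m b where mb: "x = (m, b)" "m \<le> R" "b \<le> N" using x by (auto simp: N_def)
  show ?thesis
  proof (cases "m < p")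
    case True
    then show ?thesis using main[of m b] mb by (simp add: c'_def)
  next
    case False
    then have "m = (m - p) + p" "m - p < p" using mb R2 by auto
    then show ?thesis using main[of "m - p" b] mb by (simp add: c'_def)
  qed
qed

end

section \<open>Ring homomorphisms out of k[X,Y] and homogeneous forms\<close>

lemma poly_map_poly_pCons:
  "h 0 = 0 \<Longrightarrow> poly (map_poly h (pCons a F)) Q = h a + Q * poly (map_poly h F) Q"
  by (simp add: map_poly_pCons)

lemma poly_map_poly_hom:
  fixes h :: "'a::comm_ring_1 \<Rightarrow> 'b::comm_ring_1"
  assumes h: "h 0 = 0" "\<And>x y. h (x + y) = h x + h y" "\<And>x y. h (x * y) = h x * h y"
  shows "poly (map_poly h (F + G)) Q = poly (map_poly h F) Q + poly (map_poly h G) Q"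
    and "poly (map_poly h (F * G)) Q = poly (map_poly h F) Q * poly (map_poly h G) Q"
proof -
  show add: "poly (map_poly h (F + G)) Q = poly (map_poly h F) Q + poly (map_poly h G) Q" for F G
    by (induction F G rule: poly_induct2) (simp_all add: poly_map_poly_pCons h algebra_simps)
  have smult: "poly (map_poly h (smult a F)) Q = h a * poly (map_poly h F) Q" for a F
    by (induction F) (simp_all add: poly_map_poly_pCons h algebra_simps)
  show "poly (map_poly h (F * G)) Q = poly (map_poly h F) Q * poly (map_poly h G) Q"
    by (induction F) (simp_all add: poly_map_poly_pCons h add smult algebra_simps)
qed

locale bipoly_hom =
  fixes \<Phi> :: "'k::comm_ring_1 bipoly \<Rightarrow> 'a::comm_ring_1"
  assumes zero [simp]: "\<Phi> 0 = 0" and one [simp]: "\<Phi> 1 = 1"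
    and add: "\<Phi> (F + G) = \<Phi> F + \<Phi> G" and mult: "\<Phi> (F * G) = \<Phi> F * \<Phi> G"
begin

lemma power: "\<Phi> (F ^ n) = \<Phi> F ^ n"
  by (induction n) (simp_all add: mult)

end

text \<open>
  Both substitution of bivariate polynomials and dehomogenization are instances:
  \<open>\<iota>\<close> embeds the coefficients in the target ring.
\<close>

definition bipoly_eval :: "('k \<Rightarrow> 'a) \<Rightarrow> 'a \<Rightarrow> 'a \<Rightarrow> 'k::comm_ring_1 bipoly \<Rightarrow> 'a::comm_ring_1" where
  "bipoly_eval \<iota> P Q F = poly (map_poly (\<lambda>f. poly (map_poly \<iota> f) P) F) Q"

lemma bipoly_subst_eq_eval: "bipoly_subst = bipoly_eval bipoly_const"
  by (simp add: fun_eq_iff bipoly_subst_def bipoly_eval_def)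

lemma bipoly_const_simps:
  "bipoly_const (0::'k::comm_ring_1) = 0" "bipoly_const (1::'k) = 1"
  "bipoly_const (x + y) = bipoly_const x + bipoly_const (y::'k)"
  "bipoly_const (x * y) = bipoly_const x * bipoly_const (y::'k)"
  by (simp_all add: bipoly_const_def one_pCons)

locale coefficient_hom =
  fixes \<iota> :: "'k::comm_ring_1 \<Rightarrow> 'a::comm_ring_1"
  assumes \<iota>: "\<iota> 0 = 0" "\<iota> 1 = 1" "\<iota> (x + y) = \<iota> x + \<iota> y" "\<iota> (x * y) = \<iota> x * \<iota> y"
begin

sublocale bipoly_hom "bipoly_eval \<iota> P Q" for P Q
proof
  note inner = poly_map_poly_hom[of \<iota>, OF \<iota>(1,3,4)]
  show "bipoly_eval \<iota> P Q 1 = 1" by (simp add: bipoly_eval_def map_poly_1 \<iota>)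
  show "bipoly_eval \<iota> P Q (F + G) = bipoly_eval \<iota> P Q F + bipoly_eval \<iota> P Q G" for F G
    unfolding bipoly_eval_def by (rule poly_map_poly_hom(1)) (simp_all add: inner)
  show "bipoly_eval \<iota> P Q (F * G) = bipoly_eval \<iota> P Q F * bipoly_eval \<iota> P Q G" for F G
    unfolding bipoly_eval_def by (rule poly_map_poly_hom(2)) (simp_all add: inner)
qed (simp add: bipoly_eval_def)

lemma eval_const [simp]: "bipoly_eval \<iota> P Q (bipoly_const c) = \<iota> c"
  by (simp add: bipoly_eval_def bipoly_const_def map_poly_pCons \<iota>)

lemma eval_X [simp]: "bipoly_eval \<iota> P Q bipoly_X = P"
  by (simp add: bipoly_eval_def bipoly_X_def map_poly_pCons \<iota>)

lemma eval_Y [simp]: "bipoly_eval \<iota> P Q bipoly_Y = Q"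
  by (simp add: bipoly_eval_def bipoly_Y_def map_poly_pCons \<iota>)

lemma eval_scale: "bipoly_eval \<iota> P Q (bipoly_scale c F) = \<iota> c * bipoly_eval \<iota> P Q F"
  by (simp add: bipoly_scale_def mult)

end

interpretation subst: coefficient_hom "bipoly_const :: 'k::comm_ring_1 \<Rightarrow> 'k bipoly"
  by unfold_locales (fact bipoly_const_simps)+

interpretation dehom: coefficient_hom "\<lambda>c::'k::comm_ring_1. [:c:]"
  by unfold_locales (simp_all add: one_pCons)

lemma subst_scale:
  "bipoly_eval bipoly_const P Q (bipoly_scale c F) = bipoly_scale c (bipoly_eval bipoly_const P Q F)"
  unfolding subst.eval_scale by (simp add: bipoly_scale_def)

lemma bipoly_hom_eqI:
  assumes "bipoly_hom \<Phi>" "bipoly_hom \<Psi>"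
    and const: "\<And>c. \<Phi> (bipoly_const c) = \<Psi> (bipoly_const c)"
    and X: "\<Phi> bipoly_X = \<Psi> bipoly_X" and Y: "\<Phi> bipoly_Y = \<Psi> bipoly_Y"
  shows "\<Phi> F = \<Psi> F"
proof -
  interpret \<Phi>: bipoly_hom \<Phi> by fact
  interpret \<Psi>: bipoly_hom \<Psi> by fact
  have coeff: "\<Phi> [:f:] = \<Psi> [:f:]" for f
  proof (induction f)
    case (pCons c f)
    have eq: "[:pCons c f:] = bipoly_const c + bipoly_X * [:f:]"
      by (simp add: bipoly_const_def bipoly_X_def)
    show ?case unfolding eq \<Phi>.add \<Phi>.mult \<Psi>.add \<Psi>.mult const X pCons.IH ..
  qed simp
  show ?thesis
  proof (induction F)
    case (pCons f F)
    have eq: "pCons f F = [:f:] + bipoly_Y * F" by (simp add: bipoly_Y_def)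
    show ?case unfolding eq \<Phi>.add \<Phi>.mult \<Psi>.add \<Psi>.mult coeff Y pCons.IH ..
  qed simp
qed

lemma bipoly_subst_subst:
  "bipoly_subst P Q (bipoly_subst P' Q' F) = bipoly_subst (bipoly_subst P Q P') (bipoly_subst P Q Q') F"
proof -
  have "bipoly_hom (\<lambda>F. bipoly_subst P Q (bipoly_subst P' Q' F))"
    unfolding bipoly_subst_eq_eval by unfold_locales (simp_all add: subst.add subst.mult)
  moreover have "bipoly_hom (bipoly_subst (bipoly_subst P Q P') (bipoly_subst P Q Q'))"
    unfolding bipoly_subst_eq_eval by (rule subst.bipoly_hom_axioms)
  ultimately show ?thesis
    by (rule bipoly_hom_eqI) (simp_all add: bipoly_subst_eq_eval)
qed

lemma bipoly_subst_X_Y: "bipoly_subst bipoly_X bipoly_Y F = F"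
proof -
  have "bipoly_hom (bipoly_subst bipoly_X bipoly_Y)"
    unfolding bipoly_subst_eq_eval by (rule subst.bipoly_hom_axioms)
  moreover have "bipoly_hom (\<lambda>F. F)" by unfold_locales simp_all
  ultimately show ?thesis
    by (rule bipoly_hom_eqI) (simp_all add: bipoly_subst_eq_eval)
qed

lemma X_power_mult_Y_power: "bipoly_X ^ m * bipoly_Y ^ n = monom (monom (1::'k::comm_ring_1) m) n"
proof -
  have "bipoly_X ^ m = [:monom (1::'k) m:]"
    by (induction m) (simp_all add: bipoly_X_def monom_Suc monom_0 one_pCons)
  moreover have "bipoly_Y ^ n = monom (1::'k poly) n"
    by (simp add: bipoly_Y_def monom_altdef)
  ultimately show ?thesis by (simp add: smult_monom)
qed

lemma scale_monomial: "bipoly_scale c (bipoly_X ^ m * bipoly_Y ^ n) = monom (monom (c::'k::field) m) n"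
  by (simp add: X_power_mult_Y_power bipoly_scale_def bipoly_const_def smult_monom)

text \<open>
  The index \<open>j\<close> is the dimension of the space, that is the degree plus one.  With
  this shift \<open>j = 0\<close> gives the zero space, so the descent on \<open>i\<close>
  starts from a trivial case.
\<close>

definition forms :: "nat \<Rightarrow> 'k::field bipoly set" where
  "forms j = {F. \<forall>m n. coeff (coeff F n) m \<noteq> 0 \<longrightarrow> m + n + 1 = j}"

lemma forms_Suc: "forms (Suc r) = hom_polys r"
  by (simp add: forms_def hom_polys_def)

lemma forms_0: "forms 0 = {0}"
  by (auto simp: forms_def poly_eq_iff)

lemma coeff_coeff_mult:
  "coeff (coeff (F * G :: 'k::comm_ring_1 bipoly) n) m = (\<Sum>b\<le>n. \<Sum>a\<le>m. coeff (coeff F b) a * coeff (coeff G (n - b)) (m - a))"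
  by (simp add: coeff_mult coeff_sum)

lemma hom_polys_mult_forms:
  fixes F G :: "'k::field bipoly"
  assumes "F \<in> hom_polys d" "G \<in> forms j"
  shows "F * G \<in> forms (d + j)"
  unfolding forms_def
proof (intro CollectI allI impI)
  fix m n assume "coeff (coeff (F * G) n) m \<noteq> 0"
  then obtain b where b: "b \<le> n" "(\<Sum>a\<le>m. coeff (coeff F b) a * coeff (coeff G (n - b)) (m - a)) \<noteq> 0"
    unfolding coeff_coeff_mult by (metis (no_types, lifting) atMost_iff sum.neutral)
  then obtain a where a: "a \<le> m" "coeff (coeff F b) a * coeff (coeff G (n - b)) (m - a) \<noteq> 0"
    by (metis (no_types, lifting) atMost_iff sum.neutral)
  then have "coeff (coeff F b) a \<noteq> 0" "coeff (coeff G (n - b)) (m - a) \<noteq> 0" by auto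
  then have "a + b = d" "(m - a) + (n - b) + 1 = j"
    using assms unfolding hom_polys_def forms_def by blast+
  then show "m + n + 1 = d + j" using a b by simp
qed

lemma hom_polys_mult: "F \<in> hom_polys d \<Longrightarrow> G \<in> hom_polys e \<Longrightarrow> F * G \<in> hom_polys (d + e)"
  for F G :: "'k::field bipoly"
  using hom_polys_mult_forms[of F d G "Suc e"] by (simp add: forms_Suc)

lemma hom_polys_power: "F \<in> hom_polys d \<Longrightarrow> F ^ n \<in> hom_polys (d * n)"
  for F :: "'k::field bipoly"
proof (induction n)
  case 0
  then show ?case by (auto simp: hom_polys_def one_pCons coeff_pCons split: nat.splits)
next
  case (Suc n)
  then show ?case using hom_polys_mult[of F d "F ^ n" "d * n"] by simp
qed

lemma subspace_forms: "bipoly.subspace (forms j)"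
proof (rule bipoly.subspaceI)
  fix F G :: "'a bipoly" and c assume "F \<in> forms j" "G \<in> forms j"
  then show "F + G \<in> forms j" "bipoly_scale c F \<in> forms j"
    unfolding forms_def by (auto simp: bipoly_scale_def bipoly_const_def) (metis add.right_neutral)
qed (simp add: forms_def)

lemma monomial_in_forms: "m + n + 1 = j \<Longrightarrow> bipoly_X ^ m * bipoly_Y ^ n \<in> forms j"
  by (auto simp: X_power_mult_Y_power forms_def coeff_monom split: if_splits)

lemma forms_eq_span:
  "(forms j :: 'k::field bipoly set) = bipoly.span ((\<lambda>n. bipoly_X ^ (j - Suc n) * bipoly_Y ^ n) ` {..<j})"
proof
  show "bipoly.span ((\<lambda>n. bipoly_X ^ (j - Suc n) * bipoly_Y ^ n) ` {..<j}) \<subseteq> (forms j :: 'k bipoly set)"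
    by (rule bipoly.span_minimal[OF _ subspace_forms]) (auto intro!: monomial_in_forms)
  show "(forms j :: 'k bipoly set) \<subseteq> bipoly.span ((\<lambda>n. bipoly_X ^ (j - Suc n) * bipoly_Y ^ n) ` {..<j})"
  proof
    fix F :: "'k bipoly" assume F: "F \<in> forms j"
    have "F = (\<Sum>n<j. bipoly_scale (coeff (coeff F n) (j - Suc n)) (bipoly_X ^ (j - Suc n) * bipoly_Y ^ n))"
    proof (intro poly_eqI)
      fix n m
      have "coeff (coeff (\<Sum>n<j. bipoly_scale (coeff (coeff F n) (j - Suc n))
          (bipoly_X ^ (j - Suc n) * bipoly_Y ^ n)) n) m
        = (\<Sum>n'<j. if n' = n then (if m + n + 1 = j then coeff (coeff F n) m else 0) else 0)"
        unfolding scale_monomial coeff_sum by (intro sum.cong) (auto simp: coeff_monom)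
      also have "\<dots> = coeff (coeff F n) m" using F by (auto simp: forms_def)
      finally show "coeff (coeff F n) m = coeff (coeff (\<Sum>n<j. bipoly_scale (coeff (coeff F n) (j - Suc n))
          (bipoly_X ^ (j - Suc n) * bipoly_Y ^ n)) n) m" ..
    qed
    then show "F \<in> bipoly.span ((\<lambda>n. bipoly_X ^ (j - Suc n) * bipoly_Y ^ n) ` {..<j})"
      by (metis (no_types, lifting) bipoly.span_base bipoly.span_scale bipoly.span_sum image_eqI)
  qed
qed

lemma forms_induct:
  assumes "F \<in> forms j" "bipoly.subspace W"
    and "\<And>m n. m + n + 1 = j \<Longrightarrow> bipoly_X ^ m * bipoly_Y ^ n \<in> W"
  shows "F \<in> W"
proof -
  have "bipoly.span ((\<lambda>n. bipoly_X ^ (j - Suc n) * bipoly_Y ^ n) ` {..<j}) \<subseteq> W"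
    using assms(2,3) by (intro bipoly.span_minimal) auto
  then show ?thesis using assms(1) forms_eq_span by blast
qed

definition linear_form :: "'k::field \<Rightarrow> 'k \<Rightarrow> 'k bipoly" where
  "linear_form a c = bipoly_scale a bipoly_X + bipoly_scale c bipoly_Y"

lemma linear_form_in_hom_polys: "linear_form a c \<in> hom_polys 1"
proof -
  have "bipoly_X ^ 1 * bipoly_Y ^ 0 \<in> forms 2" "bipoly_X ^ 0 * bipoly_Y ^ 1 \<in> forms 2"
    by (intro monomial_in_forms; simp)+
  then have "linear_form a c \<in> forms (Suc 1)"
    unfolding linear_form_def using subspace_forms
    by (intro bipoly.subspace_add bipoly.subspace_scale) (simp_all add: numeral_2_eq_2)
  then show ?thesis by (simp only: forms_Suc)
qed

lemma linear_form_power_in_hom_polys: "linear_form a c ^ n \<in> hom_polys n"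
  using hom_polys_power[OF linear_form_in_hom_polys, of a c n] by simp

lemma linear_form_simps: "linear_form 1 0 = bipoly_X" "linear_form 0 1 = bipoly_Y"
  by (simp_all add: linear_form_def)

lemma scale_linear_form: "bipoly_scale b (linear_form a c) = linear_form (b * a) (b * c)"
  by (simp add: linear_form_def bipoly.scale_right_distrib)

lemma subst_linear_form:
  "bipoly_subst (linear_form a c) (linear_form b d) (linear_form x y)
    = linear_form (x * a + y * b) (x * c + y * d)"
proof -
  have "bipoly_subst P Q (linear_form x y) = bipoly_scale x P + bipoly_scale y Q" for P Q
    by (simp add: bipoly_subst_eq_eval linear_form_def subst.add subst.mult bipoly_scale_def)
  then show ?thesis
    by (simp add: linear_form_def bipoly.scale_right_distrib bipoly.scale_left_distrib add_ac)
qed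

lemma subst_forms:
  assumes "F \<in> forms j"
  shows "bipoly_subst (linear_form a c) (linear_form b d) F \<in> forms j"
proof -
  have "F \<in> {F. bipoly_subst (linear_form a c) (linear_form b d) F \<in> forms j}"
    using assms
  proof (rule forms_induct)
    show "bipoly.subspace {F. bipoly_subst (linear_form a c) (linear_form b d) F \<in> forms j}"
      unfolding bipoly_subst_eq_eval
      by (rule bipoly.subspaceI)
        (auto simp: subst.add subst_scale bipoly.subspace_0[OF subspace_forms]
          intro: bipoly.subspace_add[OF subspace_forms] bipoly.subspace_scale[OF subspace_forms])
    fix m n assume "m + n + 1 = j"
    moreover have "linear_form a c ^ m * linear_form b d ^ n \<in> hom_polys (m + n)"
      by (intro hom_polys_mult linear_form_power_in_hom_polys)
    ultimately show "bipoly_X ^ m * bipoly_Y ^ n \<in> {F. bipoly_subst (linear_form a c) (linear_form b d) F \<in> forms j}"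
      by (auto simp: bipoly_subst_eq_eval subst.mult subst.power simp flip: forms_Suc)
  qed
  then show ?thesis by simp
qed

section \<open>The module generated by a monomial\<close>

text \<open>
  The sum of the spaces \<open>L\<^sup>s V\<^bsub>j - 1\<^esub>\<close> over all linear forms
  \<open>L \<noteq> 0\<close>.
\<close>

definition power_module :: "nat \<Rightarrow> nat \<Rightarrow> 'k::field bipoly set" where
  "power_module s j = bipoly.span {linear_form a c ^ s * F | a c F. (a, c) \<noteq> (0, 0) \<and> F \<in> forms j}"

lemma GL2_act_eq_subst:
  "GL2_act g = bipoly_subst (linear_form (g $ 1 $ 1) (g $ 2 $ 1)) (linear_form (g $ 1 $ 2) (g $ 2 $ 2))"
  by (simp add: fun_eq_iff GL2_act_def linear_form_def)

lemma GL2_iff: "g \<in> GL2 \<longleftrightarrow> g $ 1 $ 1 * g $ 2 $ 2 - g $ 1 $ 2 * g $ 2 $ 1 \<noteq> 0"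
  for g :: "'k::field ^ 2 ^ 2"
  by (simp add: GL2_def invertible_det_nz det_2)

lemma subst_in_GL2_submodule:
  assumes W: "GL2_submodule r W" and F: "F \<in> W" and det: "a * d - b * c \<noteq> 0"
  shows "bipoly_subst (linear_form a c) (linear_form b d) F \<in> W"
proof -
  define g :: "'a ^ 2 ^ 2" where "g = vector [vector [a, b], vector [c, d]]"
  have "g \<in> GL2" using det by (simp add: GL2_iff g_def)
  then have "GL2_act g F \<in> W" using W F by (auto simp: GL2_submodule_def)
  then show ?thesis by (simp add: GL2_act_eq_subst g_def)
qed

lemma power_mult_form_in_forms:
  "F \<in> forms j \<Longrightarrow> linear_form a c ^ s * F \<in> forms (s + j)"
  by (rule hom_polys_mult_forms[OF linear_form_power_in_hom_polys])

lemma power_module_subset_forms: "power_module s j \<subseteq> forms (s + j)"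
  unfolding power_module_def
  by (rule bipoly.span_minimal[OF _ subspace_forms]) (auto intro: power_mult_form_in_forms)

lemma power_module_GL2_submodule: "GL2_submodule (s + i) (power_module s (Suc i) :: 'k::field bipoly set)"
  unfolding GL2_submodule_def
proof (intro conjI ballI)
  show "power_module s (Suc i) \<subseteq> (hom_polys (s + i) :: 'k bipoly set)"
    using power_module_subset_forms[of s "Suc i"] by (simp add: forms_Suc)
  show subsp: "bipoly.subspace (power_module s (Suc i) :: 'k bipoly set)"
    by (simp add: power_module_def)
  fix g :: "'k ^ 2 ^ 2" and F :: "'k bipoly" assume g: "g \<in> GL2" and F: "F \<in> power_module s (Suc i)"
  define A B where "A = linear_form (g $ 1 $ 1) (g $ 2 $ 1)" "B = linear_form (g $ 1 $ 2) (g $ 2 $ 2)"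
  have "power_module s (Suc i) \<subseteq> {F. bipoly_subst A B F \<in> power_module s (Suc i)}"
    unfolding power_module_def
  proof (rule bipoly.span_minimal, rule subsetI, goal_cases)
    case 2
    show ?case
      unfolding bipoly_subst_eq_eval
      by (rule bipoly.subspaceI)
        (auto simp: subst.add subst_scale bipoly.span_zero intro: bipoly.span_add bipoly.span_scale)
  next
    case (1 x)
    then obtain a c G where x: "x = linear_form a c ^ s * G" "(a, c) \<noteq> (0, 0)" "G \<in> forms (Suc i)" by blast
    define a' c' where "a' = a * g $ 1 $ 1 + c * g $ 1 $ 2" "c' = a * g $ 2 $ 1 + c * g $ 2 $ 2"
    have "bipoly_subst A B x = bipoly_subst A B (linear_form a c) ^ s * bipoly_subst A B G"
      by (simp add: x bipoly_subst_eq_eval subst.mult subst.power)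
    also have "bipoly_subst A B (linear_form a c) = linear_form a' c'"
      by (simp add: A_B_def subst_linear_form a'_c'_def)
    finally have eq: "bipoly_subst A B x = linear_form a' c' ^ s * bipoly_subst A B G" .
    have "(a', c') \<noteq> (0, 0)"
    proof
      assume "(a', c') = (0, 0)"
      then have z: "a * g $ 1 $ 1 + c * g $ 1 $ 2 = 0" "a * g $ 2 $ 1 + c * g $ 2 $ 2 = 0"
        by (simp_all add: a'_c'_def)
      \<comment> \<open>Cramer's rule\<close>
      define \<delta> where "\<delta> = g $ 1 $ 1 * g $ 2 $ 2 - g $ 1 $ 2 * g $ 2 $ 1"
      have "a * \<delta> = (a * g $ 1 $ 1 + c * g $ 1 $ 2) * g $ 2 $ 2 - (a * g $ 2 $ 1 + c * g $ 2 $ 2) * g $ 1 $ 2"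
        by (simp add: \<delta>_def algebra_simps)
      moreover have "c * \<delta> = (a * g $ 2 $ 1 + c * g $ 2 $ 2) * g $ 1 $ 1 - (a * g $ 1 $ 1 + c * g $ 1 $ 2) * g $ 2 $ 1"
        by (simp add: \<delta>_def algebra_simps)
      moreover have "\<delta> \<noteq> 0" using g by (simp add: GL2_iff \<delta>_def)
      ultimately show False using x(2) z by simp
    qed
    moreover have "bipoly_subst A B G \<in> forms (Suc i)"
      unfolding A_B_def using x(3) by (rule subst_forms)
    ultimately have "bipoly_subst A B x \<in> {linear_form a c ^ s * F |a c F. (a, c) \<noteq> (0, 0) \<and> F \<in> forms (Suc i)}"
      unfolding eq by blast
    then show ?case
      by (auto intro: bipoly.span_base)
  qed
  then show "GL2_act g F \<in> power_module s (Suc i)"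
    using F by (auto simp add: GL2_act_eq_subst A_B_def)
qed

context prime_field begin

text \<open>
  Unipotent matrices fixing \<open>X\<close> turn the generator into \<open>X\<^sup>s (t X +
  Y)\<^sup>i\<close>.  As \<open>i < p\<close>, all binomial coefficients of \<open>i\<close>
  are units and the Vandermonde argument extracts every \<open>X\<^sup>s X\<^sup>b Y\<^bsup>i
  - b\<^esup>\<close>.  A matrix that moves \<open>X\<close> to a given linear form handles
  the other powers.
\<close>

lemma GL2_submodule_contains_power_multiples:
  fixes W :: "'k bipoly set"
  assumes W: "GL2_submodule r W" and i: "i < p" and gen: "bipoly_X ^ s * bipoly_Y ^ i \<in> W"
    and L: "(a, c) \<noteq> (0, 0)" and F: "F \<in> forms (Suc i)"
  shows "linear_form a c ^ s * F \<in> W"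
proof -
  have subsp: "bipoly.subspace W" using W by (simp add: GL2_submodule_def)
  have monomials: "bipoly_X ^ s * (bipoly_X ^ b * bipoly_Y ^ (i - b)) \<in> W" if b: "b \<le> i" for b
  proof -
    define v :: "nat \<Rightarrow> 'k bipoly" where "v b = bipoly_scale (of_nat (i choose b)) (bipoly_X ^ s * (bipoly_X ^ b * bipoly_Y ^ (i - b)))" for b
    have "v b \<in> W"
    proof (rule vandermonde_subspace[OF bipoly.vector_space_axioms subsp i _ b])
      fix t :: 'k
      have pow: "bipoly_scale t bipoly_X ^ b = bipoly_scale (t ^ b) (bipoly_X ^ b)" for b
        by (simp add: bipoly_scale_def power_mult_distrib bipoly_const_def flip: power_mult_distrib)
          (induction b; simp add: one_pCons)
      have nat: "of_nat n * G = bipoly_scale (of_nat n) G" for n and G :: "'k bipoly"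
        by (simp add: bipoly_scale_def bipoly_const_def of_nat_poly)
      have "bipoly_subst (linear_form 1 0) (linear_form t 1) (bipoly_X ^ s * bipoly_Y ^ i)
          = bipoly_X ^ s * (bipoly_scale t bipoly_X + bipoly_Y) ^ i"
        by (simp add: bipoly_subst_eq_eval subst.mult subst.power linear_form_def)
      also have "\<dots> = (\<Sum>b\<le>i. bipoly_scale (t ^ b) (v b))"
        unfolding binomial_ring sum_distrib_left v_def pow nat mult.assoc
        by (intro sum.cong) (simp_all add: bipoly_scale_def mult_ac)
      finally show "(\<Sum>b\<le>i. bipoly_scale (t ^ b) (v b)) \<in> W"
        using subst_in_GL2_submodule[OF W gen, of 1 1 t 0] by simp
    qed
    then have "bipoly_scale (inverse (of_nat (i choose b))) (v b) \<in> W"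
      using subsp by (intro bipoly.subspace_scale)
    then show ?thesis using of_nat_choose_neq_0[OF b i] by (simp add: v_def)
  qed
  have X: "bipoly_X ^ s * G \<in> W" if "G \<in> forms (Suc i)" for G
  proof -
    have "G \<in> {G. bipoly_X ^ s * G \<in> W}"
      using that
    proof (rule forms_induct)
      show "bipoly.subspace {G. bipoly_X ^ s * G \<in> W}"
      proof (rule bipoly.subspaceI)
        fix c and G :: "'k bipoly" assume "G \<in> {G. bipoly_X ^ s * G \<in> W}"
        then have "bipoly_scale c (bipoly_X ^ s * G) \<in> W" using subsp by (simp add: bipoly.subspace_scale)
        then show "bipoly_scale c G \<in> {G. bipoly_X ^ s * G \<in> W}"
          by (simp add: bipoly_scale_def mult_ac)
      qed (use subsp in \<open>auto simp: bipoly.subspace_0 bipoly.subspace_add distrib_left\<close>)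
      fix m n assume "m + n + 1 = Suc i"
      then show "bipoly_X ^ m * bipoly_Y ^ n \<in> {G. bipoly_X ^ s * G \<in> W}"
        using monomials[of m] by auto
    qed
    then show ?thesis by simp
  qed
  \<comment> \<open>complete \<open>(a, c)\<close> to an invertible matrix; the primed entries are those of the inverse substitution\<close>
  obtain b d a' c' b' d' where det: "a * d - b * c \<noteq> 0"
    and inv: "a' * a + c' * b = 1" "a' * c + c' * d = 0" "b' * a + d' * b = 0" "b' * c + d' * d = 1"
  proof (cases "a = 0")
    case True
    then show ?thesis using L by (intro that[of 0 1 0 1 "1 / c" 0]) auto
  next
    case False
    then show ?thesis by (intro that[of 1 0 "1 / a" "- c / a" 0 1]) auto
  qed
  define G where "G = bipoly_subst (linear_form a' c') (linear_form b' d') F"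
  have "bipoly_X ^ s * G \<in> W" by (rule X) (simp add: G_def subst_forms F)
  then have "bipoly_subst (linear_form a c) (linear_form b d) (bipoly_X ^ s * G) \<in> W"
    using det by (rule subst_in_GL2_submodule[OF W])
  also have "bipoly_subst (linear_form a c) (linear_form b d) (bipoly_X ^ s * G)
      = linear_form a c ^ s * bipoly_subst (linear_form a c) (linear_form b d) G"
    by (simp add: bipoly_subst_eq_eval subst.mult subst.power)
  also have "bipoly_subst (linear_form a c) (linear_form b d) G = F"
    unfolding G_def bipoly_subst_subst subst_linear_form
    by (simp add: inv linear_form_simps bipoly_subst_X_Y)
  finally show ?thesis .
qed

lemma monomial_submodule_eq_power_module:
  assumes "i < p"
  shows "monomial_submodule s i = (power_module s (Suc i) :: 'k bipoly set)"
proof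
  have "linear_form 1 0 ^ s * bipoly_Y ^ i \<in> (power_module s (Suc i) :: 'k bipoly set)"
    unfolding power_module_def using monomial_in_forms[of 0 i "Suc i"]
    by (intro bipoly.span_base CollectI exI[of _ 1] exI[of _ 0] exI[of _ "bipoly_Y ^ i"]) auto
  then show "monomial_submodule s i \<subseteq> (power_module s (Suc i) :: 'k bipoly set)"
    unfolding monomial_submodule_def
    by (intro hull_minimal power_module_GL2_submodule) (simp add: linear_form_simps)
  show "(power_module s (Suc i) :: 'k bipoly set) \<subseteq> monomial_submodule s i"
    unfolding monomial_submodule_def hull_def
  proof (rule Inter_greatest)
    fix W :: "'k bipoly set"
    assume "W \<in> {t. GL2_submodule (s + i) t \<and> {bipoly_X ^ s * bipoly_Y ^ i} \<subseteq> t}"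
    then have W: "GL2_submodule (s + i) W" "bipoly_X ^ s * bipoly_Y ^ i \<in> W" by auto
    show "power_module s (Suc i) \<subseteq> W"
      unfolding power_module_def
    proof (rule bipoly.span_minimal)
      show "bipoly.subspace W" using W by (simp add: GL2_submodule_def)
    qed (use GL2_submodule_contains_power_multiples[OF W(1) assms W(2)] in auto)
  qed
qed

end

section \<open>Dehomogenization\<close>

lemma (in vector_space_pair) dim_image_inj_on:
  assumes f: "Vector_Spaces.linear s1 s2 f" and V: "vs1.subspace V" and inj: "inj_on f V"
  shows "vs2.dim (f ` V) = vs1.dim V"
proof -
  obtain B where B: "B \<subseteq> V" "vs1.independent B" "V \<subseteq> vs1.span B" "card B = vs1.dim V"
    using vs1.basis_exists .
  have "vs1.span B \<subseteq> V" using B(1) V by (rule vs1.span_minimal)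
  then have span: "vs1.span B = V" using B(3) by auto
  have inj_B: "inj_on f B" using inj B(1) by (rule inj_on_subset)
  show ?thesis
  proof (rule vs2.dim_unique)
    show "f ` B \<subseteq> f ` V" using B(1) by auto
    show "f ` V \<subseteq> vs2.span (f ` B)" using span linear_span_image[OF f, of B] by simp
    show "vs2.independent (f ` B)"
      using linear_independent_injective_image[OF f B(2)] span inj by simp
    show "card (f ` B) = vs1.dim V" using card_image[OF inj_B] B(4) by simp
  qed
qed

definition dehomogenize :: "'k::field bipoly \<Rightarrow> 'k poly" where
  "dehomogenize = bipoly_eval (\<lambda>c. [:c:]) 1 [:0, 1:]"

lemma linear_dehom: "Vector_Spaces.linear bipoly_scale smult (bipoly_eval (\<lambda>c. [:c:]) P Q)"
  unfolding Vector_Spaces.linear_iff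
  by (auto simp: dehom.add dehom.eval_scale bipoly.vector_space_axioms poly_vs.vector_space_axioms)

lemma dehom_linear_form:
  "bipoly_eval (\<lambda>c. [:c:]) P Q (linear_form a c) = smult a P + smult c Q"
  by (simp add: linear_form_def dehom.add dehom.eval_scale)

lemma degree_dehom_forms:
  assumes "F \<in> forms (Suc i)" "degree P \<le> 1" "degree Q \<le> 1"
  shows "degree (bipoly_eval (\<lambda>c. [:c:]) P Q F) \<le> i"
proof -
  have "F \<in> {F. degree (bipoly_eval (\<lambda>c. [:c:]) P Q F) \<le> i}"
    using assms(1)
  proof (rule forms_induct)
    show "bipoly.subspace {F. degree (bipoly_eval (\<lambda>c. [:c:]) P Q F) \<le> i}"
      by (rule bipoly.subspaceI)
        (auto simp: dehom.add dehom.eval_scale intro: degree_add_le order_trans[OF degree_smult_le])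
    fix m n assume mn: "m + n + 1 = Suc i"
    have "degree (P ^ m * Q ^ n) \<le> degree P * m + degree Q * n"
      by (intro order_trans[OF degree_mult_le] add_mono degree_power_le)
    also have "\<dots> \<le> 1 * m + 1 * n" using assms by (intro add_mono mult_le_mono1)
    finally show "bipoly_X ^ m * bipoly_Y ^ n \<in> {F. degree (bipoly_eval (\<lambda>c. [:c:]) P Q F) \<le> i}"
      using mn by (simp add: dehom.mult dehom.power)
  qed
  then show ?thesis by simp
qed

lemma dehomogenize_monomial: "dehomogenize (bipoly_X ^ m * bipoly_Y ^ n) = monom 1 n"
  by (simp add: dehomogenize_def dehom.mult dehom.power monom_altdef)

lemma dehomogenize_scale: "dehomogenize (bipoly_scale c F) = smult c (dehomogenize F)"
  by (simp add: dehomogenize_def dehom.eval_scale)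

lemma dehomogenize_add: "dehomogenize 0 = 0" "dehomogenize (F + G) = dehomogenize F + dehomogenize G"
  by (simp_all add: dehomogenize_def dehom.add)

lemma coeff_scale: "coeff (coeff (bipoly_scale c F) n) m = c * coeff (coeff F n) m"
  by (simp add: bipoly_scale_def bipoly_const_def)

lemma coeff_dehomogenize:
  assumes "F \<in> hom_polys r"
  shows "coeff (dehomogenize F) n = (if n \<le> r then coeff (coeff F n) (r - n) else 0)"
proof -
  have "F \<in> {F. coeff (dehomogenize F) n = (if n \<le> r then coeff (coeff F n) (r - n) else 0)}"
    using assms unfolding forms_Suc[symmetric]
  proof (rule forms_induct)
    show "bipoly.subspace {F. coeff (dehomogenize F) n = (if n \<le> r then coeff (coeff F n) (r - n) else 0)}"
      by (rule bipoly.subspaceI)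
        (auto simp: coeff_scale dehomogenize_scale dehomogenize_add)
    fix m n' assume "m + n' + 1 = Suc r"
    then show "bipoly_X ^ m * bipoly_Y ^ n' \<in> {F. coeff (dehomogenize F) n = (if n \<le> r then coeff (coeff F n) (r - n) else 0)}"
      unfolding mem_Collect_eq dehomogenize_monomial unfolding X_power_mult_Y_power
      by (auto simp: coeff_monom)
  qed
  then show ?thesis by simp
qed

lemma inj_on_dehomogenize: "inj_on dehomogenize (hom_polys r)"
proof (rule inj_onI)
  fix F G :: "'a bipoly" assume FG: "F \<in> hom_polys r" "G \<in> hom_polys r" "dehomogenize F = dehomogenize G"
  show "F = G"
  proof (intro poly_eqI)
    fix n m
    show "coeff (coeff F n) m = coeff (coeff G n) m"
    proof (cases "m + n = r")
      case True
      then show ?thesis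
        using coeff_dehomogenize[OF FG(1), of n] coeff_dehomogenize[OF FG(2), of n] FG(3) by auto
    next
      case False
      then have "coeff (coeff F n) m = 0" "coeff (coeff G n) m = 0"
        using FG(1,2) unfolding hom_polys_def by blast+
      then show ?thesis by simp
    qed
  qed
qed

lemma dehomogenize_image_forms: "dehomogenize ` forms (Suc i) = {q :: 'k::field poly. degree q \<le> i}"
proof (intro equalityI subsetI)
  fix q :: "'k poly" assume "q \<in> dehomogenize ` forms (Suc i)"
  then show "q \<in> {q. degree q \<le> i}"
    using degree_dehom_forms[of _ i 1 "[:0, 1:]"] by (auto simp: dehomogenize_def)
next
  fix q :: "'k poly" assume "q \<in> {q. degree q \<le> i}"
  then have q: "degree q \<le> i" by simp
  define F :: "'k bipoly" where "F = (\<Sum>n\<le>i. bipoly_scale (coeff q n) (bipoly_X ^ (i - n) * bipoly_Y ^ n))"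
  have "F \<in> forms (Suc i)"
    unfolding F_def using subspace_forms
    by (intro bipoly.subspace_sum bipoly.subspace_scale monomial_in_forms) auto
  moreover have "dehomogenize F = (\<Sum>n\<le>i. monom (coeff q n) n)"
  proof -
    interpret D: Vector_Spaces.linear bipoly_scale smult "dehomogenize :: 'k bipoly \<Rightarrow> 'k poly"
      unfolding dehomogenize_def by (rule linear_dehom)
    show ?thesis
      by (simp add: F_def D.sum dehomogenize_scale dehomogenize_monomial smult_monom)
  qed
  then have "dehomogenize F = q" using poly_as_sum_of_monoms'[OF q] by simp
  ultimately show "q \<in> dehomogenize ` forms (Suc i)" by blast
qed

lemma dim_power_module:
  "bipoly.dim (power_module s (Suc i) :: 'k::field bipoly set)
    = poly_vs.dim (poly_vs.span {q * [:a, c:] ^ s | q a c. (a, c) \<noteq> (0, 0::'k) \<and> degree q \<le> i})"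
proof -
  interpret vector_space_pair "bipoly_scale :: 'k \<Rightarrow> _" "smult :: 'k \<Rightarrow> _" ..
  have lin: "Vector_Spaces.linear bipoly_scale smult (dehomogenize :: 'k bipoly \<Rightarrow> 'k poly)"
    unfolding dehomogenize_def by (rule linear_dehom)
  have "dehomogenize (linear_form a c) = [:a, c:]" for a c :: 'k
    by (simp add: dehomogenize_def dehom_linear_form)
  then have D: "dehomogenize (linear_form a c ^ s * F) = dehomogenize F * [:a, c:] ^ s" for a c :: 'k and F
    unfolding dehomogenize_def by (simp add: dehom.mult dehom.power)
  have "dehomogenize ` {linear_form a c ^ s * F | a c F. (a, c) \<noteq> (0::'k, 0) \<and> F \<in> forms (Suc i)}
      = {q * [:a, c:] ^ s | q a c. (a, c) \<noteq> (0, 0::'k) \<and> q \<in> dehomogenize ` forms (Suc i)}"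
    (is "?l = ?r")
  proof (intro equalityI subsetI)
    fix x assume "x \<in> ?l"
    then obtain a c F where "x = dehomogenize (linear_form a c ^ s * F)" "(a, c) \<noteq> (0, 0)" "F \<in> forms (Suc i)"
      by blast
    then show "x \<in> ?r" unfolding D by blast
  next
    fix x assume "x \<in> ?r"
    then obtain a c F where "x = dehomogenize F * [:a, c:] ^ s" "(a, c) \<noteq> (0, 0)" "F \<in> forms (Suc i)"
      by blast
    then show "x \<in> ?l" unfolding D[symmetric] by blast
  qed
  then have "dehomogenize ` power_module s (Suc i)
      = poly_vs.span {q * [:a, c:] ^ s | q a c. (a, c) \<noteq> (0, 0::'k) \<and> degree q \<le> i}"
    unfolding power_module_def linear_span_image[OF lin, symmetric]
    by (simp add: dehomogenize_image_forms)
  moreover have "poly_vs.dim (dehomogenize ` (power_module s (Suc i) :: 'k bipoly set)) = bipoly.dim (power_module s (Suc i) :: 'k bipoly set)"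
  proof (rule dim_image_inj_on[OF lin])
    show "inj_on dehomogenize (power_module s (Suc i) :: 'k bipoly set)"
      using power_module_subset_forms[of s "Suc i"]
      by (intro inj_on_subset[OF inj_on_dehomogenize[of "s + i"]]) (simp add: forms_Suc)
  qed (simp add: power_module_def)
  ultimately show ?thesis by simp
qed

context prime_field begin

text \<open>
  The elements \<open>z\<^sup>j H\<^sub>a\<close> form a basis.
\<close>

lemma dim_power_module_independent:
  assumes "s mod p + i < p" "i \<le> digit_sum p (s div p)" "digit_sum p s \<le> p"
  shows "bipoly.dim (power_module s (Suc i) :: 'k bipoly set) = (i + 1) * (digit_sum p s + 1)"
proof -
  let ?I = "{..i} \<times> {..digit_sum p s}"
  have "bipoly.dim (power_module s (Suc i) :: 'k bipoly set)
      = poly_vs.dim (poly_vs.span ((\<lambda>(j, a). monom 1 j * digit_part s a) ` ?I))"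
    unfolding dim_power_module span_linear_powers_eq_span_digit_parts[OF assms(3)] ..
  also have "\<dots> = card ?I"
    by (rule poly_vs.dim_span_family) (use digit_parts_independent[OF assms(1,2)] in auto)
  finally show ?thesis by simp
qed

text \<open>
  The twisted parts form a basis.  The two alternatives of the last hypothesis are the ranges
  in which they are independent.
\<close>

lemma dim_power_module_filled:
  assumes "digit_sum p (s div p) \<le> i" "digit_sum p s < p"
    and "s mod p + i < p \<or> s mod p + i < 2 * p \<and> s div p mod p + 1 < p \<and> 1 \<le> digit_sum p (s div p div p)"
  shows "bipoly.dim (power_module s (Suc i) :: 'k bipoly set)
    = (s mod p + i + 1) * (digit_sum p (s div p) + 1)"
proof -
  let ?I = "{..s mod p + i} \<times> {..digit_sum p (s div p)}"
  have "bipoly.dim (power_module s (Suc i) :: 'k bipoly set)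
      = poly_vs.dim (poly_vs.span ((\<lambda>(l, b). twisted_part (s div p) l b) ` ?I))"
    unfolding dim_power_module span_linear_powers_eq_span_digit_parts[OF less_imp_le[OF assms(2)]]
      span_digit_parts_eq_span_twisted_parts[OF assms(1,2)] ..
  also have "\<dots> = card ?I"
    by (rule poly_vs.dim_span_family) (use twisted_parts_independent[OF assms(3)] in auto)
  finally show ?thesis by simp
qed

end

section \<open>Relations when the digit sum is at least p\<close>

text \<open>
  The points of the projective line over the field, with \<open>None\<close> for the point at
  infinity \<open>Y\<close>.  For each point, \<open>transversal\<close> picks a complementary
  linear form, and \<open>chart\<close> sends the line to the coordinate \<open>z\<close> and
  the transversal to 1.  Choosing coordinates adapted to each point makes the symmetry under
  the general linear group explicit.
\<close>

fun line :: "'k::field option \<Rightarrow> 'k bipoly" where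
  "line None = linear_form 0 1"
| "line (Some t) = linear_form 1 t"

fun transversal :: "'k::field option \<Rightarrow> 'k bipoly" where
  "transversal None = bipoly_X"
| "transversal (Some t) = bipoly_Y"

fun chart :: "'k::field option \<Rightarrow> 'k bipoly \<Rightarrow> 'k poly" where
  "chart None = bipoly_eval (\<lambda>c. [:c:]) 1 [:0, 1:]"
| "chart (Some t) = bipoly_eval (\<lambda>c. [:c:]) [:- t, 1:] 1"

lemma chart_hom: "bipoly_hom (chart x)"
  by (cases x) (simp_all add: dehom.bipoly_hom_axioms)

lemma chart_scale: "chart x (bipoly_scale c F) = smult c (chart x F)"
  by (cases x) (simp_all add: dehom.eval_scale)

lemma chart_line: "chart x (line x) = [:0, 1:]"
  by (cases x) (simp_all add: dehom_linear_form)

lemma chart_transversal: "chart x (transversal x) = 1"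
  by (cases x) simp_all

lemma degree_chart: "F \<in> forms (Suc i) \<Longrightarrow> degree (chart x F) \<le> i"
  by (cases x) (auto intro!: degree_dehom_forms)

lemma chart_linear_form:
  obtains (on) v where "chart x (linear_form a c) = [:0, v:]"
  | (off) u v where "chart x (linear_form a c) = [:u, v:]" "u \<noteq> 0"
proof (cases x)
  case None
  then have "chart x (linear_form a c) = [:a, c:]" by (simp add: dehom_linear_form)
  then show ?thesis using on off by (cases "a = 0") auto
next
  case (Some t)
  then have "chart x (linear_form a c) = [:c - a * t, a:]" by (simp add: dehom_linear_form)
  then show ?thesis using on off by (cases "c - a * t = 0") auto
qed

lemma chart_other_line:
  assumes "x \<noteq> y"
  obtains u v where "chart x (line y) = [:u, v:]" "u \<noteq> 0"
proof (cases x; cases y)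
  fix t u assume "x = Some t" "y = Some u"
  then have "chart x (line y) = [:u - t, 1:]" "u - t \<noteq> 0" using assms by (auto simp: dehom_linear_form)
  then show ?thesis by (rule that)
next
  fix t assume "x = Some t" "y = None"
  then have "chart x (line y) = [:1, 0:]" "(1::'a) \<noteq> 0" by (auto simp: dehom_linear_form)
  then show ?thesis by (rule that)
next
  fix t assume "x = None" "y = Some t"
  then have "chart x (line y) = [:1, t:]" "(1::'a) \<noteq> 0" by (auto simp: dehom_linear_form)
  then show ?thesis by (rule that)
qed (use assms in auto)

lemma line_power_in_power_module:
  assumes "F \<in> forms j"
  shows "line x ^ s * F \<in> power_module s j"
proof -
  obtain a c where "line x = linear_form a c" "(a, c) \<noteq> (0, 0)"
    by (cases x) auto
  then show ?thesis
    unfolding power_module_def using assms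
    by (intro bipoly.span_base CollectI exI[of _ a] exI[of _ c] exI[of _ F]) simp
qed

lemma linear_form_eq_scale_line:
  assumes "(a, c) \<noteq> (0, 0)"
  obtains b x where "linear_form a c = bipoly_scale b (line x)"
proof (cases "a = 0")
  case True
  then have "linear_form a c = bipoly_scale c (line None)" by (simp add: scale_linear_form)
  then show ?thesis by (rule that)
next
  case False
  then have "linear_form a c = bipoly_scale a (line (Some (c / a)))" by (simp add: scale_linear_form)
  then show ?thesis by (rule that)
qed

lemma transversal_power_in_forms: "transversal x ^ i \<in> forms (Suc i)"
  using monomial_in_forms[of i 0 "Suc i"] monomial_in_forms[of 0 i "Suc i"] by (cases x) auto

text \<open>
  In a monomial, eliminate \<open>X\<close> through \<open>X = L - t Y\<close>; at infinity
  the line is \<open>Y\<close> itself, and only \<open>X\<^sup>i\<close> is not divisible by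
  it.
\<close>

lemma form_decomposition:
  assumes "F \<in> forms (Suc i)"
  shows "\<exists>\<alpha>. \<exists>G\<in>forms i. F = bipoly_scale \<alpha> (transversal x ^ i) + line x * G"
proof -
  let ?W = "{F. \<exists>\<alpha>. \<exists>G\<in>forms i. F = bipoly_scale \<alpha> (transversal x ^ i) + line x * G}"
  have subspace: "bipoly.subspace ?W"
  proof (rule bipoly.subspaceI)
    show "0 \<in> ?W"
      using bipoly.subspace_0[OF subspace_forms] by (auto intro!: exI[of _ 0] bexI[of _ 0])
  next
    fix F F' assume "F \<in> ?W" "F' \<in> ?W"
    then obtain \<alpha> G \<alpha>' G' where "F = bipoly_scale \<alpha> (transversal x ^ i) + line x * G" "G \<in> forms i"
      "F' = bipoly_scale \<alpha>' (transversal x ^ i) + line x * G'" "G' \<in> forms i" by blast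
    then show "F + F' \<in> ?W"
      by (auto simp: bipoly.scale_left_distrib algebra_simps
          intro!: exI[of _ "\<alpha> + \<alpha>'"] bexI[of _ "G + G'"] bipoly.subspace_add[OF subspace_forms])
  next
    fix c F assume "F \<in> ?W"
    then obtain \<alpha> G where F: "F = bipoly_scale \<alpha> (transversal x ^ i) + line x * G" "G \<in> forms i" by blast
    have "bipoly_scale c F = bipoly_scale (c * \<alpha>) (transversal x ^ i) + line x * bipoly_scale c G"
      unfolding F by (simp add: bipoly.scale_right_distrib) (simp add: bipoly_scale_def mult_ac)
    moreover have "bipoly_scale c G \<in> forms i" using F(2) by (rule bipoly.subspace_scale[OF subspace_forms])
    ultimately show "bipoly_scale c F \<in> ?W" by blast
  qed
  have "F \<in> ?W"
    using assms subspace
  proof (rule forms_induct)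
    fix m n assume mn: "m + n + 1 = Suc i"
    show "bipoly_X ^ m * bipoly_Y ^ n \<in> ?W"
    proof (cases x)
      case None
      show ?thesis
      proof (cases n)
        case 0
        then have "bipoly_X ^ m * bipoly_Y ^ n = bipoly_scale 1 (transversal x ^ i) + line x * 0"
          using mn None by simp
        moreover have "0 \<in> forms i" by (simp add: forms_def)
        ultimately show ?thesis by blast
      next
        case (Suc n')
        then have "bipoly_X ^ m * bipoly_Y ^ n = bipoly_scale 0 (transversal x ^ i) + line x * (bipoly_X ^ m * bipoly_Y ^ n')"
          using None by (simp add: linear_form_simps)
        moreover have "bipoly_X ^ m * bipoly_Y ^ n' \<in> forms i" using mn Suc by (intro monomial_in_forms) simp
        ultimately show ?thesis by blast
      qed
    next
      case (Some t)
      show ?thesis using mn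
      proof (induction m arbitrary: n)
        case 0
        then have "bipoly_X ^ 0 * bipoly_Y ^ n = bipoly_scale 1 (transversal x ^ i) + line x * 0"
          using Some by simp
        moreover have "0 \<in> forms i" by (simp add: forms_def)
        ultimately show ?case by blast
      next
        case (Suc m)
        have eq: "bipoly_X ^ Suc m * bipoly_Y ^ n =
          (bipoly_scale 0 (transversal x ^ i) + line x * (bipoly_X ^ m * bipoly_Y ^ n)) + bipoly_scale (- t) (bipoly_X ^ m * bipoly_Y ^ Suc n)"
        proof -
          have "line x = bipoly_X + bipoly_const t * bipoly_Y"
            using Some by (simp add: linear_form_def bipoly_scale_def bipoly_const_simps)
          moreover have "bipoly_scale (- t) G = - (bipoly_const t * G)" for G
            by (simp only: bipoly.scale_minus_left) (simp only: bipoly_scale_def)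
          ultimately show ?thesis by (simp add: algebra_simps)
        qed
        have "bipoly_X ^ m * bipoly_Y ^ n \<in> forms i" using Suc.prems by (intro monomial_in_forms) simp
        then have A: "bipoly_scale 0 (transversal x ^ i) + line x * (bipoly_X ^ m * bipoly_Y ^ n) \<in> ?W" by blast
        have B: "bipoly_scale (- t) (bipoly_X ^ m * bipoly_Y ^ Suc n) \<in> ?W"
          using Suc.prems by (intro bipoly.subspace_scale[OF subspace] Suc.IH) simp
        show ?case by (subst eq) (rule bipoly.subspace_add[OF subspace A B])
      qed
    qed
  qed
  then show ?thesis by simp
qed

lemma power_module_step_span:
  "(power_module s (Suc i) :: 'k::field bipoly set) = bipoly.span (power_module (Suc s) i \<union> range (\<lambda>x. line x ^ s * transversal x ^ i))"
  (is "_ = bipoly.span ?R")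
proof (rule subset_antisym)
  show "power_module s (Suc i) \<subseteq> bipoly.span ?R"
    unfolding power_module_def[of s]
  proof (rule bipoly.span_minimal[OF _ bipoly.subspace_span], rule subsetI)
    fix f assume "f \<in> {linear_form a c ^ s * F |a c F. (a, c) \<noteq> (0::'k, 0) \<and> F \<in> forms (Suc i)}"
    then obtain a c F where f: "f = linear_form a c ^ s * F" "(a, c) \<noteq> (0, 0)" "F \<in> forms (Suc i)" by blast
    obtain b x where L: "linear_form a c = bipoly_scale b (line x)"
      using f(2) by (rule linear_form_eq_scale_line)
    obtain \<alpha> G where F: "F = bipoly_scale \<alpha> (transversal x ^ i) + line x * G" "G \<in> forms i"
      using form_decomposition[OF f(3)] by blast
    have pow: "bipoly_scale b A ^ n = bipoly_scale (b ^ n) (A ^ n)" for A :: "'k bipoly" and n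
      by (induction n) (simp_all add: bipoly_scale_def bipoly_const_simps mult_ac)
    have "f = bipoly_scale (b ^ s) (bipoly_scale \<alpha> (line x ^ s * transversal x ^ i) + line x ^ Suc s * G)"
      unfolding f(1) L pow F(1) by (simp add: bipoly_scale_def algebra_simps)
    moreover have "line x ^ s * transversal x ^ i \<in> bipoly.span ?R" by (intro bipoly.span_base) auto
    moreover have "line x ^ Suc s * G \<in> power_module (Suc s) i"
      using F(2) by (rule line_power_in_power_module)
    then have "line x ^ Suc s * G \<in> bipoly.span ?R" by (intro bipoly.span_base) auto
    ultimately show "f \<in> bipoly.span ?R" by (simp add: bipoly.span_add bipoly.span_scale)
  qed
next
  have sub: "bipoly.subspace (power_module s (Suc i) :: 'k bipoly set)" by (simp add: power_module_def)
  have "power_module (Suc s) i \<subseteq> (power_module s (Suc i) :: 'k bipoly set)"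
    unfolding power_module_def[of "Suc s"]
  proof (rule bipoly.span_minimal[OF _ sub], rule subsetI)
    fix f assume "f \<in> {linear_form a c ^ Suc s * F |a c F. (a, c) \<noteq> (0::'k, 0) \<and> F \<in> forms i}"
    then obtain a c F where f: "f = linear_form a c ^ s * (linear_form a c * F)" "(a, c) \<noteq> (0, 0)" "F \<in> forms i"
      by (auto simp: mult_ac)
    have "linear_form a c * F \<in> forms (Suc i)"
      using hom_polys_mult_forms[OF linear_form_in_hom_polys f(3)] by simp
    then show "f \<in> power_module s (Suc i)"
      unfolding power_module_def f(1) using f(2)
      by (intro bipoly.span_base CollectI exI[of _ a] exI[of _ c] exI[of _ "linear_form a c * F"]) simp
  qed
  moreover have "line x ^ s * transversal x ^ i \<in> power_module s (Suc i)" for x :: "'k option"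
    using transversal_power_in_forms by (rule line_power_in_power_module)
  ultimately show "bipoly.span ?R \<subseteq> power_module s (Suc i)"
    by (intro bipoly.span_minimal[OF _ sub]) auto
qed

context prime_field begin

text \<open>
  Substituting \<open>t z\<close> for \<open>z\<close> multiplies a coefficient at an exponent
  \<open>k\<close> by \<open>t\<^sup>k\<close>, and \<open>t\<^sup>k = t\<^sup>s\<close> in
  the class of \<open>s\<close>.  So \<open>(1 + t z)\<^sup>s q\<close> looks there like
  \<open>(1 + z)\<^sup>s g\<close> with \<open>g\<^sub>j = q\<^sub>j t\<^bsup>s -
  j\<^esup>\<close>; the bound \<open>i < k\<close> keeps all exponents of \<open>t\<close>
  positive, so that \<open>t = 0\<close> is covered too.
\<close>

lemma class_witness:
  fixes q :: "'k poly"
  assumes u: "u \<noteq> 0" and q: "degree q \<le> i"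
  shows "\<exists>g. degree g \<le> i \<and> (\<forall>k. i < k \<and> k \<le> s \<and> k mod (p - 1) = s mod (p - 1) \<longrightarrow>
      coeff ([:u, v:] ^ s * q) k = coeff ([:1, 1:] ^ s * g) k)"
proof -
  define t where "t = v / u"
  define g where "g = (\<Sum>j\<le>i. monom (u ^ s * coeff q j * t ^ (s - j)) j)"
  have coeff_g: "coeff g j = (if j \<le> i then u ^ s * coeff q j * t ^ (s - j) else 0)" for j
    by (simp add: g_def coeff_sum)
  have q0: "coeff q j = 0" if "\<not> j \<le> i" for j using that q by (intro coeff_eq_0) simp
  show ?thesis
  proof (intro exI[of _ g] conjI allI impI; (elim conjE)?)
    show "degree g \<le> i" by (rule degree_le) (simp add: coeff_g)
    fix k assume k: "i < k" "k \<le> s" "k mod (p - 1) = s mod (p - 1)"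
    have "[:u, v:] = smult u [:1, t:]" using u by (simp add: t_def)
    then have "[:u, v:] ^ s * q = smult (u ^ s) ([:1, t:] ^ s * q)" unfolding \<open>[:u, v:] = _\<close> smult_power by simp
    then have "coeff ([:u, v:] ^ s * q) k = u ^ s * coeff (q * [:1, t:] ^ s) k" by (simp add: mult.commute)
    also have "\<dots> = (\<Sum>j\<le>k. u ^ s * (coeff q j * (of_nat (s choose (k - j)) * t ^ (k - j))))"
      by (simp add: coeff_mult coeff_linear_power' sum_distrib_left)
    also have "\<dots> = (\<Sum>j\<le>k. coeff g j * of_nat (s choose (k - j)))"
    proof (rule sum.cong[OF refl])
      fix j assume "j \<in> {..k}"
      show "u ^ s * (coeff q j * (of_nat (s choose (k - j)) * t ^ (k - j))) = coeff g j * of_nat (s choose (k - j))"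
      proof (cases "j \<le> i")
        case True
        have "(p - 1) dvd (s - k)" using k by (metis mod_eq_dvd_iff_nat)
        then have "(k - j) mod (p - 1) = (s - j) mod (p - 1)"
        proof -
          obtain w where "s - k = (p - 1) * w" using \<open>(p - 1) dvd (s - k)\<close> by blast
          then have "s - j = (k - j) + (p - 1) * w" using k True by linarith
          then show ?thesis by (metis mod_mult_self2)
        qed
        then have "t ^ (k - j) = t ^ (s - j)" using k True by (intro power_cong_mod) auto
        then show ?thesis using True by (simp add: coeff_g mult_ac)
      qed (simp add: coeff_g q0)
    qed
    also have "\<dots> = coeff ([:1, 1:] ^ s * g) k"
      by (subst mult.commute) (simp add: coeff_mult coeff_linear_power)
    finally show "coeff ([:u, v:] ^ s * q) k = coeff ([:1, 1:] ^ s * g) k" .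
  qed
qed

text \<open>
  In the chart at \<open>x\<close> the left-hand side becomes \<open>z\<^sup>s\<close>, the
  powers of the other lines are handled by \<open>class_witness\<close>, and multiples of the
  \<open>(s + 1)\<close>-st power of \<open>x\<close> itself do not reach exponents up to
  \<open>s\<close>.  Hence every member of the span agrees with some \<open>(1 + z)\<^sup>s
  g\<close> on the class of \<open>s\<close>, whereas for \<open>z\<^sup>s\<close> this
  contradicts \<open>vanishes_on_class_top\<close>.
\<close>

lemma power_not_in_span_of_others:
  fixes x :: "'k option"
  assumes i: "i < p" and p_le: "p \<le> digit_sum p s" and s_ge: "s + i \<ge> (i + 1) * (p + 1)"
  shows "line x ^ s * transversal x ^ i \<notin>
    bipoly.span (power_module (Suc s) i \<union> (\<lambda>y. line y ^ s * transversal y ^ i) ` (UNIV - {x}))"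
proof
  assume *: "line x ^ s * transversal x ^ i \<in>
    bipoly.span (power_module (Suc s) i \<union> (\<lambda>y. line y ^ s * transversal y ^ i) ` (UNIV - {x}))"
  interpret \<psi>: bipoly_hom "chart x" by (rule chart_hom)
  \<comment> \<open>the subspace of those \<open>F\<close> that look like \<open>(1 + z)\<^sup>s g\<close> on the class of \<open>s\<close>\<close>
  define T where "T = {F. \<exists>g. degree g \<le> i \<and> (\<forall>k. i < k \<and> k \<le> s \<and> k mod (p - 1) = s mod (p - 1) \<longrightarrow>
      coeff (chart x F) k = coeff ([:1, 1:] ^ s * g) k)}"
  have subspace: "bipoly.subspace T"
  proof (rule bipoly.subspaceI)
    show "0 \<in> T" unfolding T_def by (auto intro!: exI[of _ 0])
  next
    fix F G assume "F \<in> T" "G \<in> T"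
    then obtain f g where "degree f \<le> i" "degree g \<le> i"
      "\<And>k. i < k \<and> k \<le> s \<and> k mod (p - 1) = s mod (p - 1) \<Longrightarrow> coeff (chart x F) k = coeff ([:1, 1:] ^ s * f) k"
      "\<And>k. i < k \<and> k \<le> s \<and> k mod (p - 1) = s mod (p - 1) \<Longrightarrow> coeff (chart x G) k = coeff ([:1, 1:] ^ s * g) k"
      unfolding T_def by blast
    then show "F + G \<in> T"
      unfolding T_def by (intro CollectI exI[of _ "f + g"]) (auto simp: \<psi>.add distrib_left intro: degree_add_le)
  next
    fix c F assume "F \<in> T"
    then obtain f where "degree f \<le> i"
      "\<And>k. i < k \<and> k \<le> s \<and> k mod (p - 1) = s mod (p - 1) \<Longrightarrow> coeff (chart x F) k = coeff ([:1, 1:] ^ s * f) k"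
      unfolding T_def by blast
    then show "bipoly_scale c F \<in> T"
      unfolding T_def
      by (intro CollectI exI[of _ "smult c f"]) (auto simp: chart_scale intro: order_trans[OF degree_smult_le])
  qed
  have off_line: "F \<in> T" if "chart x F = [:u, v:] ^ s * q" "u \<noteq> 0" "degree q \<le> i" for F u v q
    using class_witness[OF that(2,3), of s v] unfolding T_def mem_Collect_eq that(1) .
  have "power_module (Suc s) i \<subseteq> T"
    unfolding power_module_def
  proof (rule bipoly.span_minimal[OF _ subspace], rule subsetI)
    fix f assume "f \<in> {linear_form a c ^ Suc s * F |a c F. (a, c) \<noteq> (0::'k, 0) \<and> F \<in> forms i}"
    then obtain a c F where f: "f = linear_form a c ^ Suc s * F" "F \<in> forms i" by blast
    show "f \<in> T"
    proof (rule chart_linear_form[of x a c])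
      fix v assume v: "chart x (linear_form a c) = [:0, v:]"
      have "chart x f = smult (v ^ Suc s) (monom 1 (Suc s) * chart x F)"
      proof -
        have "[:0, v:] = smult v (monom 1 1)" by (simp add: monom_altdef)
        then show ?thesis unfolding f(1) \<psi>.mult \<psi>.power v by (simp only: smult_power monom_power) simp
      qed
      then have "coeff (chart x f) k = 0" if "k \<le> s" for k
        using that by (simp add: coeff_monom_mult)
      then show "f \<in> T" unfolding T_def by (intro CollectI exI[of _ 0]) auto
    next
      fix u v assume uv: "chart x (linear_form a c) = [:u, v:]" "u \<noteq> 0"
      show "f \<in> T"
      proof (rule off_line[OF _ uv(2)])
        show "chart x f = [:u, v:] ^ s * chart x (linear_form a c * F)"
          unfolding f(1) \<psi>.mult \<psi>.power uv(1) by (simp only: power_Suc mult_ac)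
        show "degree (chart x (linear_form a c * F)) \<le> i"
          using hom_polys_mult_forms[OF linear_form_in_hom_polys f(2)] by (intro degree_chart) simp
      qed
    qed
  qed
  moreover have "line y ^ s * transversal y ^ i \<in> T" if yx: "y \<noteq> x" for y
  proof -
    obtain u v where uv: "chart x (line y) = [:u, v:]" "u \<noteq> 0"
      using chart_other_line[OF yx[symmetric]] .
    show ?thesis
    proof (rule off_line[OF _ uv(2)])
      show "chart x (line y ^ s * transversal y ^ i) = [:u, v:] ^ s * chart x (transversal y ^ i)"
        by (simp only: \<psi>.mult \<psi>.power uv(1))
    qed (intro degree_chart transversal_power_in_forms)
  qed
  ultimately have "bipoly.span (power_module (Suc s) i \<union> (\<lambda>y. line y ^ s * transversal y ^ i) ` (UNIV - {x})) \<subseteq> T"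
    by (intro bipoly.span_minimal[OF _ subspace]) auto
  then have in_T: "line x ^ s * transversal x ^ i \<in> T" using * by blast
  have chart_eq: "chart x (line x ^ s * transversal x ^ i) = monom 1 s"
    by (simp add: \<psi>.mult \<psi>.power chart_line chart_transversal monom_altdef)
  obtain g :: "'k poly" where g: "degree g \<le> i" "\<forall>k. i < k \<and> k \<le> s \<and> k mod (p - 1) = s mod (p - 1) \<longrightarrow>
      coeff (monom 1 s) k = coeff ([:1, 1:] ^ s * g) k"
    using in_T unfolding T_def mem_Collect_eq chart_eq by blast
  have "vanishes_on_class s i g"
    unfolding vanishes_on_class_def using g i by auto
  then have "coeff ([:1, 1:] ^ s * g) s = 0"
    using p_le s_ge by (rule vanishes_on_class_top)
  moreover have "i < s"
  proof -
    have "(i + 1) * (p + 1) = i * p + i + p + 1" by simp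
    moreover have "i \<le> i * p" using p_pos by simp
    ultimately show ?thesis using s_ge p_pos by linarith
  qed
  ultimately show False using g(2)[rule_format, of s] by simp
qed

text \<open>
  By \<open>form_decomposition\<close> the larger module arises from the smaller one by
  adjoining the element \<open>L\<^sup>s M\<^sup>i\<close> for each of the \<open>p +
  1\<close> points \<open>L\<close>, with \<open>M\<close> its transversal, and none of them
  is redundant.
\<close>

lemma dim_power_module_step:
  assumes "i < p" "p \<le> digit_sum p s" "s + i \<ge> (i + 1) * (p + 1)"
  shows "bipoly.dim (power_module s (Suc i) :: 'k bipoly set)
    = bipoly.dim (power_module (Suc s) i :: 'k bipoly set) + (p + 1)"
proof -
  have "bipoly.dim (power_module (Suc s) i \<union> range (\<lambda>x::'k option. line x ^ s * transversal x ^ i))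
      = bipoly.dim (power_module (Suc s) i :: 'k bipoly set) + card (UNIV :: 'k option set)"
  proof (rule bipoly.dim_union_independent_family)
    show "power_module (Suc s) i \<subseteq> bipoly.span ((\<lambda>n. bipoly_X ^ (Suc s + i - Suc n) * bipoly_Y ^ n) ` {..<Suc s + i})"
      using power_module_subset_forms[of "Suc s" i] by (simp only: forms_eq_span)
  qed (use power_not_in_span_of_others[OF assms] in auto)
  then show ?thesis
    unfolding power_module_step_span[of s i] bipoly.dim_span
    by (simp add: card_UNIV_option card_k)
qed

section \<open>The dimension formula\<close>

lemma dim_power_module_0: "bipoly.dim (power_module s 0 :: 'k bipoly set) = 0"
proof -
  have "(power_module s 0 :: 'k bipoly set) \<subseteq> {0}"
    using power_module_subset_forms[of s 0] unfolding power_module_def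
    by (intro bipoly.span_minimal) (auto simp: forms_0)
  then have "bipoly.dim (power_module s 0 :: 'k bipoly set) \<le> card ({} :: 'k bipoly set)"
    by (intro bipoly.dim_le_card) auto
  then show ?thesis by simp
qed

lemma dim_power_module_descend:
  assumes "e \<le> j" "j \<le> p" "j * (p + 1) \<le> r"
    and "\<And>i. e \<le> i \<Longrightarrow> i < j \<Longrightarrow> p \<le> digit_sum p (r - i)"
  shows "bipoly.dim (power_module (Suc r - j) j :: 'k bipoly set)
    = bipoly.dim (power_module (Suc r - e) e :: 'k bipoly set) + (j - e) * (p + 1)"
  using assms
proof (induction j rule: dec_induct)
  case (step i)
  have le: "i * (p + 1) \<le> r" "i \<le> r"
  proof -
    have "i * (p + 1) \<le> Suc i * (p + 1)" by (intro mult_le_mono1) simp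
    then show "i * (p + 1) \<le> r" using step.prems by linarith
    moreover have "i * 1 \<le> i * (p + 1)" by (intro mult_le_mono2) simp
    ultimately show "i \<le> r" by simp
  qed
  have "Suc (r - i) = Suc r - i" using le by simp
  then have top: "bipoly.dim (power_module (r - i) (Suc i) :: 'k bipoly set)
    = bipoly.dim (power_module (Suc r - i) i :: 'k bipoly set) + (p + 1)"
    using step.prems step.hyps le dim_power_module_step[of i "r - i"] by simp
  have rest: "bipoly.dim (power_module (Suc r - i) i :: 'k bipoly set)
    = bipoly.dim (power_module (Suc r - e) e :: 'k bipoly set) + (i - e) * (p + 1)"
    using step.prems le by (intro step.IH) auto
  have "Suc i - e = Suc (i - e)" using step.hyps by simp
  then have "(Suc i - e) * (p + 1) = (i - e) * (p + 1) + (p + 1)" by simp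
  then show ?case unfolding diff_Suc_Suc top rest by (simp only: add.assoc)
qed simp

lemma dim_power_module_no_carry:
  assumes "i \<le> r mod p" "i \<le> r"
  shows "digit_sum p (r - i) = r mod p - i + digit_sum p (r div p)"
    and "digit_sum p (r div p) \<le> i \<Longrightarrow>
      bipoly.dim (power_module (r - i) (Suc i) :: 'k bipoly set) = (r mod p + 1) * (digit_sum p (r div p) + 1)"
    and "i \<le> digit_sum p (r div p) \<Longrightarrow> digit_sum p (r - i) \<le> p \<Longrightarrow>
      bipoly.dim (power_module (r - i) (Suc i) :: 'k bipoly set) = (i + 1) * (digit_sum p (r - i) + 1)"
proof -
  have lt: "r mod p < p" using p_pos by simp
  have "r mod p - i + p * (r div p) + i = r" using assms by simp
  then have s: "r - i = (r mod p - i) + p * (r div p)" by simp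
  have s0: "(r - i) mod p = r mod p - i" "(r - i) div p = r div p"
    unfolding s using lt by auto
  show ds: "digit_sum p (r - i) = r mod p - i + digit_sum p (r div p)"
    using digit_sum_split[of "r mod p - i" "r div p"] lt unfolding s by simp
  show "bipoly.dim (power_module (r - i) (Suc i) :: 'k bipoly set) = (r mod p + 1) * (digit_sum p (r div p) + 1)"
    if "digit_sum p (r div p) \<le> i"
    using dim_power_module_filled[of "r - i" i] that lt assms unfolding s0 ds by simp
  show "bipoly.dim (power_module (r - i) (Suc i) :: 'k bipoly set) = (i + 1) * (digit_sum p (r - i) + 1)"
    if "i \<le> digit_sum p (r div p)" "digit_sum p (r - i) \<le> p"
    using dim_power_module_independent[of "r - i" i] that lt assms unfolding s0 by simp
qed

lemma digit_sum_borrow: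
  assumes "r mod p < i" "i < p" "i \<le> r"
  shows "digit_sum p (r - i) = p + r mod p - i + digit_sum p (r div p - 1)"
    and "(r - i) mod p = p + r mod p - i" and "(r - i) div p = r div p - 1"
proof -
  have "r div p \<noteq> 0"
  proof
    assume "r div p = 0"
    then have "r = r mod p" using p_pos by (simp add: div_eq_0_iff)
    then show False using assms by simp
  qed
  then have "p * (r div p) = p + p * (r div p - 1)" by (cases "r div p") auto
  then have "r = r mod p + p + p * (r div p - 1)" using mod_mult_div_eq[of r p] by linarith
  then have s: "r - i = (p + r mod p - i) + p * (r div p - 1)" using assms by linarith
  have lt: "p + r mod p - i < p" using assms p_pos by linarith
  show "digit_sum p (r - i) = p + r mod p - i + digit_sum p (r div p - 1)"
    using digit_sum_split[OF lt, of "r div p - 1"] unfolding s by simp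
  show "(r - i) mod p = p + r mod p - i" "(r - i) div p = r div p - 1"
    unfolding s using lt by (simp_all add: p_pos)
qed

text \<open>
  Here \<open>s\<^sub>0 + i = p + r\<^sub>0\<close> and \<open>s' = r div p - 1\<close>.  The
  lower bound on \<open>r\<close> excludes a one-digit \<open>s'\<close>, whose digit sum
  would be at least \<open>i\<close>; and the last digit of \<open>s'\<close> is less than
  \<open>p - 1\<close>, so \<open>r div p\<close> has digit sum one more than
  \<open>s'\<close>.
\<close>

lemma dim_power_module_borrow_small:
  assumes i: "r mod p < i" "i < p" and r: "(i + 1) * (p + 1) \<le> r" and \<sigma>: "digit_sum p (r - i) < p"
  shows "bipoly.dim (power_module (r - i) (Suc i) :: 'k bipoly set)
    = (p + r mod p + 1) * digit_sum p (r div p)"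
proof -
  define s' where "s' = r div p - 1"
  have "i \<le> (i + 1) * (p + 1)" by simp
  then have "i \<le> r" using r by simp
  note b = digit_sum_borrow[OF i this, folded s'_def]
  have N: "digit_sum p s' < i - r mod p" using b(1) \<sigma> i by linarith
  have "i + 1 \<le> r div p"
  proof -
    have "(i + 1) * p \<le> r" using r by simp
    then have "(i + 1) * p div p \<le> r div p" by (rule div_le_mono)
    then show ?thesis using p_pos by simp
  qed
  then have s': "r div p = Suc s'" "i \<le> s'" by (auto simp: s'_def)
  have split: "digit_sum p s' = s' mod p + digit_sum p (s' div p)"
    by (rule digit_sum_mod_div[OF p_ge_2])
  have mod: "s' mod p + 1 < p" using N split i by linarith
  have "s' div p \<noteq> 0"
  proof
    assume "s' div p = 0"
    then have "s' < p" using p_pos by (simp add: div_eq_0_iff)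
    then show False using N s' by (simp add: digit_sum_lt_p)
  qed
  then have high: "1 \<le> digit_sum p (s' div p)" using digit_sum_eq_0_iff[OF p_ge_2, of "s' div p"] by linarith
  have "bipoly.dim (power_module (r - i) (Suc i) :: 'k bipoly set)
    = (p + r mod p - i + i + 1) * (digit_sum p s' + 1)"
    using dim_power_module_filled[of "r - i" i] N \<sigma> mod high i p_pos unfolding b(2,3) by simp
  moreover have "digit_sum p (r div p) = digit_sum p s' + 1"
  proof -
    have "r div p = (s' mod p + 1) + p * (s' div p)" using s' by simp
    then have "digit_sum p (r div p) = (s' mod p + 1) + digit_sum p (s' div p)"
      by (simp only: digit_sum_split[OF mod])
    then show ?thesis using split by simp
  qed
  ultimately show ?thesis using i by simp
qed

end

theorem corollary1p3:
  fixes p i r r0 :: nat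
    and X :: "'k::{field, finite} bipoly set"
  assumes "prime p" and "p \<ge> 3"
    and "CARD('k) = p"
    and "i \<le> p - 1"
    and "r \<ge> (i + 1) * (p + 1)"
    and "r0 = r mod p"
    and "X = monomial_submodule (r - i) i"
  shows
    "(r0 \<ge> i \<longrightarrow>
        (digit_sum p (r - i) \<le> r0 \<longrightarrow>
          bipoly.dim X = (r0 + 1) * (digit_sum p (r - r0) + 1)) \<and>
        (r0 \<le> digit_sum p (r - i) \<and> digit_sum p (r - i) \<le> p \<longrightarrow>
          bipoly.dim X = (i + 1) * (digit_sum p (r - i) + 1)) \<and>
        (digit_sum p (r - i) \<ge> p \<longrightarrow>
          bipoly.dim X = (i + 1) * (p + 1))) \<and>
     (r0 < i \<longrightarrow>
        (digit_sum p (r - i) < p \<longrightarrow>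
          bipoly.dim X = (p + r0 + 1) * digit_sum p (r - r0)) \<and>
        (digit_sum p (r - i) \<ge> p \<and> digit_sum p (r - r0) \<le> p \<longrightarrow>
          bipoly.dim X = (i - r0) * (p + 1) + (digit_sum p (r - r0) + 1) * (r0 + 1)) \<and>
        (digit_sum p (r - i) \<ge> p \<and> digit_sum p (r - r0) \<ge> p \<longrightarrow>
          bipoly.dim X = (i + 1) * (p + 1)))"
proof -
  interpret prime_field p "TYPE('k)"
    by unfold_locales (use assms in auto)
  have ip: "i < p" using assms(2,4) by simp
  have r: "(i + 1) * (p + 1) \<le> r" using assms(5) .
  have "i \<le> (i + 1) * (p + 1)" by simp
  then have ir: "i \<le> r" using r by simp
  have r0_le: "r0 \<le> r" "r0 < p" using assms(6) p_pos by auto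
  have X: "X = power_module (r - i) (Suc i)"
    using monomial_submodule_eq_power_module[OF ip] assms(7) by simp
  define N where "N = digit_sum p (r div p)"
  have ds_r0: "digit_sum p (r - r0) = N"
    using dim_power_module_no_carry(1)[of r0 r] r0_le assms(6) by (simp add: N_def)
  have no_carry: "digit_sum p (r - j) = r0 - j + N" if "j \<le> r0" for j
    using dim_power_module_no_carry(1)[of j r] that r0_le assms(6) by (simp add: N_def)
  have borrow: "p \<le> digit_sum p (r - j)" if i: "r0 < i" and \<sigma>: "p \<le> digit_sum p (r - i)" and j: "r0 < j" "j \<le> i" for j
  proof -
    have "digit_sum p (r - i) = p + r0 - i + digit_sum p (r div p - 1)"
      "digit_sum p (r - j) = p + r0 - j + digit_sum p (r div p - 1)"
      using digit_sum_borrow(1)[of r i] digit_sum_borrow(1)[of r j] i j ip ir assms(6) by simp_all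
    then show ?thesis using \<sigma> j by linarith
  qed
  have full: "bipoly.dim X = (i + 1) * (p + 1)" if "\<And>j. j \<le> i \<Longrightarrow> p \<le> digit_sum p (r - j)"
    using dim_power_module_descend[of 0 "Suc i" r] that ip r by (simp add: X dim_power_module_0)
  show ?thesis
  proof (intro conjI impI; (elim conjE)?)
    assume i: "i \<le> r0" and \<sigma>: "digit_sum p (r - i) \<le> r0"
    then show "bipoly.dim X = (r0 + 1) * (digit_sum p (r - r0) + 1)"
      using dim_power_module_no_carry(2)[of i r] ir assms(6) no_carry[of i] ds_r0 by (simp add: X N_def)
  next
    assume "i \<le> r0" "r0 \<le> digit_sum p (r - i)" "digit_sum p (r - i) \<le> p"
    then show "bipoly.dim X = (i + 1) * (digit_sum p (r - i) + 1)"
      using dim_power_module_no_carry(3)[of i r] ir assms(6) no_carry[of i] by (simp add: X N_def)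
  next
    assume "i \<le> r0" "p \<le> digit_sum p (r - i)"
    then show "bipoly.dim X = (i + 1) * (p + 1)"
      using no_carry by (intro full) fastforce
  next
    assume "r0 < i" "digit_sum p (r - i) < p"
    then show "bipoly.dim X = (p + r0 + 1) * digit_sum p (r - r0)"
      using dim_power_module_borrow_small[of r i] ip r assms(6) ds_r0 by (simp add: X N_def)
  next
    assume i: "r0 < i" and \<sigma>: "p \<le> digit_sum p (r - i)" and N: "digit_sum p (r - r0) \<le> p"
    have "bipoly.dim X = bipoly.dim (power_module (r - r0) (Suc r0) :: 'k bipoly set) + (i - r0) * (p + 1)"
      using dim_power_module_descend[of "Suc r0" "Suc i" r] borrow[OF i \<sigma>] i ip r by (simp add: X)
    also have "bipoly.dim (power_module (r - r0) (Suc r0) :: 'k bipoly set) = (N + 1) * (r0 + 1)"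
    proof (cases "N \<le> r0")
      case True
      then show ?thesis
        using dim_power_module_no_carry(2)[of r0 r] r0_le assms(6) by (simp add: N_def)
    next
      case False
      then show ?thesis
        using dim_power_module_no_carry(3)[of r0 r] r0_le assms(6) N ds_r0 by (simp add: N_def)
    qed
    finally show "bipoly.dim X = (i - r0) * (p + 1) + (digit_sum p (r - r0) + 1) * (r0 + 1)"
      by (simp add: ds_r0)
  next
    assume i: "r0 < i" and \<sigma>: "p \<le> digit_sum p (r - i)" and N: "p \<le> digit_sum p (r - r0)"
    show "bipoly.dim X = (i + 1) * (p + 1)"
    proof (rule full)
      fix j assume j: "j \<le> i"
      show "p \<le> digit_sum p (r - j)"
      proof (cases "j \<le> r0")
        case True
        then show ?thesis using no_carry[of j] N ds_r0 by simp
      next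
        case False
        then show ?thesis using borrow[OF i \<sigma>, of j] j by simp
      qed
    qed
  qed
qed

end
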